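(* Let $\mathcal{U}$ be a stable ordered-union ultrafilter on $\mathrm{FIN}$, and let $\mathcal{V}$ be a nonprincipal ultrafilter on a countable index set $I$ with $\mathcal{U} \geq_T \mathcal{V}$. Then $\mathcal{V}$ is isomorphic to an ultrafilter from the class $\mathcal{C}_{\omega_1}$ (the class of countable Fubini iterates of $\mathcal{U}, \mathcal{U}_{\min}, \mathcal{U}_{\max}, \mathcal{U}_{\operatorname{minmax}}$ defined in the context).
   Context: All ultrafilters are on countable base sets. $\mathrm{FIN}$ is the set of all finite nonempty subsets of $\omega$. An infinite block sequence is a map $X : \omega \to \mathrm{FIN}$ with $\max(X(i)) < \min(X(i+1))$ for all $i$; $\mathrm{FIN}^{[\infty]}$ is the set of all infinite block sequences. For $X \in \mathrm{FIN}^{[\infty]}$, $[X] = \{ \bigcup_{i \in F} X(i) : F \subseteq \omega \text{ finite nonempty}\} \subseteq \mathrm{FIN}$. Write $X \leq Y$ iff $X(i) \in [Y]$ for all $i$. For $n\in\omega$, $X/n = (X(i))_{i \geq i_0}$ (re-indexed from $0$), where $i_0$ is least with $\min(X(i_0)) > n$. Write $X \leq^* Y$ iff there is $n \in \omega$ with $X/n \leq Y$. An ultrafilter $\mathcal{U}$ on $\mathrm{FIN}$ is ordered-union if it has a filter base all of whose members have the form $[X]$ for some $X \in \mathrm{FIN}^{[\infty]}$. It is stable ordered-union if it is ordered-union and for every sequence $(X_i)_{i \in \omega}$ in $\mathrm{FIN}^{[\infty]}$ with $[X_i] \in \mathcal{U}$ and $X_{i+1} \leq^* X_i$ for all $i$,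 there is $X\in\mathrm{FIN}^{[\infty]}$ with $[X] \in \mathcal{U}$ and $X \leq^* X_i$ for all $i$. For an ultrafilter $\mathcal{V}$ on $I_1$ and a map $f : I_1 \to I_2$, the RK-image is $f(\mathcal{V}) = \{Y \subseteq I_2 : f^{-1}(Y) \in \mathcal{V}\}$. Ultrafilters $\mathcal{V}$ on $I_1$ and $\mathcal{W}$ on $I_2$ are isomorphic (Rudin-Keisler equivalent) if there are maps $f_1: I_1 \to I_2$ and $f_2 : I_2 \to I_1$ with $f_1(\mathcal{V}) = \mathcal{W}$ and $f_2(\mathcal{W}) = \mathcal{V}$. Let $\min, \max : \mathrm{FIN} \to \omega$ give the least and greatest elements, and let $\operatorname{minmax} : \mathrm{FIN} \to \omega^2$, $\operatorname{minmax}(s) = (\min(s), \max(s))$. Let $\mathcal{U}_{\min}, \mathcal{U}_{\max}, \mathcal{U}_{\operatorname{minmax}}$ be the RK-images of $\mathcal{U}$ under $\min, \max, \operatorname{minmax}$ respectively. A filter base for an ultrafilter $\mathcal{V}$ is a set $\mathcal{B} \subseteq \mathcal{V}$ such that every $V \in \mathcal{V}$ contains some $B \in \mathcal{B}$. $\mathcal{V} \leq_T \mathcal{W}$ (equivalently $\mathcal{W} \geq_T \mathcal{V}$; $\mathcal{V}$ is Tukey reducible to $\mathcal{W}$) means there is a map $f : \mathcal{W} \to \mathcal{V}$ such that for every filter base $\mathcal{B}$ for $\mathcal{W}$, $f[\mathcal{B}]$ is a filter base for $\mathcal{V}$. Fubini limit: for an ultrafilter $\mathcal{V}$ on $I$ and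 ultrafilters $\mathcal{W}_i$ on $A$ ($i \in I$), $\lim_{i \to \mathcal{V}} \mathcal{W}_i = \{X \subseteq I \times A : \{i \in I : \{a \in A : (i,a) \in X\} \in \mathcal{W}_i\} \in \mathcal{V}\}$, an ultrafilter on $I \times A$. Classes $\mathcal{C}_\alpha$: here all ultrafilters on $\mathrm{FIN}$, $\omega^2$ and $\omega\times\omega$ are regarded as ultrafilters on $\omega$ by transporting them along fixed bijections with $\omega$. Put $\mathcal{C}_0 = \{\mathcal{U}, \mathcal{U}_{\min}, \mathcal{U}_{\max}, \mathcal{U}_{\operatorname{minmax}}\}$; $\mathcal{C}_{\alpha+1} = \{\lim_{x \to \mathcal{V}} \mathcal{W}_x : \mathcal{V} \in \mathcal{C}_0, \text{ and each } \mathcal{W}_x \in \mathcal{C}_\alpha\}$; $\mathcal{C}_\gamma = \bigcup_{\alpha < \gamma} \mathcal{C}_\alpha$ for countable limit ordinals $\gamma$; and $\mathcal{C}_{\omega_1} = \bigcup_{\alpha < \omega_1} \mathcal{C}_\alpha$. *)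

theory Defs
  imports "HOL-Library.Countable_Set" "HOL-Library.FuncSet"
begin

section \<open>Ultrafilters on sets\<close>

definition ultrafilter_on :: "'a set \<Rightarrow> 'a set set \<Rightarrow> bool" where
  "ultrafilter_on I V \<longleftrightarrow>
     V \<subseteq> Pow I \<and> I \<in> V \<and> {} \<notin> V \<and>
     (\<forall>A\<in>V. \<forall>B\<in>V. A \<inter> B \<in> V) \<and>
     (\<forall>A\<in>V. \<forall>B. A \<subseteq> B \<and> B \<subseteq> I \<longrightarrow> B \<in> V) \<and>
     (\<forall>A. A \<subseteq> I \<longrightarrow> A \<in> V \<or> I - A \<in> V)"

definition nonprincipal_on :: "'a set \<Rightarrow> 'a set set \<Rightarrow> bool" where
  "nonprincipal_on I V \<longleftrightarrow> \<not> (\<exists>x\<in>I. V = {A. A \<subseteq> I \<and> x \<in> A})"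

definition filter_base :: "'a set set \<Rightarrow> 'a set set \<Rightarrow> bool" where
  "filter_base V B \<longleftrightarrow> B \<subseteq> V \<and> (\<forall>A\<in>V. \<exists>b\<in>B. b \<subseteq> A)"

definition tukey_le :: "'a set set \<Rightarrow> 'b set set \<Rightarrow> bool" (infix "\<le>\<^sub>T" 50) where
  "V \<le>\<^sub>T W \<longleftrightarrow> (\<exists>f. f \<in> W \<rightarrow> V \<and> (\<forall>B. filter_base W B \<longrightarrow> filter_base V (f ` B)))"

text \<open>Rudin--Keisler image under a map from \<open>I\<close> to \<open>J\<close>; the base sets are explicit
  because HOL maps are total on their types.\<close>

definition rk_image :: "'a set \<Rightarrow> 'b set \<Rightarrow> ('a \<Rightarrow> 'b) \<Rightarrow> 'a set set \<Rightarrow> 'b set set" where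
  "rk_image I J f V = {Y. Y \<subseteq> J \<and> f -` Y \<inter> I \<in> V}"

definition rk_isomorphic :: "'a set \<Rightarrow> 'a set set \<Rightarrow> 'b set \<Rightarrow> 'b set set \<Rightarrow> bool" where
  "rk_isomorphic I V J W \<longleftrightarrow>
     (\<exists>f g. f \<in> I \<rightarrow> J \<and> g \<in> J \<rightarrow> I \<and> rk_image I J f V = W \<and> rk_image J I g W = V)"

definition fubini_lim ::
  "'i set \<Rightarrow> 'a set \<Rightarrow> 'i set set \<Rightarrow> ('i \<Rightarrow> 'a set set) \<Rightarrow> ('i \<times> 'a) set set" where
  "fubini_lim I A V W = {X. X \<subseteq> I \<times> A \<and> {i\<in>I. {a\<in>A. (i, a) \<in> X} \<in> W i} \<in> V}"


section \<open>Block sequences and stable ordered-union ultrafilters\<close>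

definition FIN :: "nat set set" where
  "FIN = {s. finite s \<and> s \<noteq> {}}"

definition block_seq :: "(nat \<Rightarrow> nat set) \<Rightarrow> bool" where
  "block_seq X \<longleftrightarrow> (\<forall>i. X i \<in> FIN) \<and> (\<forall>i. Max (X i) < Min (X (Suc i)))"

text \<open>\<open>block_span X\<close> is \<open>[X]\<close>, and \<open>block_tail X n\<close> is \<open>X/n\<close>.\<close>

definition block_span :: "(nat \<Rightarrow> nat set) \<Rightarrow> nat set set" where
  "block_span X = {\<Union>i\<in>F. X i | F. finite F \<and> F \<noteq> {}}"

definition block_le :: "(nat \<Rightarrow> nat set) \<Rightarrow> (nat \<Rightarrow> nat set) \<Rightarrow> bool" where
  "block_le X Y \<longleftrightarrow> (\<forall>i. X i \<in> block_span Y)"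

definition block_tail :: "(nat \<Rightarrow> nat set) \<Rightarrow> nat \<Rightarrow> nat \<Rightarrow> nat set" where
  "block_tail X n = (\<lambda>i. X ((LEAST i\<^sub>0. n < Min (X i\<^sub>0)) + i))"

definition block_le_star :: "(nat \<Rightarrow> nat set) \<Rightarrow> (nat \<Rightarrow> nat set) \<Rightarrow> bool" where
  "block_le_star X Y \<longleftrightarrow> (\<exists>n. block_le (block_tail X n) Y)"

definition ordered_union :: "nat set set set \<Rightarrow> bool" where
  "ordered_union U \<longleftrightarrow> ultrafilter_on FIN U \<and>
     (\<exists>B. filter_base U B \<and> (\<forall>b\<in>B. \<exists>X. block_seq X \<and> b = block_span X))"

definition stable_ordered_union :: "nat set set set \<Rightarrow> bool" where
  "stable_ordered_union U \<longleftrightarrow> ordered_union U \<and>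
     (\<forall>Xs :: nat \<Rightarrow> nat \<Rightarrow> nat set.
        (\<forall>i. block_seq (Xs i) \<and> block_span (Xs i) \<in> U \<and> block_le_star (Xs (Suc i)) (Xs i)) \<longrightarrow>
        (\<exists>X. block_seq X \<and> block_span X \<in> U \<and> (\<forall>i. block_le_star X (Xs i))))"

definition minmax :: "nat set \<Rightarrow> nat \<times> nat" where
  "minmax s = (Min s, Max s)"


section \<open>Countable Fubini iterates\<close>

text \<open>The ordinals below the first uncountable ordinal are the elements of the field of the
  well-order \<open>omega1\<close>.\<close>

definition omega1 :: "nat set rel" where
  "omega1 = cardSuc natLeq"

lemma Card_order_omega1: "Card_order omega1"
  unfolding omega1_def by (rule cardSuc_Card_order[OF natLeq_Card_order])

lemma Well_order_omega1: "Well_order omega1"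
  using Card_order_omega1 unfolding card_order_on_def by blast

definition is_zero1 :: "nat set \<Rightarrow> bool" where
  "is_zero1 \<alpha> \<longleftrightarrow> Order_Relation.underS omega1 \<alpha> = {}"

definition is_succ1 :: "nat set \<Rightarrow> nat set \<Rightarrow> bool" where
  "is_succ1 \<beta> \<alpha> \<longleftrightarrow> \<beta> \<in> Order_Relation.underS omega1 \<alpha> \<and>
     (\<forall>\<delta>\<in>Order_Relation.underS omega1 \<alpha>. (\<delta>, \<beta>) \<in> omega1)"

text \<open>The parameters \<open>e\<close> and \<open>p\<close> are the fixed bijections from \<open>FIN\<close> and from
  \<open>\<omega> \<times> \<omega>\<close> to \<open>\<omega>\<close> along which ultrafilters are transported.\<close>

definition fubini_class0 ::
  "(nat set \<Rightarrow> nat) \<Rightarrow> (nat \<times> nat \<Rightarrow> nat) \<Rightarrow> nat set set set \<Rightarrow> nat set set set" where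
  "fubini_class0 e p U =
     {rk_image FIN UNIV e U,
      rk_image FIN UNIV Min U,
      rk_image FIN UNIV Max U,
      rk_image UNIV UNIV p (rk_image FIN UNIV minmax U)}"

definition fubini_step ::
  "(nat \<times> nat \<Rightarrow> nat) \<Rightarrow> nat set set set \<Rightarrow> nat set set set \<Rightarrow> nat set set set" where
  "fubini_step p C\<^sub>0 C =
     {rk_image UNIV UNIV p (fubini_lim UNIV UNIV V W) | V W. V \<in> C\<^sub>0 \<and> (\<forall>x. W x \<in> C)}"

definition fubini_class ::
  "(nat set \<Rightarrow> nat) \<Rightarrow> (nat \<times> nat \<Rightarrow> nat) \<Rightarrow> nat set set set \<Rightarrow> nat set \<Rightarrow> nat set set set" where
  "fubini_class e p U = wo_rel.worec omega1 (\<lambda>C \<alpha>.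
     if is_zero1 \<alpha> then fubini_class0 e p U
     else if \<exists>\<beta>. is_succ1 \<beta> \<alpha>
       then fubini_step p (fubini_class0 e p U) (C (THE \<beta>. is_succ1 \<beta> \<alpha>))
     else (\<Union>\<beta>\<in>Order_Relation.underS omega1 \<alpha>. C \<beta>))"

definition fubini_class_omega1 ::
  "(nat set \<Rightarrow> nat) \<Rightarrow> (nat \<times> nat \<Rightarrow> nat) \<Rightarrow> nat set set set \<Rightarrow> nat set set set" where
  "fubini_class_omega1 e p U = (\<Union>\<alpha>\<in>Field omega1. fubini_class e p U \<alpha>)"

lemma is_succ1_unique:
  assumes "is_succ1 \<beta> \<alpha>"
  shows "(THE \<gamma>. is_succ1 \<gamma> \<alpha>) = \<beta>"
proof (rule the_equality)
  show "is_succ1 \<beta> \<alpha>" by (fact assms)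
next
  fix \<gamma> assume "is_succ1 \<gamma> \<alpha>"
  with assms have "(\<gamma>, \<beta>) \<in> omega1" "(\<beta>, \<gamma>) \<in> omega1"
    unfolding is_succ1_def by auto
  with wo_rel.ANTISYM[of omega1] Well_order_omega1 show "\<gamma> = \<beta>"
    unfolding wo_rel_def antisym_def by blast
qed

lemma fubini_class_unfold:
  "fubini_class e p U \<alpha> =
    (if is_zero1 \<alpha> then fubini_class0 e p U
     else if \<exists>\<beta>. is_succ1 \<beta> \<alpha>
       then fubini_step p (fubini_class0 e p U) (fubini_class e p U (THE \<beta>. is_succ1 \<beta> \<alpha>))
     else (\<Union>\<beta>\<in>Order_Relation.underS omega1 \<alpha>. fubini_class e p U \<beta>))"
proof -
  let ?H = "\<lambda>C \<alpha>. if is_zero1 \<alpha> then fubini_class0 e p U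
     else if \<exists>\<beta>. is_succ1 \<beta> \<alpha>
       then fubini_step p (fubini_class0 e p U) (C (THE \<beta>. is_succ1 \<beta> \<alpha>))
     else (\<Union>\<beta>\<in>Order_Relation.underS omega1 \<alpha>. C \<beta>)"
  have wo: "wo_rel omega1"
    using Well_order_omega1 by (simp add: wo_rel_def)
  have "wo_rel.adm_wo omega1 ?H"
    unfolding wo_rel.adm_wo_def[OF wo]
  proof (intro allI impI)
    fix f g :: "nat set \<Rightarrow> nat set set set" and \<alpha>
    assume eq: "\<forall>\<beta>\<in>Order_Relation.underS omega1 \<alpha>. f \<beta> = g \<beta>"
    have "f (THE \<beta>. is_succ1 \<beta> \<alpha>) = g (THE \<beta>. is_succ1 \<beta> \<alpha>)" if "is_succ1 \<beta> \<alpha>" for \<beta>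
      using that eq is_succ1_unique[OF that] unfolding is_succ1_def by auto
    with eq show "?H f \<alpha> = ?H g \<alpha>"
      by (cases "\<exists>\<beta>. is_succ1 \<beta> \<alpha>") auto
  qed
  from fun_cong[OF wo_rel.worec_fixpoint[OF wo this], of \<alpha>] show ?thesis
    unfolding fubini_class_def .
qed

lemma fubini_class_zero:
  "is_zero1 \<alpha> \<Longrightarrow> fubini_class e p U \<alpha> = fubini_class0 e p U"
  by (subst fubini_class_unfold) simp

lemma fubini_class_succ:
  assumes "is_succ1 \<beta> \<alpha>"
  shows "fubini_class e p U \<alpha> = fubini_step p (fubini_class0 e p U) (fubini_class e p U \<beta>)"
proof -
  have "\<not> is_zero1 \<alpha>"
    using assms unfolding is_zero1_def is_succ1_def by blast
  then show ?thesis
    by (subst fubini_class_unfold) (use assms is_succ1_unique[OF assms] in auto)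
qed

lemma fubini_class_lim:
  assumes "\<not> is_zero1 \<alpha>" "\<nexists>\<beta>. is_succ1 \<beta> \<alpha>"
  shows "fubini_class e p U \<alpha> = (\<Union>\<beta>\<in>Order_Relation.underS omega1 \<alpha>. fubini_class e p U \<beta>)"
  by (subst fubini_class_unfold) (use assms in simp)

end

theory Submission
  imports Defs
begin

text \<open>
  Ultrafilters are treated as quantifiers: \<open>most V P\<close> says that \<open>P\<close> holds on a set in \<open>V\<close>, and
  \<open>lim D W\<close> is the ultrafilter of sets that lie in \<open>W x\<close> for \<open>D\<close>-most \<open>x\<close>. Such a limit is called
  discrete if one map \<open>g\<close> is constantly \<open>x\<close> on a set in \<open>W x\<close>, for most \<open>x\<close>; then the index can be read
  off from the result, so the limit is isomorphic to the Fubini limit. Let \<open>iterate\<close> be the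
  closure of the principal ultrafilters under discrete limits along \<open>U\<close>, \<open>U_min\<close> and \<open>U_max\<close>. The proof
  has three parts.

  \<^bold>\<open>A Tukey reduction yields a well-founded tree of questions.\<close> The reduction gives a monotone map \<open>T\<close>
  on the block sequences with span in \<open>U\<close>, whose values form a base of \<open>V\<close>. Call a finite set \<open>S\<close> of
  blocks settled if some \<open>i\<close> lies in \<open>T X\<close> for all \<open>X\<close> whose span includes \<open>S\<close>, or if \<open>insert t S\<close> is settled for most \<open>t\<close>.
  If \<open>{}\<close> were not settled, a diagonal sequence \<open>Z\<close> would have \<open>T Z = {}\<close> (lemma \<open>empty_settled\<close>). Hence it
  is settled, and taking limits along \<open>U\<close> down the recursion produces an ultrafilter that
  contains all \<open>T X\<close> and therefore equals \<open>V\<close>.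

  \<^bold>\<open>Limits along \<open>U\<close> can be made discrete\<close> (theorem \<open>iterate_lim\<close>). Let \<open>F s\<close> be in \<open>iterate\<close> for all \<open>s\<close> and
  let \<open>tail_lim F s\<close> be the limit of \<open>F (s \<union> t)\<close> over \<open>t\<close>: what is known after \<open>s\<close>, if \<open>s\<close> is only the
  beginning of a block. By \<open>trichotomy\<close>, on some span in \<open>U\<close> this is constant, or depends exactly on
  \<open>Min s\<close>, or is injective. In the first case \<open>F s\<close> is constant or depends only on \<open>Max s\<close>
  (\<open>closing_case\<close>). In the second, \<open>lim U F\<close> is a discrete limit along \<open>U_min\<close> of ultrafilters of the
  first kind (\<open>min_case\<close>); this is where the Fubini product of \<open>U_min\<close> and \<open>U_max\<close> appears,
  which is isomorphic to \<open>U_minmax\<close>. In the third, either the end of the block matters, and \<open>F\<close>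
  itself is discrete (\<open>splitting_case\<close>), or \<open>F s = tail_lim F s\<close>. Then \<open>F s\<close> is the discrete limit of some \<open>P s u\<close>,
  necessarily over \<open>u\<close> along \<open>U\<close>, and uniqueness of discrete representations gives
  \<open>P (s \<union> t) u = P s (t \<union> u)\<close>. So there is one family \<open>Z\<close> with \<open>Z (s \<union> t) = P s t\<close>; it has the same limit as \<open>F\<close>,
  and \<open>splitting_case\<close> applies to it (\<open>continuing_case\<close>).

  \<^bold>\<open>The members of \<open>iterate\<close> lie in the Fubini classes.\<close> Countably many countable ordinals have a
  countable limit ordinal above them, so the union of the classes is closed under Fubini limits
  along \<open>U\<close>, \<open>U_min\<close> and \<open>U_max\<close>.
\<close>

section \<open>Ultrafilters as quantifiers\<close>

lemma principal_ultrafilter: "ultrafilter_on UNIV {A. a \<in> A}"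
  unfolding ultrafilter_on_def by auto

text \<open>A type of ultrafilters on a whole type makes all laws of the quantifier unconditional. An
  ultrafilter on a set \<open>I\<close> is embedded by \<open>ultra_on\<close> below.\<close>

typedef 'a ultra = "{V :: 'a set set. ultrafilter_on UNIV V}"
  using principal_ultrafilter by (intro exI) (rule CollectI)

definition most :: "'a ultra \<Rightarrow> ('a \<Rightarrow> bool) \<Rightarrow> bool" where
  "most V P \<longleftrightarrow> {x. P x} \<in> Rep_ultra V"

lemma Rep_ultra_ultrafilter: "ultrafilter_on UNIV (Rep_ultra V)"
  using Rep_ultra by blast

lemma most_mono: "most V P \<Longrightarrow> (\<And>x. P x \<Longrightarrow> Q x) \<Longrightarrow> most V Q"
proof -
  assume "most V P" "\<And>x. P x \<Longrightarrow> Q x"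
  moreover have "\<And>A B. A \<in> Rep_ultra V \<Longrightarrow> A \<subseteq> B \<Longrightarrow> B \<in> Rep_ultra V"
    using Rep_ultra_ultrafilter[of V] unfolding ultrafilter_on_def by blast
  moreover have "{x. P x} \<subseteq> {x. Q x}" using calculation(2) by auto
  ultimately show ?thesis unfolding most_def by blast
qed

lemma most_const [simp]: "most V (\<lambda>_. c) = c"
proof -
  have "UNIV \<in> Rep_ultra V" "{} \<notin> Rep_ultra V"
    using Rep_ultra_ultrafilter[of V] unfolding ultrafilter_on_def by blast+
  then show ?thesis by (cases c) (simp_all add: most_def)
qed

lemma most_conj [simp]: "most V (\<lambda>x. P x \<and> Q x) \<longleftrightarrow> most V P \<and> most V Q"
proof
  assume "most V P \<and> most V Q"
  moreover have "\<And>A B. A \<in> Rep_ultra V \<Longrightarrow> B \<in> Rep_ultra V \<Longrightarrow> A \<inter> B \<in> Rep_ultra V"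
    using Rep_ultra_ultrafilter[of V] unfolding ultrafilter_on_def by blast
  moreover have "{x. P x \<and> Q x} = {x. P x} \<inter> {x. Q x}" by auto
  ultimately show "most V (\<lambda>x. P x \<and> Q x)" unfolding most_def by simp
next
  assume *: "most V (\<lambda>x. P x \<and> Q x)"
  show "most V P \<and> most V Q"
    by (rule conjI; rule most_mono[OF *]) simp_all
qed

lemma most_not [simp]: "most V (\<lambda>x. \<not> P x) \<longleftrightarrow> \<not> most V P"
proof -
  have "{x. P x} \<in> Rep_ultra V \<or> UNIV - {x. P x} \<in> Rep_ultra V"
    using Rep_ultra_ultrafilter[of V] unfolding ultrafilter_on_def by blast
  moreover have "UNIV - {x. P x} = {x. \<not> P x}" by auto
  ultimately have "most V P \<or> most V (\<lambda>x. \<not> P x)" unfolding most_def by simp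
  moreover have "\<not> (most V P \<and> most V (\<lambda>x. \<not> P x))"
    using most_conj[of V P "\<lambda>x. \<not> P x"] by simp
  ultimately show ?thesis by blast
qed

lemma most_disj [simp]: "most V (\<lambda>x. P x \<or> Q x) \<longleftrightarrow> most V P \<or> most V Q"
  using most_not[of V "\<lambda>x. \<not> P x \<and> \<not> Q x"] most_not[of V P] most_not[of V Q]
    most_conj[of V "\<lambda>x. \<not> P x" "\<lambda>x. \<not> Q x"] unfolding de_Morgan_conj not_not by blast

lemma most_imp [simp]: "most V (\<lambda>x. P x \<longrightarrow> Q x) \<longleftrightarrow> (most V P \<longrightarrow> most V Q)"
  using most_disj[of V "\<lambda>x. \<not> P x" Q] most_not[of V P] unfolding imp_conv_disj by blast

lemma most_ball_finite:
  "finite F \<Longrightarrow> most V (\<lambda>x. \<forall>i\<in>F. P i x) \<longleftrightarrow> (\<forall>i\<in>F. most V (P i))"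
  by (induction F rule: finite_induct) auto

lemma most_bex_finite:
  "finite F \<Longrightarrow> most V (\<lambda>x. \<exists>i\<in>F. P i x) \<longleftrightarrow> (\<exists>i\<in>F. most V (P i))"
  by (induction F rule: finite_induct) auto

lemma most_ex: "most V P \<Longrightarrow> \<exists>x. P x"
  using most_const[of V False] most_mono[of V P "\<lambda>_. False"] by blast

lemma most_cong: "most V (\<lambda>x. P x = Q x) \<Longrightarrow> most V P = most V Q"
proof -
  assume "most V (\<lambda>x. P x = Q x)"
  then have "most V (\<lambda>x. (P x \<longrightarrow> Q x) \<and> (Q x \<longrightarrow> P x))" by (rule most_mono) simp
  then show ?thesis by auto
qed

lemma ultra_eqI: "(\<And>P. most V P = most W P) \<Longrightarrow> V = W"
proof -
  assume *: "\<And>P. most V P = most W P"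
  have "A \<in> Rep_ultra V \<longleftrightarrow> A \<in> Rep_ultra W" for A
    using *[of "\<lambda>x. x \<in> A"] by (simp add: most_def)
  then show ?thesis using Rep_ultra_inject by blast
qed

lemma ultra_eqI': "(\<And>P. most V P \<Longrightarrow> most W P) \<Longrightarrow> V = W"
  by (rule ultra_eqI) (metis most_not)

lemma ultra_separate: "V \<noteq> W \<Longrightarrow> \<exists>P. most V P \<and> \<not> most W P"
  using ultra_eqI' by blast

lemma separate_family: "\<exists>C. \<forall>t. V t \<noteq> W t \<longrightarrow> most (V t) (C t) \<and> \<not> most (W t) (C t)"
  by (intro choice allI) (use ultra_separate in blast)

text \<open>The converse reading: a quantifier that commutes with negation and conjunction and is monotone
  determines an ultrafilter. The three constructions below are given by their quantifiers.\<close>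

definition ultra_of :: "(('a \<Rightarrow> bool) \<Rightarrow> bool) \<Rightarrow> 'a ultra" where
  "ultra_of M = Abs_ultra {A. M (\<lambda>x. x \<in> A)}"

lemma most_ultra_of:
  assumes "M (\<lambda>_. True)" "\<And>P. M (\<lambda>x. \<not> P x) \<longleftrightarrow> \<not> M P"
    "\<And>P Q. M P \<Longrightarrow> M Q \<Longrightarrow> M (\<lambda>x. P x \<and> Q x)"
    "\<And>P Q. M P \<Longrightarrow> (\<And>x. P x \<Longrightarrow> Q x) \<Longrightarrow> M Q"
  shows "most (ultra_of M) P = M P"
proof -
  have "ultrafilter_on UNIV {A. M (\<lambda>x. x \<in> A)}"
    unfolding ultrafilter_on_def
  proof (intro conjI ballI allI impI)
    show "{} \<notin> {A. M (\<lambda>x. x \<in> A)}"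
      using assms(1) assms(2)[of "\<lambda>_. True"] by simp
  next
    fix A B assume "A \<in> {A. M (\<lambda>x. x \<in> A)}" "A \<subseteq> B \<and> B \<subseteq> UNIV"
    then show "B \<in> {A. M (\<lambda>x. x \<in> A)}"
      using assms(4)[of "\<lambda>x. x \<in> A" "\<lambda>x. x \<in> B"] by auto
  next
    fix A
    show "A \<in> {A. M (\<lambda>x. x \<in> A)} \<or> UNIV - A \<in> {A. M (\<lambda>x. x \<in> A)}"
      using assms(2)[of "\<lambda>x. x \<in> A"] by simp
  qed (use assms in auto)
  then show ?thesis
    unfolding most_def ultra_of_def by (simp add: Abs_ultra_inverse)
qed

definition point :: "'a \<Rightarrow> 'a ultra" where
  "point a = ultra_of (\<lambda>P. P a)"

definition lim :: "'b ultra \<Rightarrow> ('b \<Rightarrow> 'a ultra) \<Rightarrow> 'a ultra" where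
  "lim D W = ultra_of (\<lambda>P. most D (\<lambda>x. most (W x) P))"

definition push :: "('b \<Rightarrow> 'a) \<Rightarrow> 'b ultra \<Rightarrow> 'a ultra" where
  "push f D = ultra_of (\<lambda>P. most D (\<lambda>x. P (f x)))"

lemma most_point [simp]: "most (point a) P = P a"
  unfolding point_def by (rule most_ultra_of) auto

lemma most_lim [simp]: "most (lim D W) P \<longleftrightarrow> most D (\<lambda>x. most (W x) P)"
  unfolding lim_def
proof (rule most_ultra_of)
  fix P Q assume *: "most D (\<lambda>x. most (W x) P)" and PQ: "\<And>x. P x \<Longrightarrow> Q x"
  show "most D (\<lambda>x. most (W x) Q)"
    by (rule most_mono[OF *], erule most_mono, erule PQ)
qed simp_all

lemma most_push [simp]: "most (push f D) P \<longleftrightarrow> most D (\<lambda>x. P (f x))"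
  unfolding push_def
proof (rule most_ultra_of)
  fix P Q assume *: "most D (\<lambda>x. P (f x))" and PQ: "\<And>x. P x \<Longrightarrow> Q x"
  show "most D (\<lambda>x. Q (f x))"
    by (rule most_mono[OF *], erule PQ)
qed simp_all

lemma most_eq_point: "most V (\<lambda>x. x = a) \<Longrightarrow> V = point a"
proof (rule ultra_eqI'[symmetric])
  fix P assume "most V (\<lambda>x. x = a)" "most (point a) P"
  then show "most V P" using most_mono[of V "\<lambda>x. x = a" P] by simp
qed

lemma most_finite_point: "finite S \<Longrightarrow> most V (\<lambda>x. x \<in> S) \<Longrightarrow> \<exists>a\<in>S. V = point a"
proof -
  assume S: "finite S" and "most V (\<lambda>x. x \<in> S)"
  then have "most V (\<lambda>x. \<exists>a\<in>S. x = a)" by simp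
  then obtain a where "a \<in> S" "most V (\<lambda>x. x = a)"
    unfolding most_bex_finite[OF S] by (elim bexE)
  then show ?thesis by (intro bexI[of _ a] most_eq_point)
qed

lemma lim_cong: "most D (\<lambda>x. W x = W' x) \<Longrightarrow> lim D W = lim D W'"
proof (rule ultra_eqI)
  fix P assume "most D (\<lambda>x. W x = W' x)"
  then have "most D (\<lambda>x. most (W x) P = most (W' x) P)" by (rule most_mono) simp
  then show "most (lim D W) P = most (lim D W') P" unfolding most_lim by (rule most_cong)
qed

lemma lim_const [simp]: "lim D (\<lambda>_. W) = W"
  by (rule ultra_eqI) simp

lemma lim_push: "lim (push f D) W = lim D (\<lambda>x. W (f x))"
  by (rule ultra_eqI) simp

lemma push_lim: "push g (lim D W) = lim D (\<lambda>x. push g (W x))"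
  by (rule ultra_eqI) simp

lemma push_id [simp]: "push (\<lambda>x. x) D = D"
  by (rule ultra_eqI) simp

lemma push_push: "push f (push g D) = push (\<lambda>x. f (g x)) D"
  by (rule ultra_eqI) simp

lemma push_cong:
  fixes f g :: "'b \<Rightarrow> 'a"
  shows "most D (\<lambda>x. f x = g x) \<Longrightarrow> push f D = push g D"
proof (rule ultra_eqI)
  fix P :: "'a \<Rightarrow> bool" assume "most D (\<lambda>x. f x = g x)"
  then have "most D (\<lambda>x. P (f x) = P (g x))" by (rule most_mono) simp
  then show "most (push f D) P = most (push g D) P" unfolding most_push by (rule most_cong)
qed

lemma lim_point: "lim D (\<lambda>x. point (f x)) = push f D"
  by (rule ultra_eqI) simp

subsection \<open>Discrete families\<close>

text \<open>The family \<open>P\<close> is discrete along \<open>D\<close>, with disjoint sets \<open>g -` {x}\<close> in \<open>P x\<close>.\<close>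

definition decodes :: "('a \<Rightarrow> 'x) \<Rightarrow> 'x ultra \<Rightarrow> ('x \<Rightarrow> 'a ultra) \<Rightarrow> bool" where
  "decodes g D P \<longleftrightarrow> most D (\<lambda>x. most (P x) (\<lambda>v. g v = x))"

text \<open>Reading the index off a discrete limit returns the index ultrafilter. This is what makes the
  decoder \<open>g\<close> a tool for comparing limits: the problem moves from arbitrary ultrafilters to images on
  the index set.\<close>

lemma decodes_push_lim: "decodes g D P \<Longrightarrow> push g (lim D P) = D"
  unfolding decodes_def
proof (rule ultra_eqI'[symmetric])
  fix A assume "most D (\<lambda>x. most (P x) (\<lambda>v. g v = x))" "most D A"
  then have "most D (\<lambda>x. most (P x) (\<lambda>v. g v = x) \<and> A x)" by simp
  then have "most D (\<lambda>x. most (P x) (\<lambda>v. A (g v)))"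
    by (rule most_mono) (elim conjE, erule most_mono, simp)
  then show "most (push g (lim D P)) A" by simp
qed

lemma decoder_of_disjoint:
  assumes "most D (\<lambda>x. x \<in> S)" "\<And>x. x \<in> S \<Longrightarrow> most (P x) (A x)"
    and "\<And>x y v. x \<in> S \<Longrightarrow> y \<in> S \<Longrightarrow> A x v \<Longrightarrow> A y v \<Longrightarrow> x = y"
  shows "\<exists>g. decodes g D P"
proof -
  have "decodes (\<lambda>v. THE x. x \<in> S \<and> A x v) D P"
    unfolding decodes_def
  proof (rule most_mono[OF assms(1)])
    fix x assume x: "x \<in> S"
    show "most (P x) (\<lambda>v. (THE x. x \<in> S \<and> A x v) = x)"
      by (rule most_mono[OF assms(2)[OF x]], rule the_equality) (use x assms(3) in auto)
  qed
  then show ?thesis by blast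
qed

text \<open>Discreteness comes from one-sided separation: if \<open>A x\<close> is not in \<open>P y\<close> for any \<open>y\<close> of larger rank, remove
  from \<open>A x\<close> the finitely many sets of smaller rank; the finitely many distinct ultrafilters of equal rank
  are separated from each other directly.\<close>

lemma disjointify:
  fixes r :: "'x \<Rightarrow> nat"
  assumes fin: "\<And>k. finite {x \<in> S. r x \<le> k}"
    and A: "\<And>x. x \<in> S \<Longrightarrow> most (P x) (A x)"
    and up: "\<And>x y. x \<in> S \<Longrightarrow> y \<in> S \<Longrightarrow> r x < r y \<Longrightarrow> \<not> most (P y) (A x)"
    and lev: "\<And>x y. x \<in> S \<Longrightarrow> y \<in> S \<Longrightarrow> r x = r y \<Longrightarrow> x \<noteq> y \<Longrightarrow> P x \<noteq> P y"
  shows "\<exists>B. (\<forall>x\<in>S. most (P x) (B x)) \<and> (\<forall>x\<in>S. \<forall>y\<in>S. \<forall>v. B x v \<longrightarrow> B y v \<longrightarrow> x = y)"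
proof -
  have "\<forall>x y. \<exists>C. P x \<noteq> P y \<longrightarrow> most (P x) C \<and> \<not> most (P y) C"
    using ultra_separate by blast
  then obtain C where C: "\<And>x y. P x \<noteq> P y \<Longrightarrow> most (P x) (C x y) \<and> \<not> most (P y) (C x y)"
    by metis
  define B where "B x v \<longleftrightarrow> A x v \<and>
      (\<forall>y\<in>{y \<in> S. r y = r x \<and> y \<noteq> x}. C x y v \<and> \<not> C y x v) \<and>
      (\<forall>y\<in>{y \<in> S. r y < r x}. \<not> A y v)" for x v
  have "most (P x) (B x)" if x: "x \<in> S" for x
  proof -
    have f1: "finite {y \<in> S. r y = r x \<and> y \<noteq> x}"
      by (rule finite_subset[OF _ fin[of "r x"]]) auto
    have f2: "finite {y \<in> S. r y < r x}"
      by (rule finite_subset[OF _ fin[of "r x"]]) auto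
    have "\<forall>y\<in>{y \<in> S. r y = r x \<and> y \<noteq> x}. most (P x) (\<lambda>v. C x y v \<and> \<not> C y x v)"
    proof
      fix y assume "y \<in> {y \<in> S. r y = r x \<and> y \<noteq> x}"
      then have "P x \<noteq> P y" using lev[of x y] x by auto
      then show "most (P x) (\<lambda>v. C x y v \<and> \<not> C y x v)" using C[of x y] C[of y x] by auto
    qed
    moreover have "\<forall>y\<in>{y \<in> S. r y < r x}. most (P x) (\<lambda>v. \<not> A y v)"
      using up[OF _ x] by simp
    ultimately have "most (P x) (\<lambda>v. A x v \<and>
      (\<forall>y\<in>{y \<in> S. r y = r x \<and> y \<noteq> x}. C x y v \<and> \<not> C y x v) \<and>
      (\<forall>y\<in>{y \<in> S. r y < r x}. \<not> A y v))"
      using A[OF x] unfolding most_conj most_ball_finite[OF f1] most_ball_finite[OF f2] by blast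
    then show ?thesis unfolding B_def .
  qed
  moreover have "x = y" if "x \<in> S" "y \<in> S" "B x v" "B y v" for x y v
  proof (rule ccontr)
    assume ne: "x \<noteq> y"
    consider "r x = r y" | "r x < r y" | "r y < r x" by linarith
    then show False
    proof cases
      case 1
      have "y \<in> {y \<in> S. r y = r x \<and> y \<noteq> x}" "x \<in> {z \<in> S. r z = r y \<and> z \<noteq> y}"
        using that ne 1 by auto
      then have "C x y v" "\<not> C x y v" using that(3,4) unfolding B_def by blast+
      then show False by blast
    qed (use that in \<open>auto simp: B_def\<close>)
  qed
  ultimately show ?thesis by blast
qed

section \<open>Block sequences\<close>

definition prec :: "nat set \<Rightarrow> nat set \<Rightarrow> bool" where
  "prec s t \<longleftrightarrow> (\<forall>x\<in>s. \<forall>y\<in>t. x < y)"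

text \<open>The numbers up to the maximum of \<open>t\<close>, in a form that is also right for \<open>t = {}\<close>.\<close>

definition down :: "nat set \<Rightarrow> nat set" where
  "down t = {x. \<exists>y\<in>t. x \<le> y}"

text \<open>The empty union is added because the empty set is a
  legitimate beginning of a block: \<open>tail_lim F {}\<close> is the limit of \<open>F\<close>.\<close>

definition span0 :: "(nat \<Rightarrow> nat set) \<Rightarrow> nat set set" where
  "span0 X = insert {} (block_span X)"

lemma prec_empty [simp]: "prec {} t" "prec s {}"
  by (auto simp: prec_def)

lemma prec_Un [simp]: "prec (s \<union> t) u \<longleftrightarrow> prec s u \<and> prec t u"
  "prec s (t \<union> u) \<longleftrightarrow> prec s t \<and> prec s u"
  by (auto simp: prec_def)

lemma prec_trans: "prec s t \<Longrightarrow> prec t u \<Longrightarrow> t \<noteq> {} \<Longrightarrow> prec s u"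
  unfolding prec_def by (metis all_not_in_conv less_trans)

lemma prec_subset: "prec s t \<Longrightarrow> s' \<subseteq> down s \<Longrightarrow> prec s' t"
  unfolding prec_def down_def by fastforce

lemma prec_disjoint: "prec s t \<Longrightarrow> s \<inter> t = {}"
  unfolding prec_def by fastforce

lemma prec_iff_Max_less_Min: "s \<in> FIN \<Longrightarrow> t \<in> FIN \<Longrightarrow> prec s t \<longleftrightarrow> Max s < Min t"
  unfolding FIN_def prec_def by (auto simp: Max_less_iff Min_gr_iff)

lemma finite_down: "finite t \<Longrightarrow> finite (down t)"
proof -
  assume "finite t"
  moreover have "down t = (\<Union>y\<in>t. {..y})" unfolding down_def by auto
  ultimately show ?thesis by simp
qed

lemma subset_down: "t \<subseteq> down t"
  unfolding down_def by auto

lemma down_FIN: "t \<in> FIN \<Longrightarrow> down t = {..Max t}"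
  unfolding FIN_def down_def by (auto intro: Max_ge_iff[THEN iffD2] Max_in)

lemma Min_le_Max_FIN: "s \<in> FIN \<Longrightarrow> Min s \<le> Max s"
  unfolding FIN_def by simp

lemma Max_Un_prec: "s \<in> FIN \<Longrightarrow> t \<in> FIN \<Longrightarrow> prec s t \<Longrightarrow> Max (s \<union> t) = Max t"
  using Min_le_Max_FIN[of t] by (simp add: prec_iff_Max_less_Min) (simp add: FIN_def Max_Un)

lemma Min_Un_prec: "s \<in> FIN \<Longrightarrow> t \<in> FIN \<Longrightarrow> prec s t \<Longrightarrow> Min (s \<union> t) = Min s"
  using Min_le_Max_FIN[of s] by (simp add: prec_iff_Max_less_Min) (simp add: FIN_def Min_Un)

context
  fixes X assumes X: "block_seq X"
begin

lemma block_FIN: "X i \<in> FIN"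
  using X unfolding block_seq_def by blast

lemma block_prec: "i < j \<Longrightarrow> prec (X i) (X j)"
proof (induction j)
  case (Suc j)
  have "prec (X j) (X (Suc j))"
    using X block_FIN unfolding block_seq_def by (simp add: prec_iff_Max_less_Min)
  moreover have "X j \<noteq> {}" using block_FIN[of j] unfolding FIN_def by blast
  ultimately show ?case using Suc prec_trans by (metis less_Suc_eq)
qed simp

lemma block_disjoint: "i \<noteq> j \<Longrightarrow> X i \<inter> X j = {}"
  using block_prec[THEN prec_disjoint, of i j] block_prec[THEN prec_disjoint, of j i]
  by (cases "i < j") auto

lemma block_eqI: "x \<in> X i \<Longrightarrow> x \<in> X j \<Longrightarrow> i = j"
  using block_disjoint by blast

lemma block_nonempty: "X i \<noteq> {}" and block_finite: "finite (X i)"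
  using block_FIN[of i] unfolding FIN_def by auto

lemma span0_iff: "s \<in> span0 X \<longleftrightarrow> (\<exists>F. finite F \<and> s = (\<Union>i\<in>F. X i))"
  unfolding span0_def block_span_def by auto

lemma span0_UN: "finite F \<Longrightarrow> (\<Union>i\<in>F. X i) \<in> span0 X"
  unfolding span0_iff by blast

lemma span_iff: "s \<in> block_span X \<longleftrightarrow> s \<in> span0 X \<and> s \<noteq> {}"
proof -
  have "{} \<notin> block_span X" unfolding block_span_def using block_nonempty by auto
  then show ?thesis unfolding span0_def by blast
qed

lemma span0_finite: "s \<in> span0 X \<Longrightarrow> finite s"
  using span0_iff block_finite by auto

lemma span_FIN: "s \<in> block_span X \<Longrightarrow> s \<in> FIN"
  using span0_finite span_iff unfolding FIN_def by auto

lemma block_in_span: "X i \<in> block_span X"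
  unfolding block_span_def by (auto intro!: exI[of _ "{i}"])

lemma span0_Un: "s \<in> span0 X \<Longrightarrow> t \<in> span0 X \<Longrightarrow> s \<union> t \<in> span0 X"
proof -
  assume "s \<in> span0 X" "t \<in> span0 X"
  then obtain F G where "finite F" "s = (\<Union>i\<in>F. X i)" "finite G" "t = (\<Union>i\<in>G. X i)"
    unfolding span0_iff by blast
  then have "finite (F \<union> G)" "s \<union> t = (\<Union>i\<in>F \<union> G. X i)" by auto
  then show ?thesis using span0_UN[of "F \<union> G"] by simp
qed

lemma span_Un: "s \<in> span0 X \<Longrightarrow> t \<in> block_span X \<Longrightarrow> s \<union> t \<in> block_span X"
  using span0_Un[of s t] span_iff by auto

lemma span0_cut:
  assumes "s \<in> span0 X" "t \<in> span0 X"
  shows "\<exists>q\<in>span0 X. \<exists>c\<in>span0 X. s = q \<union> c \<and> q \<subseteq> down t \<and> prec t c"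
proof (cases "t = {}")
  case True
  then show ?thesis using assms(1) by (intro bexI[of _ "{}"] bexI[of _ s]) (auto simp: span0_def)
next
  case False
  obtain F G where F: "finite F" "s = (\<Union>i\<in>F. X i)" and G: "finite G" "t = (\<Union>i\<in>G. X i)"
    using assms(1,2) unfolding span0_iff by blast
  then have "G \<noteq> {}" using False by auto
  then have j: "Max G \<in> G" using G by simp
  have "(\<Union>i\<in>F \<inter> {..Max G}. X i) \<in> span0 X" "(\<Union>i\<in>F \<inter> {Max G<..}. X i) \<in> span0 X"
    using span0_UN F(1) by simp_all
  moreover have "F = (F \<inter> {..Max G}) \<union> (F \<inter> {Max G<..})" by auto
  then have "s = (\<Union>i\<in>F \<inter> {..Max G}. X i) \<union> (\<Union>i\<in>F \<inter> {Max G<..}. X i)"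
    unfolding F(2) by (metis UN_Un)
  moreover have "(\<Union>i\<in>F \<inter> {..Max G}. X i) \<subseteq> down t"
  proof
    fix x assume "x \<in> (\<Union>i\<in>F \<inter> {..Max G}. X i)"
    then obtain i where i: "i \<le> Max G" "x \<in> X i" by auto
    show "x \<in> down t"
    proof (cases "i = Max G")
      case True
      then show ?thesis using i j G subset_down by blast
    next
      case False
      then have "prec (X i) (X (Max G))" using i by (intro block_prec) simp
      moreover obtain y where y: "y \<in> X (Max G)" using block_nonempty by blast
      ultimately have "x \<le> y" using i unfolding prec_def by (auto intro: less_imp_le)
      moreover have "y \<in> t" using y j G by blast
      ultimately show ?thesis unfolding down_def by blast
    qed
  qed
  moreover have "prec t (\<Union>i\<in>F \<inter> {Max G<..}. X i)"
    unfolding prec_def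
  proof (intro ballI)
    fix x y assume "x \<in> t" "y \<in> (\<Union>i\<in>F \<inter> {Max G<..}. X i)"
    then obtain i j where "i \<in> G" "x \<in> X i" "Max G < j" "y \<in> X j" using G by auto
    then show "x < y" using G block_prec[of i j] Max_ge[of G i] unfolding prec_def by fastforce
  qed
  ultimately show ?thesis by blast
qed

text \<open>Two different unions of blocks have a last block in which they differ. Cutting there leaves a
  common tail \<open>c\<close>, and the injectivity arguments below remove this tail by taking limits over it.\<close>

lemma span0_differ:
  assumes "s \<in> span0 X" "t \<in> span0 X" "s \<noteq> t"
  shows "\<exists>i. \<exists>q\<in>span0 X. \<exists>b\<in>span0 X. \<exists>c\<in>span0 X. prec q (X i) \<and> prec b (X i) \<and> prec (X i) c \<and>
    ((s = q \<union> X i \<union> c \<and> t = b \<union> c) \<or> (t = q \<union> X i \<union> c \<and> s = b \<union> c))"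
proof -
  obtain F G where F: "finite F" "s = (\<Union>i\<in>F. X i)" and G: "finite G" "t = (\<Union>i\<in>G. X i)"
    using assms(1,2) unfolding span0_iff by blast
  define H where "H = (F - G) \<union> (G - F)"
  have H: "finite H" "H \<noteq> {}" using F G assms(3) unfolding H_def by auto
  define i where "i = Max H"
  have iH: "i \<in> H" unfolding i_def using H by simp
  have top: "j \<in> F \<longleftrightarrow> j \<in> G" if "i < j" for j
    using that Max_ge[OF H(1), of j] unfolding i_def H_def by auto
  have main: "\<exists>q\<in>span0 X. \<exists>b\<in>span0 X. \<exists>c\<in>span0 X. prec q (X i) \<and> prec b (X i) \<and> prec (X i) c \<and>
      s = q \<union> X i \<union> c \<and> t = b \<union> c"
    if iF: "i \<in> F" "i \<notin> G" and fin: "finite F" "finite G" and st: "s = (\<Union>i\<in>F. X i)" "t = (\<Union>i\<in>G. X i)"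
      and top: "\<And>j. i < j \<Longrightarrow> j \<in> F \<longleftrightarrow> j \<in> G" for F G s t
  proof -
    have mem: "(\<Union>j\<in>F \<inter> {..<i}. X j) \<in> span0 X" "(\<Union>j\<in>G \<inter> {..<i}. X j) \<in> span0 X" "(\<Union>j\<in>F \<inter> {i<..}. X j) \<in> span0 X"
      using span0_UN fin by simp_all
    have "F = (F \<inter> {..<i}) \<union> {i} \<union> (F \<inter> {i<..})" using iF by auto
    then have "s = (\<Union>j\<in>F \<inter> {..<i}. X j) \<union> X i \<union> (\<Union>j\<in>F \<inter> {i<..}. X j)"
      unfolding st by (metis UN_Un UN_singleton UN_insert UN_empty Un_empty_right)
    moreover have "j \<in> G \<longleftrightarrow> j \<in> (G \<inter> {..<i}) \<union> (F \<inter> {i<..})" for j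
      using iF top[of j] by (cases j i rule: linorder_cases) auto
    then have "G = (G \<inter> {..<i}) \<union> (F \<inter> {i<..})" by blast
    then have "t = (\<Union>j\<in>G \<inter> {..<i}. X j) \<union> (\<Union>j\<in>F \<inter> {i<..}. X j)"
      unfolding st by (metis UN_Un)
    moreover have "prec (\<Union>j\<in>F \<inter> {..<i}. X j) (X i)" "prec (\<Union>j\<in>G \<inter> {..<i}. X j) (X i)"
      "prec (X i) (\<Union>j\<in>F \<inter> {i<..}. X j)"
      using block_prec unfolding prec_def by blast+
    ultimately show ?thesis using mem by blast
  qed
  have "i \<in> F \<and> i \<notin> G \<or> i \<in> G \<and> i \<notin> F" using iH unfolding H_def by auto
  then show ?thesis
    using main[OF _ _ F(1) G(1) F(2) G(2)] main[OF _ _ G(1) F(1) G(2) F(2)] top by metis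
qed

lemma span_first:
  assumes "s \<in> block_span X"
  shows "\<exists>i. \<exists>a\<in>span0 X. s = X i \<union> a \<and> prec (X i) a \<and> Min s = Min (X i)"
proof -
  obtain F where F: "finite F" "F \<noteq> {}" "s = (\<Union>i\<in>F. X i)"
    using assms unfolding block_span_def by auto
  define i where "i = Min F"
  have iF: "i \<in> F" unfolding i_def using F by simp
  have a: "(\<Union>j\<in>F \<inter> {i<..}. X j) \<in> span0 X" using span0_UN F(1) by simp
  have "F = {i} \<union> (F \<inter> {i<..})"
    using iF Min_le[OF F(1)] unfolding i_def by (auto simp: less_le)
  then have s: "s = X i \<union> (\<Union>j\<in>F \<inter> {i<..}. X j)"
    unfolding F(3) by (metis UN_Un UN_insert UN_empty Un_empty_right)
  have p: "prec (X i) (\<Union>j\<in>F \<inter> {i<..}. X j)"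
    using block_prec unfolding prec_def by blast
  have "Min s = Min (X i)"
  proof (cases "(\<Union>j\<in>F \<inter> {i<..}. X j) = {}")
    case False
    then show ?thesis using s a p Min_Un_prec[OF block_FIN _ p] span_iff span_FIN by metis
  qed (use s in simp)
  then show ?thesis using s a p by blast
qed

lemma span_last:
  assumes "s \<in> block_span X"
  shows "\<exists>i. \<exists>a\<in>span0 X. s = a \<union> X i \<and> prec a (X i) \<and> Max s = Max (X i)"
proof -
  obtain F where F: "finite F" "F \<noteq> {}" "s = (\<Union>i\<in>F. X i)"
    using assms unfolding block_span_def by auto
  define i where "i = Max F"
  have iF: "i \<in> F" unfolding i_def using F by simp
  have a: "(\<Union>j\<in>F \<inter> {..<i}. X j) \<in> span0 X" using span0_UN F(1) by simp
  have "F = (F \<inter> {..<i}) \<union> {i}"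
    using iF Max_ge[OF F(1)] unfolding i_def by (auto simp: less_le)
  then have s: "s = (\<Union>j\<in>F \<inter> {..<i}. X j) \<union> X i"
    unfolding F(3) by (metis UN_Un UN_insert UN_empty Un_empty_right)
  have p: "prec (\<Union>j\<in>F \<inter> {..<i}. X j) (X i)"
    using block_prec unfolding prec_def by blast
  have "Max s = Max (X i)"
  proof (cases "(\<Union>j\<in>F \<inter> {..<i}. X j) = {}")
    case False
    then show ?thesis using s a p Max_Un_prec[OF _ block_FIN p] span_iff span_FIN by metis
  qed (use s in simp)
  then show ?thesis using s a p by blast
qed

lemma block_index_le: "i \<le> Min (X i)"
proof (induction i)
  case (Suc i)
  have "Min (X i) \<le> Max (X i)"
    using block_finite block_nonempty by (meson Max_ge Min_in)
  moreover have "Max (X i) < Min (X (Suc i))" using X unfolding block_seq_def by blast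
  ultimately show ?case using Suc by linarith
qed simp

lemma block_tail_exists: "finite k \<Longrightarrow> \<exists>i. prec k (X i)"
proof -
  assume k: "finite k"
  have "prec k (X (Suc (Max k)))"
    unfolding prec_def
  proof (intro ballI)
    fix x y assume "x \<in> k" "y \<in> X (Suc (Max k))"
    then have "x \<le> Max k" "Min (X (Suc (Max k))) \<le> y" using k block_finite by auto
    then show "x < y" using block_index_le[of "Suc (Max k)"] by linarith
  qed
  then show ?thesis by blast
qed

lemma Min_block_inj: "Min (X i) = Min (X j) \<Longrightarrow> i = j"
  and Max_block_inj: "Max (X i) = Max (X j) \<Longrightarrow> i = j"
  using block_eqI block_finite block_nonempty by (metis Min_in, metis Max_in)

lemma finite_span_Max: "finite {s \<in> block_span X. Max s \<le> k}"
proof (rule finite_subset)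
  show "{s \<in> block_span X. Max s \<le> k} \<subseteq> Pow {..k}"
    using span_FIN unfolding FIN_def by (auto intro: order_trans[OF Max_ge])
qed simp

end

section \<open>Stable ordered-union ultrafilters\<close>

text \<open>The three facts about \<open>U\<close> that are used; \<open>stable_ultra_ultra_on\<close> shows that they hold for the
  ultrafilter of the theorem.\<close>

locale stable_ultra =
  fixes U :: "nat set ultra"
  assumes most_FIN: "most U (\<lambda>s. s \<in> FIN)"
    and most_base: "most U P \<Longrightarrow>
      \<exists>X. block_seq X \<and> most U (\<lambda>s. s \<in> block_span X) \<and> (\<forall>s\<in>block_span X. P s)"
    and stable: "(\<And>i. block_seq (Xs i) \<and> most U (\<lambda>s. s \<in> block_span (Xs i)) \<and>
        block_le_star (Xs (Suc i)) (Xs i)) \<Longrightarrow>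
      \<exists>X. block_seq X \<and> most U (\<lambda>s. s \<in> block_span X) \<and> (\<forall>i. block_le_star X (Xs i))"
begin

definition big :: "(nat \<Rightarrow> nat set) \<Rightarrow> bool" where
  "big X \<longleftrightarrow> block_seq X \<and> most U (\<lambda>s. s \<in> block_span X)"

lemma bigD: "big X \<Longrightarrow> block_seq X" "big X \<Longrightarrow> most U (\<lambda>s. s \<in> block_span X)"
  unfolding big_def by auto

lemma ex_big: "most U P \<Longrightarrow> \<exists>X. big X \<and> (\<forall>s\<in>block_span X. P s)"
  using most_base unfolding big_def by metis

lemma most_prec: "finite k \<Longrightarrow> most U (prec k)"
proof (rule ccontr)
  assume k: "finite k" and "\<not> most U (prec k)"
  then have "most U (\<lambda>s. \<not> prec k s)" by simp
  then obtain X where X: "big X" "\<forall>s\<in>block_span X. \<not> prec k s" using ex_big by metis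
  then show False using block_tail_exists[OF bigD(1) k] block_in_span bigD(1) by metis
qed

text \<open>\<open>U\<close> is an idempotent for the partial semigroup of disjoint unions: a set in \<open>U\<close> contains a span, which
  is closed under unions. So two consecutive questions to \<open>U\<close> can be merged into one.\<close>

lemma most_idem: "most U (\<lambda>s. most U (\<lambda>t. P (s \<union> t))) \<longleftrightarrow> most U P"
proof -
  have imp: "most U (\<lambda>s. most U (\<lambda>t. P (s \<union> t)))" if P: "most U P" for P :: "nat set \<Rightarrow> bool"
  proof -
    obtain X where X: "big X" "\<forall>s\<in>block_span X. P s" using ex_big[OF P] by blast
    have "most U (\<lambda>t. P (s \<union> t))" if "s \<in> block_span X" for s
    proof (rule most_mono[OF bigD(2)[OF X(1)]])
      fix t assume "t \<in> block_span X"
      then show "P (s \<union> t)" using X that span_Un bigD(1) by (simp add: span0_def)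
    qed
    then show ?thesis using most_mono[OF bigD(2)[OF X(1)]] by metis
  qed
  show ?thesis using imp[of P] imp[of "\<lambda>s. \<not> P s"] by auto
qed

text \<open>If gaps are called long when they exceed the bound \<open>m\<close>, then \<open>s\<close> splits into pieces separated by long
  gaps, and these are the first elements of the pieces.\<close>

definition far_starts :: "(nat \<Rightarrow> nat) \<Rightarrow> nat set \<Rightarrow> nat set" where
  "far_starts m s = {x\<in>s. \<forall>y\<in>s. y < x \<longrightarrow> m y < x}"

lemma far_starts_Un:
  assumes s: "s \<in> FIN" and t: "t \<in> FIN" and st: "prec s t" and m: "mono m"
  shows "card (far_starts m (s \<union> t)) + (if m (Max s) < Min t then 0 else 1) =
    card (far_starts m s) + card (far_starts m t)"
proof -
  have fs: "finite s" "finite t" "s \<noteq> {}" "t \<noteq> {}" using s t unfolding FIN_def by auto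
  then have min: "Min t \<in> t" "Max s \<in> s" by auto
  have lt: "\<And>x y. x \<in> s \<Longrightarrow> y \<in> t \<Longrightarrow> x < y" using st unfolding prec_def by blast
  have fin: "finite (far_starts m u)" if "finite u" for u using that unfolding far_starts_def by simp
  have minstart: "Min t \<in> far_starts m t"
    unfolding far_starts_def using min fs by (auto simp: not_less[symmetric] dest: Min_le)
  have below: "far_starts m (s \<union> t) \<inter> s = far_starts m s"
    unfolding far_starts_def using lt by (auto dest: less_asym)
  have above: "far_starts m (s \<union> t) \<inter> t - {Min t} = far_starts m t - {Min t}"
  proof -
    have "m y < x" if "x \<in> far_starts m t" "x \<noteq> Min t" "y \<in> s" for x y
    proof -
      have "Min t < x" using that fs unfolding far_starts_def by (auto simp: less_le)
      then have "m (Min t) < x" using that min unfolding far_starts_def by auto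
      moreover have "m y \<le> m (Min t)" using m lt[OF that(3) min(1)] by (simp add: monoD)
      ultimately show ?thesis by simp
    qed
    then show ?thesis unfolding far_starts_def by auto
  qed
  have atmin: "Min t \<in> far_starts m (s \<union> t) \<longleftrightarrow> m (Max s) < Min t"
  proof -
    have "m y < Min t" if "m (Max s) < Min t" "y \<in> s" for y
      using that m fs monoD[OF m, of y "Max s"] by (simp add: le_less_trans)
    moreover have "m (Max s) < Min t" if "Min t \<in> far_starts m (s \<union> t)"
      using that lt[OF min(2,1)] min(2) unfolding far_starts_def by simp
    moreover have "y \<in> s" if "y \<in> s \<union> t" "y < Min t" for y
      using that fs(2) by (auto dest: Min_le)
    ultimately show ?thesis unfolding far_starts_def using min(1) by blast
  qed
  have disj: "s \<inter> t = {}" using st by (rule prec_disjoint)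
  have ct: "card (far_starts m t) = Suc (card (far_starts m t - {Min t}))"
    using card.remove[OF fin[OF fs(2)] minstart] by simp
  have "far_starts m (s \<union> t) =
      far_starts m s \<union> ((far_starts m t - {Min t}) \<union> (if m (Max s) < Min t then {Min t} else {}))"
    (is "?L = ?A \<union> (?B \<union> ?C)")
  proof -
    have "?L = (?L \<inter> s) \<union> ((?L \<inter> t - {Min t}) \<union> (?L \<inter> {Min t}))"
      using min unfolding far_starts_def by auto
    then show ?thesis using below above atmin by auto
  qed
  moreover have "?A \<inter> (?B \<union> ?C) = {}" "?B \<inter> ?C = {}"
    using disj min unfolding far_starts_def by auto
  ultimately have "card ?L = card ?A + (card ?B + card ?C)"
    using fin[OF fs(1)] fin[OF fs(2)] by (simp add: card_Un_disjoint)
  then show ?thesis using ct by auto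
qed

text \<open>Why gaps can be made long although \<open>U\<close> does not allow blocks to be skipped: colour \<open>s\<close> by the parity of
  the number of its far starts. A union of two sets that are far apart adds these numbers, a union of
  close ones loses one. Far pairs exist in every span, so on a homogeneous span all parities are even,
  and then no pair can be close.\<close>

lemma ex_big_far:
  assumes "mono m" "big X0"
  shows "\<exists>Y. big Y \<and> block_span Y \<subseteq> block_span X0 \<and>
    (\<forall>s\<in>block_span Y. \<forall>t\<in>block_span Y. prec s t \<longrightarrow> m (Max s) < Min t)"
proof -
  define c where "c s = card (far_starts m s)" for s
  define par where "par = most U (\<lambda>s. even (c s))"
  have "most U (\<lambda>s. even (c s) = par)" by (cases par) (simp_all add: par_def)
  then have "most U (\<lambda>s. even (c s) = par \<and> s \<in> block_span X0)" using bigD[OF assms(2)] by simp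
  then obtain Y where Y: "big Y" "\<And>s. s \<in> block_span Y \<Longrightarrow> even (c s) = par \<and> s \<in> block_span X0"
    using ex_big by blast
  note bY = bigD(1)[OF Y(1)]
  have c: "c (s \<union> t) + (if m (Max s) < Min t then 0 else 1) = c s + c t"
    if "s \<in> block_span Y" "t \<in> block_span Y" "prec s t" for s t
    unfolding c_def using far_starts_Un[OF _ _ that(3) assms(1)] span_FIN[OF bY] that by blast
  have un: "s \<union> t \<in> block_span Y" if "s \<in> block_span Y" "t \<in> block_span Y" for s t
    using that span_Un[OF bY] by (simp add: span0_def)
  \<comment> \<open>A block and a much later one are far apart, which forces the even colour.\<close>
  have par: par
  proof -
    obtain i where i: "prec (insert (m (Max (Y 0))) (Y 0)) (Y i)"
      using block_tail_exists[OF bY, of "insert (m (Max (Y 0))) (Y 0)"] block_finite[OF bY] by auto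
    then have p: "prec (Y 0) (Y i)" "m (Max (Y 0)) < Min (Y i)"
      using block_nonempty[OF bY, of i] block_finite[OF bY, of i] unfolding prec_def by auto
    have "c (Y 0 \<union> Y i) = c (Y 0) + c (Y i)"
      using c[OF _ _ p(1)] p(2) block_in_span[OF bY] by simp
    then show ?thesis using Y(2)[OF un[OF block_in_span[OF bY] block_in_span[OF bY]], of 0 i]
        Y(2)[OF block_in_span[OF bY, of 0]] Y(2)[OF block_in_span[OF bY, of i]] by auto
  qed
  have "m (Max s) < Min t" if "s \<in> block_span Y" "t \<in> block_span Y" "prec s t" for s t
  proof (rule ccontr)
    assume "\<not> m (Max s) < Min t"
    then have "c (s \<union> t) + 1 = c s + c t" using c[OF that] by simp
    then show False using Y(2)[OF un[OF that(1,2)]] Y(2)[OF that(1)] Y(2)[OF that(2)] par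
      by (metis even_add odd_one)
  qed
  then show ?thesis using Y by blast
qed

lemma le_star_span:
  assumes "block_seq X" "block_seq Y" "block_le_star X Y"
  shows "\<exists>n. \<forall>s\<in>block_span X. n < Min s \<longrightarrow> s \<in> block_span Y"
proof -
  obtain n where n: "block_le (block_tail X n) Y" using assms(3) unfolding block_le_star_def by blast
  define i0 where "i0 = (LEAST i. n < Min (X i))"
  have "s \<in> block_span Y" if s: "s \<in> block_span X" "n < Min s" for s
  proof -
    obtain F where F: "finite F" "F \<noteq> {}" "s = (\<Union>i\<in>F. X i)"
      using s(1) unfolding block_span_def by auto
    have inY: "X i \<in> span0 Y" if "i \<in> F" for i
    proof -
      have "Min s \<le> Min (X i)"
        using F that block_finite[OF assms(1)] block_nonempty[OF assms(1)] span_FIN[OF assms(1) s(1)]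
        unfolding FIN_def by (intro Min_antimono) auto
      then have "i0 \<le> i" unfolding i0_def using s(2) by (intro Least_le) simp
      then have "X i = block_tail X n (i - i0)" unfolding block_tail_def i0_def by simp
      then show ?thesis using n unfolding block_le_def span0_def by simp
    qed
    have "(\<Union>i\<in>F'. X i) \<in> span0 Y" if "finite F'" "F' \<subseteq> F" for F'
      using that
    proof (induction F' rule: finite_induct)
      case (insert i F')
      then show ?case using span0_Un[OF assms(2) inY[of i], of "\<Union>i\<in>F'. X i"] by simp
    qed (simp add: span0_def)
    then have "s \<in> span0 Y" using F by blast
    then show ?thesis using span_iff[OF assms(2)] span_iff[OF assms(1)] s by blast
  qed
  then show ?thesis by blast
qed

lemma le_starI:
  assumes "block_seq X" "block_span X \<subseteq> block_span Y"
  shows "block_le_star X Y"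
  unfolding block_le_star_def block_le_def block_tail_def
  using assms(2) block_in_span[OF assms(1)] by blast

text \<open>The form in which stability is used: one span in \<open>U\<close> realises every statement about \<open>q\<close>, \<open>r\<close> and a later
  \<open>s\<close> that holds for most \<open>s\<close>. Stability gives \<open>X\<close> that is almost below spans homogeneous for all parameters up
  to \<open>k\<close>; the beginnings that spoil this are overtaken with \<open>ex_big_far\<close>.\<close>

lemma diagonalize:
  assumes X0: "big X0"
  shows "\<exists>X. big X \<and> block_span X \<subseteq> block_span X0 \<and>
    (\<forall>q\<in>span0 X. \<forall>r\<in>span0 X. \<forall>s\<in>block_span X. prec q s \<longrightarrow> prec r s \<longrightarrow> most U (Q q r) \<longrightarrow> Q q r s)"
proof -
  \<comment> \<open>Only finitely many pairs of parameters lie below \<open>k\<close>, so \<open>G k\<close> holds for most sets.\<close>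
  define G where "G k s \<longleftrightarrow> (\<forall>a\<in>Pow {..k} \<times> Pow {..k}. most U (Q (fst a) (snd a)) \<longrightarrow> Q (fst a) (snd a) s)"
    for k :: nat and s
  have G: "most U (G k)" for k
    unfolding G_def by (subst most_ball_finite) auto
  define step where "step k X Y \<longleftrightarrow> big Y \<and> block_span Y \<subseteq> block_span X \<and> (\<forall>s\<in>block_span Y. G k s)" for k X Y
  have step: "\<exists>Y. step k X Y" if "big X" for k X
  proof -
    have "most U (\<lambda>s. G k s \<and> s \<in> block_span X)" using G bigD(2)[OF that] by simp
    then show ?thesis unfolding step_def using ex_big that by blast
  qed
  obtain Xs where Xs: "\<And>k. big (Xs k)" "\<And>k. step k (Xs k) (Xs (Suc k))" and Xs0: "Xs 0 = X0"
  proof -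
    have "\<exists>f. \<forall>k. (big (f k) \<and> (k = 0 \<longrightarrow> f k = X0)) \<and> step k (f k) (f (Suc k))"
    proof (rule dependent_nat_choice)
      show "\<exists>x. big x \<and> ((0::nat) = 0 \<longrightarrow> x = X0)" using X0 by blast
    next
      fix x and n :: nat assume "big x \<and> (n = 0 \<longrightarrow> x = X0)"
      then show "\<exists>y. (big y \<and> (Suc n = 0 \<longrightarrow> y = X0)) \<and> step n x y"
        using step[of x n] unfolding step_def by auto
    qed
    then show ?thesis using that by blast
  qed
  have "\<exists>X. block_seq X \<and> most U (\<lambda>s. s \<in> block_span X) \<and> (\<forall>i. block_le_star X (Xs i))"
  proof (intro stable conjI)
    fix i
    show "block_seq (Xs i)" "most U (\<lambda>s. s \<in> block_span (Xs i))" using bigD[OF Xs(1)] by blast+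
    show "block_le_star (Xs (Suc i)) (Xs i)"
      using le_starI[OF bigD(1)[OF Xs(1)]] Xs(2) unfolding step_def by blast
  qed
  then obtain X where X: "big X" "\<And>i. block_le_star X (Xs i)" unfolding big_def by blast
  have "\<exists>m. \<forall>k. \<forall>s\<in>block_span X. m k < Min s \<longrightarrow> s \<in> block_span (Xs (Suc k))"
    using le_star_span[OF bigD(1) bigD(1) X(2), OF X(1) Xs(1)] by (intro choice allI)
  then obtain m0 where m0: "\<And>k s. s \<in> block_span X \<Longrightarrow> m0 k < Min s \<Longrightarrow> s \<in> block_span (Xs (Suc k))"
    by blast
  \<comment> \<open>A monotone bound for \<open>m0\<close>, as required by \<open>ex_big_far\<close>.\<close>
  define m where "m k = (\<Sum>j\<le>k. m0 j)" for k
  have m: "mono m" "m0 k \<le> m k" for k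
    unfolding m_def by (auto intro!: monoI sum_mono2 member_le_sum)
  have "most U (\<lambda>s. G 0 s \<and> s \<in> block_span X \<and> s \<in> block_span X0)"
    using G bigD(2)[OF X(1)] bigD(2)[OF X0] by simp
  then obtain X' where X': "big X'" "\<And>s. s \<in> block_span X' \<Longrightarrow> G 0 s \<and> s \<in> block_span X \<and> s \<in> block_span X0"
    using ex_big by blast
  obtain Y where Y: "big Y" "block_span Y \<subseteq> block_span X'"
    "\<And>s t. s \<in> block_span Y \<Longrightarrow> t \<in> block_span Y \<Longrightarrow> prec s t \<Longrightarrow> m (Max s) < Min t"
    using ex_big_far[OF m(1) X'(1)] by blast
  have "Q q r s" if q: "q \<in> span0 Y" and r: "r \<in> span0 Y" and s: "s \<in> block_span Y"
    and p: "prec q s" "prec r s" and Q: "most U (Q q r)" for q r s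
  proof (cases "q \<union> r = {}")
    case True
    moreover have "G 0 s" using s Y X' by blast
    ultimately show ?thesis using Q unfolding G_def by force
  next
    case False
    then have qr: "q \<union> r \<in> block_span Y"
      using span0_Un[OF bigD(1)[OF Y(1)] q r] span_iff[OF bigD(1)[OF Y(1)]] by blast
    have "m (Max (q \<union> r)) < Min s" using Y(3)[OF qr s] p by simp
    then have "s \<in> block_span (Xs (Suc (Max (q \<union> r))))"
      using m0 m(2) s Y X' by (meson le_less_trans subsetD)
    then have "G (Max (q \<union> r)) s" using Xs(2) unfolding step_def by blast
    moreover have "finite (q \<union> r)" using span_FIN[OF bigD(1)[OF Y(1)] qr] unfolding FIN_def by blast
    then have "(q, r) \<in> Pow {..Max (q \<union> r)} \<times> Pow {..Max (q \<union> r)}"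
      using Max_ge[of "q \<union> r"] by auto
    ultimately show ?thesis using Q unfolding G_def by fastforce
  qed
  moreover have "block_span Y \<subseteq> block_span X0" using Y X' by blast
  ultimately show ?thesis using Y(1) by blast
qed

end

lemma span0_mono: "block_span X \<subseteq> block_span Y \<Longrightarrow> span0 X \<subseteq> span0 Y"
  unfolding span0_def by auto

lemma span_subset_span0: "block_span X \<subseteq> span0 X"
  unfolding span0_def by auto

lemma empty_in_span0 [simp]: "{} \<in> span0 X"
  unfolding span0_def by simp

context stable_ultra
begin

definition diagonal :: "(nat set \<Rightarrow> nat set \<Rightarrow> nat set \<Rightarrow> bool) \<Rightarrow> (nat \<Rightarrow> nat set) \<Rightarrow> bool" where
  "diagonal Q X \<longleftrightarrow> (\<forall>q\<in>span0 X. \<forall>r\<in>span0 X. \<forall>s\<in>block_span X.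
    prec q s \<longrightarrow> prec r s \<longrightarrow> most U (Q q r) \<longrightarrow> Q q r s)"

lemma diagonalD:
  "diagonal Q X \<Longrightarrow> q \<in> span0 X \<Longrightarrow> r \<in> span0 X \<Longrightarrow> s \<in> block_span X \<Longrightarrow> prec q s \<Longrightarrow> prec r s \<Longrightarrow>
    most U (Q q r) \<Longrightarrow> Q q r s"
  unfolding diagonal_def by blast

lemma diagonalizeE:
  assumes "big X0"
  obtains X where "big X" "block_span X \<subseteq> block_span X0" "span0 X \<subseteq> span0 X0" "diagonal Q X"
  using diagonalize[OF assms, of Q] span0_mono unfolding diagonal_def by metis

lemma most_tail:
  assumes "big X" "finite s"
  shows "most U (\<lambda>t. t \<in> block_span X \<and> prec s t)"
  using bigD(2)[OF assms(1)] most_prec[OF assms(2)] by simp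

lemma most_span_obtain:
  assumes "most U P" "big X" "finite s"
  obtains t where "P t" "t \<in> block_span X" "prec s t"
  using most_ex[of U "\<lambda>t. P t \<and> t \<in> block_span X \<and> prec s t"] assms(1) most_tail[OF assms(2,3)] by auto

lemma big_subset:
  assumes "big X" "most U P"
  obtains Y where "big Y" "block_span Y \<subseteq> block_span X" "\<And>s. s \<in> block_span Y \<Longrightarrow> P s"
  using ex_big[of "\<lambda>s. s \<in> block_span X \<and> P s"] bigD(2)[OF assms(1)] assms(2) by auto

subsection \<open>A trichotomy for equivalence relations\<close>

text \<open>A local form of the canonical Ramsey theorem for finite unions. Compare \<open>s\<close> with its continuations
  \<open>s \<union> d\<close>. If they are mostly related, the class of \<open>s\<close> depends on the first block only, and different first
  blocks are unrelated unless \<open>R {} s\<close>. If they are mostly unrelated, then \<open>q \<union> a\<close> can be related to a fixed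
  \<open>t\<close> only for few \<open>a\<close>, since otherwise \<open>q \<union> a\<close> and \<open>q \<union> a \<union> a'\<close> would both be related to \<open>t\<close>; with \<open>inv\<close> for
  common tails, this gives injectivity.\<close>

lemma trichotomy:
  fixes R :: "nat set \<Rightarrow> nat set \<Rightarrow> bool"
  assumes refl: "\<And>a. R a a" and sym: "\<And>a b. R a b \<Longrightarrow> R b a"
    and trans: "\<And>a b c. R a b \<Longrightarrow> R b c \<Longrightarrow> R a c"
    and inv: "\<And>a b. most U (\<lambda>c. R (a \<union> c) (b \<union> c)) \<Longrightarrow> R a b"
  obtains (all) X where "big X" "\<And>a. a \<in> block_span X \<Longrightarrow> R {} a"
  | (min) X where "big X" "\<And>a. a \<in> block_span X \<Longrightarrow> \<not> R {} a"
      "\<And>a b. a \<in> block_span X \<Longrightarrow> b \<in> block_span X \<Longrightarrow> R a b \<longleftrightarrow> Min a = Min b"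
  | (inj) X where "big X" "\<And>a b. a \<in> span0 X \<Longrightarrow> b \<in> span0 X \<Longrightarrow> R a b \<Longrightarrow> a = b"
proof -
  consider (A) "most U (R {})"
    | (B) "most U (\<lambda>s. \<not> R {} s)" "most U (\<lambda>s. most U (\<lambda>d. R s (s \<union> d)))"
    | (C) "most U (\<lambda>s. most U (\<lambda>d. \<not> R s (s \<union> d)))"
    by auto
  then show thesis
  proof cases
    case A
    then show thesis using ex_big all by blast
  next
    case B
    then have "most U (\<lambda>s. \<not> R {} s \<and> most U (\<lambda>d. R s (s \<union> d)))" by simp
    then obtain X1 where X1: "big X1"
      "\<And>s. s \<in> block_span X1 \<Longrightarrow> \<not> R {} s \<and> most U (\<lambda>d. R s (s \<union> d))"
      using ex_big by blast
    obtain X2 where X2: "big X2" "block_span X2 \<subseteq> block_span X1" "span0 X2 \<subseteq> span0 X1"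
      and diag_D2: "diagonal (\<lambda>q r d. R q (q \<union> d)) X2"
      by (rule diagonalizeE[OF X1(1)]; rule that)
    note D2 = diagonalD[OF diag_D2]
    have ext: "R s (s \<union> d)" if "s \<in> block_span X2" "d \<in> block_span X2" "prec s d" for s d
      using D2[of s s d] that X1(2)[of s] X2(2) span_subset_span0 by blast
    \<comment> \<open>If most \<open>t\<close> were related to \<open>s\<close>, then \<open>t\<close> and \<open>s \<union> t\<close> would be related, and \<open>inv\<close> gives \<open>R {} s\<close>.\<close>
    have no: "\<not> most U (\<lambda>t. R s t)" if s: "s \<in> block_span X2" for s
    proof
      assume "most U (\<lambda>t. R s t)"
      then have "most U (\<lambda>t. R s t \<and> t \<in> block_span X2 \<and> prec s t)"
        using most_tail[OF X2(1), of s] span0_finite[OF bigD(1)[OF X2(1)], of s] s span_subset_span0 by auto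
      then have "most U (\<lambda>c. R ({} \<union> c) (s \<union> c))"
      proof (rule most_mono)
        fix t assume "R s t \<and> t \<in> block_span X2 \<and> prec s t"
        then show "R ({} \<union> t) (s \<union> t)" using ext[OF s, of t] trans sym by (metis Un_empty_left)
      qed
      then have "R {} s" by (rule inv)
      then show False using s X1(2) X2(2) by blast
    qed
    obtain X3 where X3: "big X3" "block_span X3 \<subseteq> block_span X2" "span0 X3 \<subseteq> span0 X2"
      and diag_D3: "diagonal (\<lambda>q r d. \<not> R q d) X3"
      by (rule diagonalizeE[OF X2(1)]; rule that)
    note D3 = diagonalD[OF diag_D3]
    note b3 = bigD(1)[OF X3(1)]
    have blk: "\<not> R (X3 i) (X3 j)" if "i < j" for i j
      using D3[of "X3 i" "X3 i" "X3 j"] no[of "X3 i"] block_prec[OF b3 that] block_in_span[OF b3]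
        X3(2) span_subset_span0 by (metis most_not subsetD)
    have first: "\<exists>i. R (X3 i) a \<and> Min a = Min (X3 i)" if a: "a \<in> block_span X3" for a
    proof -
      obtain i b where i: "b \<in> span0 X3" "a = X3 i \<union> b" "prec (X3 i) b" "Min a = Min (X3 i)"
        using span_first[OF b3 a] by blast
      have "R (X3 i) a"
      proof (cases "b = {}")
        case False
        then have "b \<in> block_span X3" using i span_iff[OF b3] by blast
        then show ?thesis using ext[of "X3 i" b] i X3(2) block_in_span[OF b3] by auto
      qed (use i refl in simp)
      then show ?thesis using i by blast
    qed
    show thesis
    proof (rule min[OF X3(1)])
      show "\<not> R {} a" if "a \<in> block_span X3" for a using that X3(2) X2(2) X1(2) by blast
      fix a b assume ab: "a \<in> block_span X3" "b \<in> block_span X3"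
      obtain i j where i: "R (X3 i) a" "Min a = Min (X3 i)" and j: "R (X3 j) b" "Min b = Min (X3 j)"
        using first ab by metis
      have "R a b \<longleftrightarrow> R (X3 i) (X3 j)" using i j sym trans by blast
      also have "\<dots> \<longleftrightarrow> i = j"
        using blk[of i j] blk[of j i] sym refl by (metis linorder_neqE_nat)
      also have "\<dots> \<longleftrightarrow> Min a = Min b" using i j Min_block_inj[OF b3] by metis
      finally show "R a b \<longleftrightarrow> Min a = Min b" .
    qed
  next
    case C
    then obtain X1 where X1: "big X1"
      "\<And>s. s \<in> block_span X1 \<Longrightarrow> most U (\<lambda>d. \<not> R s (s \<union> d))"
      using ex_big by blast
    note b1 = bigD(1)[OF X1(1)]
    have new: "\<not> most U (\<lambda>a. R (q \<union> a) t)" if q: "q \<in> span0 X1" for q t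
    proof
      assume most1: "most U (\<lambda>a. R (q \<union> a) t)"
      then have "most U (\<lambda>a. most U (\<lambda>a'. R (q \<union> (a \<union> a')) t))"
        using most_idem[of "\<lambda>a. R (q \<union> a) t"] by simp
      then have "most U (\<lambda>a. R (q \<union> a) t \<and> most U (\<lambda>a'. R (q \<union> (a \<union> a')) t))" using most1 by simp
      then obtain a where a: "R (q \<union> a) t" "most U (\<lambda>a'. R (q \<union> (a \<union> a')) t)" "a \<in> block_span X1"
        by (rule most_span_obtain[OF _ X1(1), of _ "{}"]) auto
      have "most U (\<lambda>a'. R (q \<union> a) (q \<union> a \<union> a'))"
        by (rule most_mono[OF a(2)]) (use a(1) trans sym Un_assoc in metis)
      then show False using X1(2)[OF span_Un[OF b1 q a(3)]] by simp
    qed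
    obtain X2 where X2: "big X2" "block_span X2 \<subseteq> block_span X1" "span0 X2 \<subseteq> span0 X1"
      and diag_D2: "diagonal (\<lambda>q r a. \<not> R (q \<union> a) r) X2"
      by (rule diagonalizeE[OF X1(1)]; rule that)
    note D2 = diagonalD[OF diag_D2]
    obtain X3 where X3: "big X3" "block_span X3 \<subseteq> block_span X2" "span0 X3 \<subseteq> span0 X2"
      and diag_D3: "diagonal (\<lambda>q r c. \<not> R (q \<union> c) (r \<union> c)) X3"
      by (rule diagonalizeE[OF X2(1)]; rule that)
    note D3 = diagonalD[OF diag_D3]
    note b3 = bigD(1)[OF X3(1)]
    have key: "\<not> R (q \<union> X3 i \<union> c) (b \<union> c)"
      if "q \<in> span0 X3" "b \<in> span0 X3" "c \<in> span0 X3" "prec q (X3 i)" "prec b (X3 i)" "prec (X3 i) c" for q b c i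
    proof -
      have i: "X3 i \<in> block_span X3" using block_in_span[OF b3] .
      have n1: "\<not> R (q \<union> X3 i) b"
        using D2[of q b "X3 i"] new[of q b] that i X2 X3 by (metis most_not subsetD)
      show ?thesis
      proof (cases "c = {}")
        case False
        then have c: "c \<in> block_span X3" using that span_iff[OF b3] by blast
        have "most U (\<lambda>c. \<not> R ((q \<union> X3 i) \<union> c) (b \<union> c))" using n1 inv by auto
        moreover have "q \<union> X3 i \<in> span0 X3" using span_Un[OF b3 that(1) i] span_subset_span0 by blast
        moreover have "prec q c" "prec b c"
          using prec_trans that block_nonempty[OF b3] by blast+
        ultimately show ?thesis using D3[of "q \<union> X3 i" b c] that c by simp
      qed (use n1 in simp)
    qed
    show thesis
    proof (rule inj[OF X3(1)], rule ccontr)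
      fix s t assume st: "s \<in> span0 X3" "t \<in> span0 X3" "R s t" "s \<noteq> t"
      then show False using span0_differ[OF b3 st(1,2,4)] key sym by metis
    qed
  qed
qed

subsection \<open>Limits along continuations of a block\<close>

text \<open>The ultrafilter that remains when \<open>s\<close> is known to be an initial part of the next block, which
  is not yet completed.\<close>

definition tail_lim :: "(nat set \<Rightarrow> 'a ultra) \<Rightarrow> nat set \<Rightarrow> 'a ultra" where
  "tail_lim F s = lim U (\<lambda>t. F (s \<union> t))"

lemma tail_lim_empty [simp]: "tail_lim F {} = lim U F"
  unfolding tail_lim_def by simp

lemma most_tail_lim: "most (tail_lim F s) P \<longleftrightarrow> most U (\<lambda>t. most (F (s \<union> t)) P)"
  unfolding tail_lim_def by simp

lemma tail_lim_shift: "tail_lim (\<lambda>t. F (s \<union> t)) t = tail_lim F (s \<union> t)"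
  unfolding tail_lim_def by (simp add: Un_assoc)

text \<open>Idempotence of \<open>U\<close>: extending an uncompleted block by a further piece leaves it uncompleted.\<close>

lemma lim_tail_lim: "lim U (\<lambda>t. tail_lim F (s \<union> t)) = tail_lim F s"
proof (rule ultra_eqI)
  fix P
  show "most (lim U (\<lambda>t. tail_lim F (s \<union> t))) P = most (tail_lim F s) P"
    using most_idem[of "\<lambda>t. most (F (s \<union> t)) P"] by (simp add: most_tail_lim Un_assoc)
qed

lemma lim_of_tail_lim: "lim U (tail_lim F) = lim U F"
  using lim_tail_lim[of F "{}"] by simp

subsection \<open>Iterated discrete limits\<close>

text \<open>What can be remembered about a block. All three maps take values in finite sets, so that one type of
  index serves for \<open>U\<close>, \<open>U_min\<close> and \<open>U_max\<close>.\<close>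

definition records :: "(nat set \<Rightarrow> nat set) set" where
  "records = {\<lambda>s. {Min s}, \<lambda>s. {Max s}, \<lambda>s. s}"

inductive iterate :: "'a ultra \<Rightarrow> bool" where
  point: "iterate (point a)"
| dlim: "\<phi> \<in> records \<Longrightarrow> (\<And>x. iterate (P x)) \<Longrightarrow> decodes g (push \<phi> U) P \<Longrightarrow> iterate (lim (push \<phi> U) P)"

text \<open>If the minimum (or the maximum) of \<open>s\<close> determines \<open>W s\<close>, it is enough to separate the ultrafilters that
  belong to single blocks, and these form a sequence.\<close>

lemma iterate_lim_blocks:
  assumes X: "big X" and phi: "\<phi> \<in> records" and inj: "\<And>i j. \<phi> (X i) = \<phi> (X j) \<Longrightarrow> i = j"
    and blk: "\<And>s. s \<in> block_span X \<Longrightarrow> \<exists>i. \<phi> s = \<phi> (X i) \<and> W s = W (X i)"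
    and it: "\<And>i. iterate (W (X i))"
    and A: "\<And>i. most (W (X i)) (A i)"
    and up: "\<And>i j. i < j \<Longrightarrow> \<not> most (W (X j)) (A i)"
  shows "iterate (lim U W)"
proof -
  define ix where "ix x = (SOME i. \<phi> (X i) = x)" for x
  have ix: "ix (\<phi> (X i)) = i" for i
    unfolding ix_def by (rule some_equality) (use inj in auto)
  define P where "P x = W (X (ix x))" for x
  define S where "S = range (\<lambda>i. \<phi> (X i))"
  have "\<exists>B. (\<forall>x\<in>S. most (P x) (B x)) \<and> (\<forall>x\<in>S. \<forall>y\<in>S. \<forall>v. B x v \<longrightarrow> B y v \<longrightarrow> x = y)"
  proof (rule disjointify[where r = ix and A = "\<lambda>x. A (ix x)"])
    show "finite {x \<in> S. ix x \<le> k}" for k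
    proof (rule finite_subset)
      show "{x \<in> S. ix x \<le> k} \<subseteq> (\<lambda>i. \<phi> (X i)) ` {..k}" unfolding S_def using ix by auto
    qed simp
  qed (use A up ix in \<open>auto simp: P_def S_def\<close>)
  then obtain B where B: "\<And>x. x \<in> S \<Longrightarrow> most (P x) (B x)"
    "\<And>x y v. x \<in> S \<Longrightarrow> y \<in> S \<Longrightarrow> B x v \<Longrightarrow> B y v \<Longrightarrow> x = y" by blast
  have "most U (\<lambda>s. \<phi> s \<in> S)"
    by (rule most_mono[OF bigD(2)[OF X]]) (use blk in \<open>unfold S_def, blast\<close>)
  then obtain g where "decodes g (push \<phi> U) P"
    using decoder_of_disjoint[of "push \<phi> U" S P B] B by auto
  then have "iterate (lim (push \<phi> U) P)" using it phi by (intro dlim) (auto simp: P_def)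
  moreover have "lim (push \<phi> U) P = lim U W"
    unfolding lim_push
  proof (rule lim_cong, rule most_mono[OF bigD(2)[OF X]])
    fix s assume "s \<in> block_span X"
    then obtain i where "\<phi> s = \<phi> (X i)" "W s = W (X i)" using blk by blast
    then show "P (\<phi> s) = W s" by (simp add: P_def ix)
  qed
  ultimately show ?thesis by simp
qed

text \<open>Separating \<open>F s\<close> from the limit \<open>V\<close> also separates it from \<open>F t\<close> whenever \<open>Max s < Max t\<close>, because an
  initial part of \<open>t\<close> contributes nothing: its \<open>tail_lim\<close> is \<open>V\<close> as well. So \<open>F s\<close> determines \<open>Max s\<close>. To see
  what else it determines, apply the trichotomy to the relation \<open>F (a \<union> c) = F (b \<union> c)\<close> for most \<open>c\<close>. If all
  \<open>a\<close> are related to \<open>{}\<close>, then \<open>F s\<close> depends on the last block only and the limit runs along \<open>U_max\<close>.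
  Otherwise \<open>F s\<close> would also determine \<open>Min s\<close>, so the continuations of one block \<open>s0\<close> would be separated
  from all later sets, contradicting that \<open>tail_lim F s0\<close> and \<open>V\<close> agree.\<close>

lemma closing_case:
  assumes it: "\<And>s. iterate (F s)" and E: "most U (\<lambda>s. tail_lim F s = lim U F)"
  shows "iterate (lim U F)"
proof (cases "most U (\<lambda>s. F s = lim U F)")
  case True
  then obtain s where "F s = lim U F" using most_ex by blast
  then show ?thesis using it by metis
next
  case False
  define V where "V = lim U F"
  have "most U (\<lambda>s. F s \<noteq> V \<and> tail_lim F s = V)" using False E unfolding V_def by simp
  then obtain X0 where X0: "big X0" "\<And>s. s \<in> block_span X0 \<Longrightarrow> F s \<noteq> V \<and> tail_lim F s = V"
    using ex_big by blast
  have tl: "tail_lim F q = V" if "q \<in> span0 X0" for q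
    using that X0(2) V_def unfolding span0_def by auto
  have "\<forall>s. \<exists>A. F s \<noteq> V \<longrightarrow> most (F s) A \<and> \<not> most V A" using ultra_separate by blast
  then obtain A where A: "\<And>s. F s \<noteq> V \<Longrightarrow> most (F s) (A s) \<and> \<not> most V (A s)" by metis
  obtain X1 where X1: "big X1" "block_span X1 \<subseteq> block_span X0" "span0 X1 \<subseteq> span0 X0"
    and diag_D1: "diagonal (\<lambda>q r t. \<not> most (F (q \<union> t)) (A r)) X1"
    by (rule diagonalizeE[OF X0(1)]; rule that)
  note D1 = diagonalD[OF diag_D1]
  note b1 = bigD(1)[OF X1(1)]
  have A1: "most (F s) (A s)" if "s \<in> block_span X1" for s using A X0 X1 that by blast
  have up: "\<not> most (F t) (A s)" if s: "s \<in> block_span X1" and t: "t \<in> block_span X1" and lt: "Max s < Max t" for s t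
  proof -
    obtain q c where qc: "q \<in> span0 X1" "c \<in> span0 X1" "t = q \<union> c" "q \<subseteq> down s" "prec s c"
      using span0_cut[OF b1, of t s] s t span_subset_span0 by blast
    have "c \<noteq> {}"
    proof
      assume "c = {}"
      then have "t \<subseteq> {..Max s}" using qc down_FIN[OF span_FIN[OF b1 s]] by simp
      moreover have "Max t \<in> t" using span_FIN[OF b1 t] unfolding FIN_def by simp
      ultimately show False using lt by auto
    qed
    then have c: "c \<in> block_span X1" using qc span_iff[OF b1] by blast
    have "\<not> most (tail_lim F q) (A s)" using tl[of q] A X0(2) X1 qc s by auto
    then have "most U (\<lambda>t. \<not> most (F (q \<union> t)) (A s))" by (simp add: most_tail_lim)
    then show ?thesis using D1[of q s c] qc c s prec_subset span_subset_span0 by blast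
  qed
  define R where "R a b \<longleftrightarrow> most U (\<lambda>c. F (a \<union> c) = F (b \<union> c))" for a b
  obtain X2 where X2: "big X2" "block_span X2 \<subseteq> block_span X1" "span0 X2 \<subseteq> span0 X1"
    and diag_D2: "diagonal (\<lambda>q r c. F (q \<union> c) = F (r \<union> c)) X2"
    by (rule diagonalizeE[OF X1(1)]; rule that)
  note D2 = diagonalD[OF diag_D2]
  obtain X3 where X3: "big X3" "block_span X3 \<subseteq> block_span X2" "span0 X3 \<subseteq> span0 X2"
    and diag_D3: "diagonal (\<lambda>q r c. F (q \<union> c) \<noteq> F (r \<union> c)) X3"
    by (rule diagonalizeE[OF X2(1)]; rule that)
  note D3 = diagonalD[OF diag_D3]
  have R: "F (a \<union> c) = F (b \<union> c) \<longleftrightarrow> R a b"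
    if "a \<in> span0 X3" "b \<in> span0 X3" "c \<in> block_span X3" "prec a c" "prec b c" for a b c
    using D2[of a b c] D3[of a b c] that X3 unfolding R_def by auto
  have below3: "\<exists>Y. big Y \<and> block_span Y \<subseteq> block_span X3 \<and> block_span Y \<subseteq> block_span Z" if "big Z" for Z
    using big_subset[OF X3(1) bigD(2)[OF that]] by (metis subsetI)
  \<comment> \<open>The values \<open>F s\<close> determine \<open>Min s\<close>, and they are pairwise separated by sets \<open>B (F s)\<close>. The union \<open>Q\<close>
    of these sets over \<open>s\<close> after \<open>s0\<close> is in \<open>V\<close> but not in \<open>tail_lim F s0\<close>.\<close>
  have contra: False
    if X4: "big X4" and N1: "\<And>a. a \<in> block_span X4 \<Longrightarrow> \<not> R {} a"
      and N2: "\<And>a b. a \<in> block_span X4 \<Longrightarrow> b \<in> block_span X4 \<Longrightarrow> R a b \<Longrightarrow> Min a = Min b" for X4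
  proof -
    obtain X where X: "big X" "block_span X \<subseteq> block_span X3" "block_span X \<subseteq> block_span X4"
      using below3[OF X4] by blast
    note b = bigD(1)[OF X(1)]
    have bs3: "span0 X \<subseteq> span0 X3" using span0_mono X by blast
    have X_1: "block_span X \<subseteq> block_span X1" using X X2 X3 by blast
    have eqMax: "Max s = Max t" if "s \<in> block_span X" "t \<in> block_span X" "F s = F t" for s t
    proof (rule ccontr)
      assume "Max s \<noteq> Max t"
      then consider "Max s < Max t" | "Max t < Max s" by linarith
      then show False using up[of s t] up[of t s] A1[of s] A1[of t] that X_1 by (cases; auto)
    qed
    have eqMin: "Min s = Min t" if s: "s \<in> block_span X" and t: "t \<in> block_span X" and eq: "F s = F t" for s t
    proof -
      obtain i a where i: "a \<in> span0 X" "s = a \<union> X i" "prec a (X i)" "Max s = Max (X i)"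
        using span_last[OF b s] by blast
      obtain j c where j: "c \<in> span0 X" "t = c \<union> X j" "prec c (X j)" "Max t = Max (X j)"
        using span_last[OF b t] by blast
      have ij: "j = i" using eqMax[OF s t eq] i(4) j(4) Max_block_inj[OF b, of i j] by simp
      have R: "R a c"
        using R[of a c "X i"] i j eq bs3 X(2) block_in_span[OF b, of i] unfolding ij by blast
      have Ra: "R c a" using R unfolding R_def by (simp add: eq_commute)
      show ?thesis
      proof (cases "a = {} \<or> c = {}")
        case True
        then have "a = {} \<and> c = {}"
          using N1[of a] N1[of c] R Ra i(1) j(1) X(3) unfolding span0_def by blast
        then show ?thesis using i j ij by simp
      next
        case False
        then have ac: "a \<in> block_span X" "c \<in> block_span X" using i j span_iff[OF b] by blast+
        then have "Min a = Min c" using N2[of a c] R X(3) by blast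
        then show ?thesis
          using i(2,3) j(2,3) ij Min_Un_prec[OF span_FIN[OF b ac(1)] block_FIN[OF b, of i]]
            Min_Un_prec[OF span_FIN[OF b ac(2)] block_FIN[OF b, of i]] by simp
      qed
    qed
    define rep where "rep y = (SOME s. s \<in> block_span X \<and> F s = y)" for y
    have rep: "rep y \<in> block_span X" "F (rep y) = y" if "y \<in> F ` block_span X" for y
      using that someI_ex[of "\<lambda>s. s \<in> block_span X \<and> F s = y"] unfolding rep_def by auto
    have "\<exists>B. (\<forall>y\<in>F ` block_span X. most y (B y)) \<and>
        (\<forall>x\<in>F ` block_span X. \<forall>y\<in>F ` block_span X. \<forall>v. B x v \<longrightarrow> B y v \<longrightarrow> x = y)"
    proof (rule disjointify[where r = "\<lambda>y. Max (rep y)" and A = "\<lambda>y. A (rep y)"])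
      show "finite {x \<in> F ` block_span X. Max (rep x) \<le> k}" for k
      proof (rule finite_subset)
        show "{x \<in> F ` block_span X. Max (rep x) \<le> k} \<subseteq> F ` {s \<in> block_span X. Max s \<le> k}"
        proof
          fix x assume "x \<in> {x \<in> F ` block_span X. Max (rep x) \<le> k}"
          then show "x \<in> F ` {s \<in> block_span X. Max s \<le> k}"
            using rep[of x] by (intro image_eqI[of _ _ "rep x"]) auto
        qed
      qed (simp add: finite_span_Max[OF b])
      show "most y (A (rep y))" if "y \<in> F ` block_span X" for y
        using A1[of "rep y"] rep[OF that] X_1 by auto
      show "\<not> most y (A (rep x))" if "x \<in> F ` block_span X" "y \<in> F ` block_span X" "Max (rep x) < Max (rep y)" for x y
        using up[of "rep x" "rep y"] rep[OF that(1)] rep[OF that(2)] that(3) X_1 by auto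
    qed simp
    then obtain B where B: "\<And>s. s \<in> block_span X \<Longrightarrow> most (F s) (B (F s))"
      "\<And>s t v. s \<in> block_span X \<Longrightarrow> t \<in> block_span X \<Longrightarrow> B (F s) v \<Longrightarrow> B (F t) v \<Longrightarrow> F s = F t"
      by (metis image_eqI)
    define s0 where "s0 = X 0"
    have s0: "s0 \<in> block_span X" "finite s0" "s0 \<in> FIN"
      unfolding s0_def using block_in_span[OF b] block_finite[OF b] block_FIN[OF b] by auto
    define Q where "Q v \<longleftrightarrow> (\<exists>t\<in>block_span X. prec s0 t \<and> B (F t) v)" for v
    have FQ: "most (F t) Q" if "t \<in> block_span X" "prec s0 t" for t
      by (rule most_mono[OF B(1)[OF that(1)]]) (use that in \<open>auto simp: Q_def\<close>)
    have "most U (\<lambda>t. most (F t) Q)"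
      by (rule most_mono[OF most_tail[OF X(1) s0(2)]]) (use FQ in blast)
    then have "most V Q" unfolding V_def by simp
    moreover have "tail_lim F s0 = V" using X0(2) X_1 X1(2) s0 by blast
    ultimately have "most U (\<lambda>t. most (F (s0 \<union> t)) Q)" unfolding most_tail_lim[symmetric] by simp
    then obtain t where t: "most (F (s0 \<union> t)) Q" "t \<in> block_span X" "prec s0 t"
      by (rule most_span_obtain[OF _ X(1) s0(2)]) (rule that)
    have st: "s0 \<union> t \<in> block_span X" using span_Un[OF b _ t(2)] s0 span_subset_span0 by blast
    obtain v where "Q v" "B (F (s0 \<union> t)) v"
      using most_ex[of "F (s0 \<union> t)" "\<lambda>v. Q v \<and> B (F (s0 \<union> t)) v"] t(1) B(1)[OF st] by auto
    then obtain t' where t': "t' \<in> block_span X" "prec s0 t'" "F t' = F (s0 \<union> t)"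
      using B(2)[OF _ st] unfolding Q_def by blast
    have "Min t' = Min s0"
      using eqMin[OF t'(1) st t'(3)] Min_Un_prec[OF s0(3) span_FIN[OF b t(2)] t(3)] by simp
    moreover have "Max s0 < Min t'" using t' s0 span_FIN[OF b] by (simp add: prec_iff_Max_less_Min)
    ultimately show False using Min_le_Max_FIN[OF s0(3)] by simp
  qed
  have "iterate (lim U F)"
  proof (rule trichotomy[of R])
    show "R a a" for a unfolding R_def by simp
    show "R b a" if "R a b" for a b using that unfolding R_def by (simp add: eq_commute)
    show "R a c" if "R a b" "R b c" for a b c
    proof -
      have "most U (\<lambda>d. F (a \<union> d) = F (b \<union> d) \<and> F (b \<union> d) = F (c \<union> d))" using that unfolding R_def by simp
      then show ?thesis unfolding R_def by (rule most_mono) simp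
    qed
    show "R a b" if "most U (\<lambda>c. R (a \<union> c) (b \<union> c))" for a b
      using that most_idem[of "\<lambda>c. F (a \<union> c) = F (b \<union> c)"] unfolding R_def by (simp add: Un_assoc)
  next
    fix X4 assume X4: "big X4" "\<And>a. a \<in> block_span X4 \<Longrightarrow> R {} a"
    obtain X where X: "big X" "block_span X \<subseteq> block_span X3" "block_span X \<subseteq> block_span X4"
      using below3[OF X4(1)] by blast
    note b = bigD(1)[OF X(1)]
    have bs3: "span0 X \<subseteq> span0 X3" using span0_mono X by blast
    have X_1: "block_span X \<subseteq> block_span X1" using X X2 X3 by blast
    show "iterate (lim U F)"
    proof (rule iterate_lim_blocks[OF X(1), of "\<lambda>s. {Max s}" F "\<lambda>i. A (X i)"])
      show "(\<lambda>s. {Max s}) \<in> records" unfolding records_def by simp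
      show "i = j" if "{Max (X i)} = {Max (X j)}" for i j using that Max_block_inj[OF b] by simp
      show "\<exists>i. {Max s} = {Max (X i)} \<and> F s = F (X i)" if s: "s \<in> block_span X" for s
      proof -
        obtain i a where i: "a \<in> span0 X" "s = a \<union> X i" "prec a (X i)" "Max s = Max (X i)"
          using span_last[OF b s] by blast
        have "F (a \<union> X i) = F ({} \<union> X i)"
        proof (cases "a = {}")
          case False
          then have a: "a \<in> block_span X" using i span_iff[OF b] by blast
          have "X i \<in> block_span X3" using block_in_span[OF b] X(2) by blast
          then have "F ({} \<union> X i) = F (a \<union> X i)" using R[of "{}" a "X i"] X4(2)[of a] i a bs3 X(3) by auto
          then show ?thesis by simp
        qed simp
        then show ?thesis using i by auto
      qed
      show "most (F (X i)) (A (X i))" for i using A1 block_in_span[OF b] X_1 by blast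
      show "\<not> most (F (X j)) (A (X i))" if "i < j" for i j
      proof (rule up)
        have "Max (X i) < Min (X j)" using block_prec[OF b that] block_FIN[OF b] by (simp add: prec_iff_Max_less_Min)
        then show "Max (X i) < Max (X j)" using Min_le_Max_FIN[OF block_FIN[OF b, of j]] by linarith
      qed (use block_in_span[OF b] X_1 in blast)+
    qed (rule it)
  next
    fix X4 assume "big X4" "\<And>a. a \<in> block_span X4 \<Longrightarrow> \<not> R {} a"
      "\<And>a b. a \<in> block_span X4 \<Longrightarrow> b \<in> block_span X4 \<Longrightarrow> R a b \<longleftrightarrow> Min a = Min b"
    then have False using contra[of X4] by blast
    then show "iterate (lim U F)" ..
  next
    fix X4 assume X4: "big X4" "\<And>a b. a \<in> span0 X4 \<Longrightarrow> b \<in> span0 X4 \<Longrightarrow> R a b \<Longrightarrow> a = b"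
    have False
    proof (rule contra[OF X4(1)])
      show "\<not> R {} a" if "a \<in> block_span X4" for a
        using X4(2)[of "{}" a] that span_iff[OF bigD(1)[OF X4(1)]] by auto
      show "Min a = Min b" if "a \<in> block_span X4" "b \<in> block_span X4" "R a b" for a b
        using X4(2)[of a b] that span_subset_span0 by blast
    qed
    then show "iterate (lim U F)" ..
  qed
  then show ?thesis .
qed

text \<open>The limit of \<open>F\<close> equals the limit of its tail limits, which by assumption are indexed by minima and are
  separated from later ones like any sequence converging to a different ultrafilter. Each of them is
  itself the limit of a family with constant tail limits.\<close>

lemma min_case:
  assumes it: "\<And>s. iterate (F s)" and X0: "big X0"
    and ne: "\<And>a. a \<in> block_span X0 \<Longrightarrow> tail_lim F a \<noteq> lim U F"
    and eq: "\<And>a b. a \<in> block_span X0 \<Longrightarrow> b \<in> block_span X0 \<Longrightarrow> Min a = Min b \<Longrightarrow> tail_lim F a = tail_lim F b"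
  shows "iterate (lim U F)"
proof -
  note b0 = bigD(1)[OF X0]
  have itE: "iterate (tail_lim F s)" if s: "s \<in> block_span X0" for s
  proof -
    have "iterate (lim U (\<lambda>t. F (s \<union> t)))"
    proof (rule closing_case)
      show "iterate (F (s \<union> t))" for t by (rule it)
      show "most U (\<lambda>t. tail_lim (\<lambda>t. F (s \<union> t)) t = lim U (\<lambda>t. F (s \<union> t)))"
        unfolding tail_lim_shift tail_lim_def[of F s, symmetric]
      proof (rule most_mono[OF most_tail[OF X0]])
        show "finite s" using span_FIN[OF b0 s] unfolding FIN_def by simp
        fix t assume t: "t \<in> block_span X0 \<and> prec s t"
        show "tail_lim F (s \<union> t) = tail_lim F s"
        proof (rule eq)
          show "s \<union> t \<in> block_span X0" using span_Un[OF b0, of s t] s t span_subset_span0 by blast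
          show "Min (s \<union> t) = Min s" using Min_Un_prec span_FIN[OF b0] s t by blast
        qed (rule s)
      qed
    qed
    then show ?thesis unfolding tail_lim_def .
  qed
  have "\<forall>s. \<exists>A. tail_lim F s \<noteq> lim U F \<longrightarrow> most (tail_lim F s) A \<and> \<not> most (lim U F) A"
    using ultra_separate by blast
  then obtain A where A: "\<And>s. tail_lim F s \<noteq> lim U F \<Longrightarrow> most (tail_lim F s) (A s) \<and> \<not> most (lim U F) (A s)"
    by metis
  obtain X where X: "big X" "block_span X \<subseteq> block_span X0" "span0 X \<subseteq> span0 X0"
    and diag_D: "diagonal (\<lambda>q r t. \<not> most (tail_lim F t) (A r)) X"
    by (rule diagonalizeE[OF X0]; rule that)
  note D = diagonalD[OF diag_D]
  note b = bigD(1)[OF X(1)]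
  have in0: "X i \<in> block_span X0" for i using block_in_span[OF b] X(2) by blast
  have "iterate (lim U (tail_lim F))"
  proof (rule iterate_lim_blocks[OF X(1), of "\<lambda>s. {Min s}" _ "\<lambda>i. A (X i)"])
    show "(\<lambda>s. {Min s}) \<in> records" unfolding records_def by simp
    show "i = j" if "{Min (X i)} = {Min (X j)}" for i j using that Min_block_inj[OF b] by simp
    show "\<exists>i. {Min s} = {Min (X i)} \<and> tail_lim F s = tail_lim F (X i)" if s: "s \<in> block_span X" for s
    proof -
      obtain i where "Min s = Min (X i)" using span_first[OF b s] by blast
      then show ?thesis using eq[of s "X i"] s X(2) in0 by auto
    qed
    show "iterate (tail_lim F (X i))" for i using itE in0 by blast
    show "most (tail_lim F (X i)) (A (X i))" for i using A ne in0 by blast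
    show "\<not> most (tail_lim F (X j)) (A (X i))" if "i < j" for i j
    proof -
      have "\<not> most (lim U (tail_lim F)) (A (X i))" unfolding lim_of_tail_lim using A ne in0 by blast
      then have "most U (\<lambda>t. \<not> most (tail_lim F t) (A (X i)))" by simp
      then show ?thesis using D[of "X i" "X i" "X j"] block_prec[OF b that] block_in_span[OF b] span_subset_span0 by blast
    qed
  qed
  then show ?thesis unfolding lim_of_tail_lim .
qed

end

section \<open>Separating a limit from approximations\<close>

text \<open>On the fibre of \<open>g\<close> over \<open>x\<close>, impose only those finitely many separating sets whose index \<open>t\<close> lies below
  \<open>x\<close>; then every component \<open>P x\<close> can contain the result. For a given \<open>t\<close> this still covers \<open>D t\<close>-most fibres,
  and \<open>Q t\<close> weighs the fibres exactly like \<open>lim (D t) P\<close>, so a difference between these two cannot be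
  hidden in the other fibres.\<close>

lemma separate_limit:
  fixes Q :: "nat set \<Rightarrow> 'a ultra"
  shows "\<exists>C. (\<forall>x. most (P x) (\<lambda>v. g v = x) \<longrightarrow> most (P x) C) \<and>
    (\<forall>t. most (D t) (\<lambda>x. finite x \<and> t \<subseteq> down x) \<longrightarrow> push g (Q t) = D t \<longrightarrow> Q t \<noteq> lim (D t) P \<longrightarrow>
      \<not> most (Q t) C)"
proof -
  define bad where "bad t \<longleftrightarrow> lim (D t) P \<noteq> Q t" for t
  obtain C0 where "\<forall>t. bad t \<longrightarrow> most (lim (D t) P) (C0 t) \<and> \<not> most (Q t) (C0 t)"
    using separate_family[of "\<lambda>t. lim (D t) P" Q] unfolding bad_def ..
  note C0 = this[rule_format]
  define T where "T x = {t. bad t \<and> finite x \<and> t \<subseteq> down x \<and> most (P x) (C0 t)}" for x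
  have finT: "finite (T x)" for x
  proof (cases "finite x")
    case True
    then have "finite (Pow (down x))" using finite_down by simp
    moreover have "T x \<subseteq> Pow (down x)" unfolding T_def by blast
    ultimately show ?thesis by (rule rev_finite_subset)
  qed (simp add: T_def)
  define C where "C v \<longleftrightarrow> (\<forall>t\<in>T (g v). C0 t v)" for v
  have "most (P x) C" if x: "most (P x) (\<lambda>v. g v = x)" for x
  proof -
    have "most (P x) (\<lambda>v. \<forall>t\<in>T x. C0 t v)"
      unfolding most_ball_finite[OF finT] by (simp add: T_def)
    then have "most (P x) (\<lambda>v. (\<forall>t\<in>T x. C0 t v) \<and> g v = x)" using x by simp
    then show ?thesis by (rule most_mono) (simp add: C_def)
  qed
  moreover have "\<not> most (Q t) C"
    if t: "most (D t) (\<lambda>x. finite x \<and> t \<subseteq> down x)" and push: "push g (Q t) = D t" and ne: "Q t \<noteq> lim (D t) P" for t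
  proof
    assume C: "most (Q t) C"
    have b: "bad t" using not_sym[OF ne] unfolding bad_def .
    have "most (D t) (\<lambda>x. t \<in> T x)" using t C0[OF b] b unfolding T_def by simp
    then have "most (Q t) (\<lambda>v. t \<in> T (g v))" unfolding push[symmetric] by simp
    then have "most (Q t) (\<lambda>v. t \<in> T (g v) \<and> C v)" using C by simp
    then have "most (Q t) (C0 t)" by (rule most_mono) (simp add: C_def)
    then show False using C0[OF b] by simp
  qed
  ultimately show ?thesis by blast
qed

text \<open>Colour a point by the parity of the number of steps of \<open>f\<close> that it takes to leave \<open>S\<close>.\<close>

lemma two_colouring:
  fixes m :: "'x \<Rightarrow> nat"
  assumes "\<And>x. x \<in> S \<Longrightarrow> m (f x) < m x"
  shows "\<exists>c :: 'x \<Rightarrow> bool. \<forall>x\<in>S. c (f x) \<noteq> c x"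
proof -
  define n where "n x = (LEAST n. (f ^^ n) x \<notin> S)" for x
  have ex: "\<exists>n. (f ^^ n) x \<notin> S" for x
  proof (induction "m x" arbitrary: x rule: less_induct)
    case less
    show ?case
    proof (cases "x \<in> S")
      case True
      then obtain n where "(f ^^ n) (f x) \<notin> S" using less[OF assms[OF True]] by blast
      then have "(f ^^ Suc n) x \<notin> S" by (simp add: funpow_swap1)
      then show ?thesis by blast
    next
      case False
      then have "(f ^^ 0) x \<notin> S" by simp
      then show ?thesis by blast
    qed
  qed
  have "n x = Suc (n (f x))" if "x \<in> S" for x
  proof -
    obtain k where k: "(f ^^ k) x \<notin> S" using ex by blast
    have "n x = Suc (LEAST n. (f ^^ Suc n) x \<notin> S)"
      unfolding n_def by (rule Least_Suc[of "\<lambda>n. (f ^^ n) x \<notin> S", OF k]) (use that in simp)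
    then show ?thesis unfolding n_def by (simp add: funpow_swap1)
  qed
  then have "\<forall>x\<in>S. even (n (f x)) \<noteq> even (n x)" by simp
  then show ?thesis by (intro exI[of _ "\<lambda>x. even (n x)"])
qed

context stable_ultra
begin

lemma not_point: "\<not> most U (\<lambda>s. s = u)"
proof
  assume u: "most U (\<lambda>s. s = u)"
  then have "most U (\<lambda>s. s = u \<and> s \<in> FIN)" using most_FIN by simp
  then have "u \<in> FIN" using most_ex by blast
  then have "finite u" "u \<noteq> {}" unfolding FIN_def by auto
  then have "most U (\<lambda>s. s = u \<and> prec u s)" using u most_prec by simp
  then have "prec u u" using most_ex by blast
  then show False using prec_disjoint \<open>u \<noteq> {}\<close> by blast
qed

lemma records_subset: "\<phi> \<in> records \<Longrightarrow> s \<in> FIN \<Longrightarrow> \<phi> s \<subseteq> s \<and> \<phi> s \<noteq> {}"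
  using Min_in[of s] Max_in[of s] unfolding records_def FIN_def by (elim CollectE conjE insertE) simp_all

lemma records_nonprincipal:
  assumes "\<phi> \<in> records"
  shows "\<not> most U (\<lambda>s. \<phi> s = y)"
proof
  assume y: "most U (\<lambda>s. \<phi> s = y)"
  then have "most U (\<lambda>s. \<phi> s = y \<and> s \<in> FIN)" using most_FIN by simp
  then obtain s where "\<phi> s = y" "s \<in> FIN" using most_ex by blast
  then obtain k where k: "k \<in> y" using records_subset[OF assms] by blast
  have "most U (\<lambda>s. \<phi> s = y \<and> s \<in> FIN \<and> prec {k} s)" using y most_FIN most_prec by simp
  then obtain s where "\<phi> s = y" "s \<in> FIN" "prec {k} s" using most_ex by blast
  then show False using k records_subset[OF assms] unfolding prec_def by blast
qed

lemma records_tail: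
  assumes "\<phi> \<in> records" "finite t"
  shows "most U (\<lambda>s. finite (\<phi> s) \<and> t \<subseteq> down (\<phi> s))"
proof -
  have "most U (\<lambda>s. s \<in> FIN \<and> prec t s)" using most_FIN most_prec[OF assms(2)] by simp
  then show ?thesis
  proof (rule most_mono)
    fix s assume s: "s \<in> FIN \<and> prec t s"
    then have "\<phi> s \<subseteq> s" "\<phi> s \<noteq> {}" using records_subset[OF assms(1)] by blast+
    moreover have "finite s" using s unfolding FIN_def by simp
    moreover obtain y where "y \<in> \<phi> s" using calculation(2) by blast
    ultimately have "finite (\<phi> s)" "\<And>x. x \<in> t \<Longrightarrow> x \<le> y" "y \<in> \<phi> s"
      using s finite_subset unfolding prec_def by (blast, fastforce, blast)
    then show "finite (\<phi> s) \<and> t \<subseteq> down (\<phi> s)" unfolding down_def by blast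
  qed
qed

text \<open>If ultrafilters \<open>Q t\<close> converge to a discrete limit without being equal to it, the decoder sees the
  difference: otherwise \<open>separate_limit\<close> would give a set in the limit that lies in no \<open>Q t\<close>.\<close>

lemma images_differ:
  assumes phi: "\<phi> \<in> records" and dec: "decodes g (push \<phi> U) P"
    and lim: "lim U Q = lim (push \<phi> U) P" and ne: "most U (\<lambda>t. Q t \<noteq> lim (push \<phi> U) P)"
  shows "most U (\<lambda>t. push g (Q t) \<noteq> push \<phi> U)"
proof (rule ccontr)
  assume "\<not> ?thesis"
  then have eq: "most U (\<lambda>t. push g (Q t) = push \<phi> U)" by simp
  obtain C where C: "\<And>x. most (P x) (\<lambda>v. g v = x) \<Longrightarrow> most (P x) C"
    "\<And>t. most (push \<phi> U) (\<lambda>x. finite x \<and> t \<subseteq> down x) \<Longrightarrow> push g (Q t) = push \<phi> U \<Longrightarrow>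
      Q t \<noteq> lim (push \<phi> U) P \<Longrightarrow> \<not> most (Q t) C"
    using separate_limit[of P g "\<lambda>_. push \<phi> U" Q] by blast
  have "most (push \<phi> U) (\<lambda>x. most (P x) C)"
    by (rule most_mono[OF dec[unfolded decodes_def]]) (rule C(1))
  then have "most U (\<lambda>t. most (Q t) C)" using lim by (metis most_lim)
  then have "most U (\<lambda>t. most (Q t) C \<and> push g (Q t) = push \<phi> U \<and> Q t \<noteq> lim (push \<phi> U) P \<and> t \<in> FIN)"
    using eq ne most_FIN by simp
  then obtain t where t: "most (Q t) C" "push g (Q t) = push \<phi> U" "Q t \<noteq> lim (push \<phi> U) P" "t \<in> FIN"
    using most_ex by blast
  have "most (push \<phi> U) (\<lambda>x. finite x \<and> t \<subseteq> down x)"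
    using records_tail[OF phi, of t] t(4) unfolding FIN_def by simp
  then show False using C(2) t by blast
qed

section \<open>Families of ultrafilters converging to \<open>U\<close>\<close>

lemma span0_initial:
  assumes X: "block_seq X" and s: "s \<in> span0 X" and t: "t \<in> span0 X"
  shows "s \<inter> down t \<in> span0 X" "s - down t \<in> span0 X" "prec t (s - down t)"
proof -
  obtain q c where qc: "q \<in> span0 X" "c \<in> span0 X" "s = q \<union> c" "q \<subseteq> down t" "prec t c"
    using span0_cut[OF X s t] by blast
  have "c \<inter> down t = {}" using qc(5) unfolding prec_def down_def by fastforce
  then have "s \<inter> down t = q" "s - down t = c" using qc by auto
  then show "s \<inter> down t \<in> span0 X" "s - down t \<in> span0 X" "prec t (s - down t)" using qc by auto
qed

text \<open>If \<open>G t\<close> concentrated on sets after \<open>t\<close>, a diagonal span would be in \<open>U\<close> but, avoiding the sets that separate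
  \<open>U\<close> from \<open>G t\<close>, in no \<open>G t\<close>. So \<open>G t\<close> decides a nonempty part \<open>b t\<close> of its members up to \<open>Max t\<close>. If \<open>b t \<noteq> t\<close>, the
  function \<open>b\<close> is decreasing in one of three well-founded ways, so two colours distinguish \<open>t\<close> from \<open>b t\<close>; but a
  monochromatic span in \<open>U\<close> contains \<open>t\<close> and a member of \<open>G t\<close>, hence also its initial part \<open>b t\<close>.\<close>

lemma converging_initial:
  assumes lim: "lim U G = U" and ne: "most U (\<lambda>t. G t \<noteq> U)"
  shows "most U (\<lambda>t. most (G t) (\<lambda>s. s \<inter> down t = t))"
proof -
  have notprec: "most U (\<lambda>t. \<not> most (G t) (prec t))"
  proof (rule ccontr)
    assume "\<not> ?thesis"
    then have pr: "most U (\<lambda>t. most (G t) (prec t))" by simp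
    obtain C where "\<forall>t. U \<noteq> G t \<longrightarrow> most U (C t) \<and> \<not> most (G t) (C t)"
      using separate_family[of "\<lambda>_. U" G] ..
    note C = this[rule_format]
    obtain X0 where X0: "big X0" "\<And>t. t \<in> block_span X0 \<Longrightarrow> G t \<noteq> U" using ex_big[OF ne] by blast
    obtain Y where Y: "big Y" "block_span Y \<subseteq> block_span X0" "span0 Y \<subseteq> span0 X0"
      and diag_D: "diagonal (\<lambda>q r s. C r s) Y"
      by (rule diagonalizeE[OF X0(1)]; rule that)
    note D = diagonalD[OF diag_D]
    have "most U (\<lambda>t. most (G t) (\<lambda>s. s \<in> block_span Y))"
      using bigD(2)[OF Y(1)] by (subst (asm) lim[symmetric]) simp
    then have "most U (\<lambda>t. most (G t) (\<lambda>s. s \<in> block_span Y) \<and> most (G t) (prec t))" using pr by simp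
    then obtain t where t: "most (G t) (\<lambda>s. s \<in> block_span Y) \<and> most (G t) (prec t)" "t \<in> block_span Y"
      by (rule most_span_obtain[OF _ Y(1) finite.emptyI]) (rule that)
    then have ts: "most (G t) (\<lambda>s. s \<in> block_span Y \<and> prec t s)" by simp
    have Ct: "most U (C t)" "\<not> most (G t) (C t)" using C[of t] X0(2) Y(2) t(2) by (metis subsetD)+
    have "most (G t) (C t)"
      by (rule most_mono[OF ts]) (use D[of t t] t(2) span_subset_span0 Ct(1) in blast)
    then show False using Ct(2) by simp
  qed
  have "\<exists>b\<subseteq>down t. most (G t) (\<lambda>s. s \<inter> down t = b)" if "finite t" for t
  proof -
    have "most (G t) (\<lambda>s. \<exists>b\<in>Pow (down t). s \<inter> down t = b)"
      by (rule most_mono[of _ "\<lambda>_. True"]) auto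
    then show ?thesis
      using most_bex_finite[of "Pow (down t)" "G t" "\<lambda>b s. s \<inter> down t = b"] finite_down[OF that] by auto
  qed
  then have "\<forall>t. \<exists>b. finite t \<longrightarrow> b \<subseteq> down t \<and> most (G t) (\<lambda>s. s \<inter> down t = b)" by blast
  then obtain b where b: "\<And>t. finite t \<Longrightarrow> b t \<subseteq> down t \<and> most (G t) (\<lambda>s. s \<inter> down t = b t)" by metis
  have bne: "b t \<noteq> {}" if t: "finite t" "\<not> most (G t) (prec t)" for t
  proof
    assume e: "b t = {}"
    have "most (G t) (prec t)"
    proof (rule most_mono)
      show "most (G t) (\<lambda>s. s \<inter> down t = b t)" using b[OF t(1)] by blast
      fix s assume s: "s \<inter> down t = b t"
      show "prec t s"
        unfolding prec_def
      proof (intro ballI)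
        fix x y assume "x \<in> t" "y \<in> s"
        then show "x < y" using s e unfolding down_def by (metis (mono_tags, lifting) IntI empty_iff mem_Collect_eq not_less)
      qed
    qed
    then show False using t by simp
  qed
  have main: "most U (\<lambda>t. b t = t)"
  proof (rule ccontr)
    assume "\<not> ?thesis"
    then have "most U (\<lambda>t. b t \<noteq> t \<and> \<not> most (G t) (prec t) \<and> t \<in> FIN)" using notprec most_FIN by simp
    then have S: "most U (\<lambda>t. t \<in> FIN \<and> b t \<in> FIN \<and> b t \<noteq> t \<and> Max (b t) \<le> Max t)"
    proof (rule most_mono)
      fix t assume t: "b t \<noteq> t \<and> \<not> most (G t) (prec t) \<and> t \<in> FIN"
      then have ft: "finite t" unfolding FIN_def by simp
      have "b t \<subseteq> {..Max t}" "b t \<noteq> {}" using b[OF ft] bne[OF ft] t down_FIN by auto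
      moreover from this have "finite (b t)" by (meson finite_atMost finite_subset)
      ultimately have "b t \<in> FIN" "Max (b t) \<le> Max t" unfolding FIN_def by auto
      then show "t \<in> FIN \<and> b t \<in> FIN \<and> b t \<noteq> t \<and> Max (b t) \<le> Max t" using t by blast
    qed
    have enc: "set_encode s \<noteq> set_encode t" if "s \<in> FIN" "t \<in> FIN" "s \<noteq> t" for s t
      using that set_encode_eq unfolding FIN_def by auto
    have contra: False if S: "most U (\<lambda>t. t \<in> S)" and c: "\<forall>t\<in>S. c (b t) \<noteq> c t" for S and c :: "nat set \<Rightarrow> bool"
    proof -
      define k where "k = most U c"
      have "most U (\<lambda>t. c t = k)" by (cases k) (simp_all add: k_def)
      then have "most U (\<lambda>t. t \<in> S \<and> c t = k \<and> \<not> most (G t) (prec t))" using S notprec by simp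
      then obtain X where X: "big X" "\<And>t. t \<in> block_span X \<Longrightarrow> t \<in> S \<and> c t = k \<and> \<not> most (G t) (prec t)"
        using ex_big by blast
      note bX = bigD(1)[OF X(1)]
      have "most U (\<lambda>t. most (G t) (\<lambda>s. s \<in> block_span X))"
        using bigD(2)[OF X(1)] by (subst (asm) lim[symmetric]) simp
      then obtain t where t: "most (G t) (\<lambda>s. s \<in> block_span X)" "t \<in> block_span X"
        by (rule most_span_obtain[OF _ X(1) finite.emptyI]) (rule that)
      have ft: "finite t" using span_FIN[OF bX t(2)] unfolding FIN_def by simp
      obtain s where s: "s \<in> block_span X" "s \<inter> down t = b t"
        using most_ex[of "G t" "\<lambda>s. s \<in> block_span X \<and> s \<inter> down t = b t"] t(1) b[OF ft] by auto
      have "b t \<in> block_span X"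
        using span0_initial(1)[OF bX, of s t] s t(2) span_subset_span0 bne[OF ft] X(2)[OF t(2)] span_iff[OF bX] by (metis subsetD)
      then show False using c X(2)[of "b t"] X(2)[OF t(2)] by blast
    qed
    let ?S = "\<lambda>t. t \<in> FIN \<and> b t \<in> FIN \<and> b t \<noteq> t"
    \<comment> \<open>The three ways of decreasing. In the last one the code grows, but among the finitely many sets with
      the same maximum.\<close>
    have "most U (\<lambda>t. ?S t \<and> Max (b t) < Max t \<or>
        ?S t \<and> Max (b t) = Max t \<and> set_encode (b t) < set_encode t \<or>
        ?S t \<and> Max (b t) = Max t \<and> set_encode t < set_encode (b t))"
      by (rule most_mono[OF S]) (use enc in \<open>meson le_neq_implies_less linorder_neqE_nat\<close>)
    then consider (1) "most U (\<lambda>t. t \<in> {t. ?S t \<and> Max (b t) < Max t})"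
      | (2) "most U (\<lambda>t. t \<in> {t. ?S t \<and> Max (b t) = Max t \<and> set_encode (b t) < set_encode t})"
      | (3) "most U (\<lambda>t. t \<in> {t. ?S t \<and> Max (b t) = Max t \<and> set_encode t < set_encode (b t)})"
      unfolding most_disj mem_Collect_eq by blast
    then show False
    proof cases
      case 1
      have "\<exists>c :: nat set \<Rightarrow> bool. \<forall>t\<in>{t. ?S t \<and> Max (b t) < Max t}. c (b t) \<noteq> c t"
        by (rule two_colouring[where f = b and m = Max]) simp
      then show False using contra[OF 1] by blast
    next
      case 2
      have "\<exists>c :: nat set \<Rightarrow> bool. \<forall>t\<in>{t. ?S t \<and> Max (b t) = Max t \<and> set_encode (b t) < set_encode t}. c (b t) \<noteq> c t"
        by (rule two_colouring[where f = b and m = set_encode]) simp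
      then show False using contra[OF 2] by blast
    next
      case 3
      have "\<exists>c :: nat set \<Rightarrow> bool. \<forall>t\<in>{t. ?S t \<and> Max (b t) = Max t \<and> set_encode t < set_encode (b t)}. c (b t) \<noteq> c t"
      proof (rule two_colouring[where f = b and m = "\<lambda>t. card {u \<in> Pow {..Max t}. set_encode t < set_encode u}"])
        fix t assume t: "t \<in> {t. ?S t \<and> Max (b t) = Max t \<and> set_encode t < set_encode (b t)}"
        show "card {u \<in> Pow {..Max (b t)}. set_encode (b t) < set_encode u} <
            card {u \<in> Pow {..Max t}. set_encode t < set_encode u}"
        proof (rule psubset_card_mono)
          have "b t \<in> Pow {..Max t}" using t unfolding FIN_def by (auto dest: Max_ge)
          then have "b t \<in> {u \<in> Pow {..Max t}. set_encode t < set_encode u}" using t by simp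
          moreover have "b t \<notin> {u \<in> Pow {..Max (b t)}. set_encode (b t) < set_encode u}" by simp
          ultimately show "{u \<in> Pow {..Max (b t)}. set_encode (b t) < set_encode u} \<subset>
            {u \<in> Pow {..Max t}. set_encode t < set_encode u}" using t by auto
        qed simp
      qed
      then show False using contra[OF 3] by blast
    qed
  qed
  have "most U (\<lambda>t. b t = t \<and> t \<in> FIN)" using main most_FIN by simp
  then show ?thesis
  proof (rule most_mono)
    fix t assume t: "b t = t \<and> t \<in> FIN"
    then show "most (G t) (\<lambda>s. s \<inter> down t = t)" using b[of t] unfolding FIN_def by auto
  qed
qed

text \<open>By \<open>converging_initial\<close>, also applied to \<open>t \<union> u\<close>, members of \<open>G t\<close> are proper continuations of \<open>t\<close>. If the
  remainders did not follow \<open>U\<close>, a diagonal span would avoid them.\<close>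

lemma converging_continuations:
  assumes lim: "lim U G = U" and ne: "most U (\<lambda>t. G t \<noteq> U)" and fixp: "most U (\<lambda>t. tail_lim G t = G t)"
  shows "most U (\<lambda>t. G t = push (\<lambda>u. t \<union> u) U)"
proof -
  have "most U (\<lambda>t. most (G t) (\<lambda>s. s \<inter> down t = t) \<and> tail_lim G t = G t)"
    using converging_initial[OF lim ne] fixp by simp
  then obtain X where X: "big X"
    "\<And>t. t \<in> block_span X \<Longrightarrow> most (G t) (\<lambda>s. s \<inter> down t = t) \<and> tail_lim G t = G t"
    using ex_big by blast
  note bX = bigD(1)[OF X(1)]
  have cont: "most (G t) (\<lambda>s. s \<inter> down t = t \<and> s \<noteq> t)" if t: "t \<in> block_span X" for t
  proof -
    have ft: "finite t" using span_FIN[OF bX t] unfolding FIN_def by simp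
    have "most U (\<lambda>u. most (G (t \<union> u)) (\<lambda>s. s \<inter> down t = t \<and> s \<noteq> t))"
    proof (rule most_mono[OF most_tail[OF X(1) ft]])
      fix u assume u: "u \<in> block_span X \<and> prec t u"
      then have tu: "t \<union> u \<in> block_span X" using span_Un[OF bX, of t u] t span_subset_span0 by blast
      have une: "u \<noteq> {}" using u span_iff[OF bX] by blast
      have dis: "u \<inter> down t = {}" using u unfolding prec_def down_def by fastforce
      have sub: "down t \<subseteq> down (t \<union> u)" unfolding down_def by blast
      show "most (G (t \<union> u)) (\<lambda>s. s \<inter> down t = t \<and> s \<noteq> t)"
      proof (rule most_mono)
        show "most (G (t \<union> u)) (\<lambda>s. s \<inter> down (t \<union> u) = t \<union> u)" using X(2)[OF tu] by blast
        fix s assume s: "s \<inter> down (t \<union> u) = t \<union> u"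
        have "s \<inter> down t = (t \<union> u) \<inter> down t" using s sub by blast
        also have "\<dots> = t" using dis subset_down[of t] by blast
        moreover have "s \<noteq> t" using s une dis subset_down by blast
        ultimately show "s \<inter> down t = t \<and> s \<noteq> t" by simp
      qed
    qed
    then have "most (tail_lim G t) (\<lambda>s. s \<inter> down t = t \<and> s \<noteq> t)" unfolding most_tail_lim .
    then show ?thesis using X(2)[OF t] by simp
  qed
  define G' where "G' t = push (\<lambda>s. s - t) (G t)" for t
  have G': "G t = push (\<lambda>u. t \<union> u) (G' t)" if "t \<in> block_span X" for t
  proof -
    have "push (\<lambda>s. t \<union> (s - t)) (G t) = push (\<lambda>s. s) (G t)"
    proof (rule push_cong, rule most_mono[OF cont[OF that]])
      fix s assume "s \<inter> down t = t \<and> s \<noteq> t"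
      then show "t \<union> (s - t) = s" by blast
    qed
    then show ?thesis unfolding G'_def push_push by simp
  qed
  have "most U (\<lambda>t. G' t = U)"
  proof (rule ccontr)
    assume "\<not> ?thesis"
    then have ne': "most U (\<lambda>t. G' t \<noteq> U)" by simp
    obtain C where "\<forall>t. U \<noteq> G' t \<longrightarrow> most U (C t) \<and> \<not> most (G' t) (C t)"
      using separate_family[of "\<lambda>_. U" G'] ..
    note C = this[rule_format]
    obtain X1 where X1: "big X1" "block_span X1 \<subseteq> block_span X" "\<And>s. s \<in> block_span X1 \<Longrightarrow> G' s \<noteq> U"
      using big_subset[OF X(1) ne'] by blast
    obtain Y where Y: "big Y" "block_span Y \<subseteq> block_span X1" "span0 Y \<subseteq> span0 X1"
      and diag_D: "diagonal (\<lambda>q r s. C r s) Y"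
      by (rule diagonalizeE[OF X1(1)]; rule that)
    note D = diagonalD[OF diag_D]
    note bY = bigD(1)[OF Y(1)]
    have "most U (\<lambda>t. most (G t) (\<lambda>s. s \<in> block_span Y))"
      using bigD(2)[OF Y(1)] by (subst (asm) lim[symmetric]) simp
    then obtain t where t: "most (G t) (\<lambda>s. s \<in> block_span Y)" "t \<in> block_span Y"
      by (rule most_span_obtain[OF _ Y(1) finite.emptyI]) (rule that)
    have Ct: "most U (C t)" "\<not> most (G' t) (C t)" using C[of t] X1(3) Y(2) t(2) by (metis subsetD)+
    have "most (G t) (\<lambda>s. s \<in> block_span Y \<and> s \<inter> down t = t \<and> s \<noteq> t)"
      using t(1) cont[of t] t(2) Y(2) X1(2) by (auto simp del: Int_iff)
    then have "most (G t) (\<lambda>s. C t (s - t))"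
    proof (rule most_mono)
      fix s assume s: "s \<in> block_span Y \<and> s \<inter> down t = t \<and> s \<noteq> t"
      have "s - down t = s - t" using s subset_down[of t] by blast
      then have "s - t \<in> span0 Y" "prec t (s - t)"
        using span0_initial(2,3)[OF bY, of s t] s t(2) span_subset_span0 by (metis subsetD)+
      moreover have "s - t \<noteq> {}" using s by blast
      ultimately show "C t (s - t)" using D[of t t "s - t"] t(2) span_subset_span0 span_iff[OF bY] Ct(1) by blast
    qed
    then have "most (G' t) (C t)" unfolding G'_def by simp
    then show False using Ct by simp
  qed
  then have "most U (\<lambda>t. G' t = U \<and> t \<in> block_span X)" using bigD(2)[OF X(1)] by simp
  then show ?thesis by (rule most_mono) (use G' in auto)
qed

text \<open>The images of \<open>P u\<close> under the other decoder \<open>g'\<close> converge to \<open>U\<close>, so by \<open>converging_initial\<close> they concentrate on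
  continuations of \<open>u\<close>; thus \<open>g v \<subseteq> g' v\<close> almost everywhere. By symmetry the decoders agree, and then a set
  separating \<open>P u\<close> from \<open>P' u\<close> for most \<open>u\<close> would separate the limit from itself.\<close>

lemma discrete_limit_unique:
  assumes g: "decodes g U P" and g': "decodes g' U P'" and eq: "lim U P = lim U P'"
  shows "most U (\<lambda>u. P u = P' u)"
proof -
  have half: "most (lim U P) (\<lambda>v. g v \<subseteq> g' v)"
    if g: "decodes g U P" and g': "decodes g' U P'" and eq: "lim U P = lim U P'"
    for g g' :: "'a \<Rightarrow> nat set" and P P'
  proof -
    have ne: "most U (\<lambda>u. P u \<noteq> lim U P')"
    proof (rule ccontr)
      assume "\<not> ?thesis"
      then have "most U (\<lambda>u. P u = lim U P \<and> most (P u) (\<lambda>v. g v = u))"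
        using g eq unfolding decodes_def by simp
      then obtain u where "P u = lim U P" "most (P u) (\<lambda>v. g v = u)" using most_ex by blast
      then have "most (push g (lim U P)) (\<lambda>x. x = u)" by simp
      then show False unfolding decodes_push_lim[OF g] using not_point by blast
    qed
    have "most U (\<lambda>u. push g' (P u) \<noteq> U)"
      using images_differ[of "\<lambda>s. s" g' P' P] g' eq ne by (simp add: records_def)
    moreover have "lim U (\<lambda>u. push g' (P u)) = U"
      using decodes_push_lim[OF g'] unfolding push_lim[symmetric] eq .
    ultimately have "most U (\<lambda>u. most (push g' (P u)) (\<lambda>s. s \<inter> down u = u))"
      by (intro converging_initial)
    then have "most U (\<lambda>u. most (P u) (\<lambda>v. g' v \<inter> down u = u) \<and> most (P u) (\<lambda>v. g v = u))"
      using g unfolding decodes_def by simp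
    then have "most U (\<lambda>u. most (P u) (\<lambda>v. g v \<subseteq> g' v))"
    proof (rule most_mono)
      fix u assume "most (P u) (\<lambda>v. g' v \<inter> down u = u) \<and> most (P u) (\<lambda>v. g v = u)"
      then have "most (P u) (\<lambda>v. g' v \<inter> down u = u \<and> g v = u)" by simp
      then show "most (P u) (\<lambda>v. g v \<subseteq> g' v)" by (rule most_mono) blast
    qed
    then show ?thesis by simp
  qed
  have "most (lim U P') (\<lambda>v. g v \<subseteq> g' v \<and> g' v \<subseteq> g v)"
    using half[OF g g' eq] half[OF g' g eq[symmetric]] eq by simp
  then have same: "most (lim U P') (\<lambda>v. g v = g' v)" by (rule most_mono) blast
  show ?thesis
  proof (rule ccontr)
    assume "\<not> ?thesis"
    then have ne: "most U (\<lambda>u. P u \<noteq> P' u)" by simp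
    obtain C where "\<forall>u. P u \<noteq> P' u \<longrightarrow> most (P u) (C u) \<and> \<not> most (P' u) (C u)"
      using separate_family[of P P'] ..
    note C = this[rule_format]
    have "most U (\<lambda>u. most (P u) (\<lambda>v. g v = u) \<and> P u \<noteq> P' u)" using g ne unfolding decodes_def by simp
    then have "most U (\<lambda>u. most (P u) (\<lambda>v. C (g v) v))"
    proof (rule most_mono)
      fix u assume u: "most (P u) (\<lambda>v. g v = u) \<and> P u \<noteq> P' u"
      then have "most (P u) (\<lambda>v. g v = u \<and> C u v)" using C by simp
      then show "most (P u) (\<lambda>v. C (g v) v)" by (rule most_mono) blast
    qed
    then have "most (lim U P') (\<lambda>v. C (g v) v)" unfolding eq[symmetric] by simp
    then have "most U (\<lambda>u. most (P' u) (\<lambda>v. C (g v) v) \<and> most (P' u) (\<lambda>v. g v = g' v) \<and>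
        most (P' u) (\<lambda>v. g' v = u) \<and> P u \<noteq> P' u)"
      using same g' ne unfolding decodes_def by simp
    then obtain u where u: "most (P' u) (\<lambda>v. C (g v) v)" "most (P' u) (\<lambda>v. g v = g' v)"
      "most (P' u) (\<lambda>v. g' v = u)" "P u \<noteq> P' u" using most_ex by blast
    then have "most (P' u) (\<lambda>v. C (g v) v \<and> g v = g' v \<and> g' v = u)" by simp
    then have "most (P' u) (C u)" by (rule most_mono) auto
    then show False using C u(4) by blast
  qed
qed

section \<open>The remaining cases\<close>

text \<open>Here \<open>F s\<close> differs not only from \<open>tail_lim F s\<close> but from \<open>tail_lim F r\<close> for all \<open>r\<close> with maximum at most
  \<open>Max s\<close>: compare \<open>s\<close> and \<open>r\<close> at the last block where they differ, and take limits over the common tail to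
  contradict injectivity. A set in \<open>F s\<close> outside all these finitely many tail limits is then outside
  \<open>F t\<close> for all \<open>t\<close> with larger maximum, after diagonalisation.\<close>

lemma splitting_case:
  assumes it: "\<And>s. iterate (F s)" and X0: "big X0"
    and inj: "\<And>a b. a \<in> span0 X0 \<Longrightarrow> b \<in> span0 X0 \<Longrightarrow> tail_lim F a = tail_lim F b \<Longrightarrow> a = b"
    and ne: "most U (\<lambda>s. F s \<noteq> tail_lim F s)"
  shows "iterate (lim U F)"
proof -
  obtain X1 where X1: "big X1" "block_span X1 \<subseteq> block_span X0" "\<And>s. s \<in> block_span X1 \<Longrightarrow> F s \<noteq> tail_lim F s"
    using big_subset[OF X0 ne] by blast
  note b1 = bigD(1)[OF X1(1)]
  have inj1: "a = b" if "a \<in> span0 X1" "b \<in> span0 X1" "tail_lim F a = tail_lim F b" for a b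
    using inj that span0_mono[OF X1(2)] by blast
  have new: "\<not> most U (\<lambda>t. F (q \<union> t) = tail_lim F r)" if q: "q \<in> span0 X1" and r: "r \<in> span0 X1" for q r
  proof
    assume m: "most U (\<lambda>t. F (q \<union> t) = tail_lim F r)"
    then have "tail_lim F q = tail_lim F r" unfolding tail_lim_def[of F q] using lim_cong[OF m] by simp
    then have qr: "q = r" using inj1 q r by blast
    have "most U (\<lambda>t. most U (\<lambda>u. F (r \<union> (t \<union> u)) = tail_lim F r))"
      using m most_idem[of "\<lambda>t. F (r \<union> t) = tail_lim F r"] unfolding qr by simp
    then obtain t where t: "most U (\<lambda>u. F (r \<union> (t \<union> u)) = tail_lim F r)" "t \<in> block_span X1" "prec r t"
      by (rule most_span_obtain[OF _ X1(1) span0_finite[OF b1 r]]) (rule that)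
    have "tail_lim F (r \<union> t) = tail_lim F r"
      unfolding tail_lim_def[of F "r \<union> t"] using lim_cong[OF t(1)] by (simp add: Un_assoc)
    then have "r \<union> t = r" using inj1[of "r \<union> t" r] span_Un[OF b1 r t(2)] span_subset_span0 r by blast
    then show False using prec_disjoint[OF t(3)] t(2) span_iff[OF b1] by blast
  qed
  have new2: "\<not> most U (\<lambda>c. F (b \<union> c) = tail_lim F (a \<union> c))" "\<not> most U (\<lambda>c. F (b \<union> c) = F (a \<union> c))"
    if ab: "a \<in> span0 X1" "b \<in> span0 X1" "a \<noteq> b" for a b
  proof -
    show "\<not> most U (\<lambda>c. F (b \<union> c) = tail_lim F (a \<union> c))"
    proof
      assume "most U (\<lambda>c. F (b \<union> c) = tail_lim F (a \<union> c))"
      then have "lim U (\<lambda>c. F (b \<union> c)) = lim U (\<lambda>c. tail_lim F (a \<union> c))" by (rule lim_cong)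
      then show False using inj1[OF ab(1,2)] ab(3) unfolding lim_tail_lim tail_lim_def[symmetric] by simp
    qed
    show "\<not> most U (\<lambda>c. F (b \<union> c) = F (a \<union> c))"
    proof
      assume "most U (\<lambda>c. F (b \<union> c) = F (a \<union> c))"
      then have "tail_lim F b = tail_lim F a" unfolding tail_lim_def by (rule lim_cong)
      then show False using inj1[OF ab(1,2)] ab(3) by simp
    qed
  qed
  obtain X2 where X2: "big X2" "block_span X2 \<subseteq> block_span X1" "span0 X2 \<subseteq> span0 X1"
    and diag_D2: "diagonal (\<lambda>q r t. F (q \<union> t) \<noteq> tail_lim F r) X2"
    by (rule diagonalizeE[OF X1(1)]; rule that)
  note D2 = diagonalD[OF diag_D2]
  obtain X3 where X3: "big X3" "block_span X3 \<subseteq> block_span X2" "span0 X3 \<subseteq> span0 X2"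
    and diag_D3: "diagonal (\<lambda>q r c. F (q \<union> c) \<noteq> tail_lim F (r \<union> c) \<and> F (q \<union> c) \<noteq> F (r \<union> c)) X3"
    by (rule diagonalizeE[OF X2(1)]; rule that)
  note D3 = diagonalD[OF diag_D3]
  note b3 = bigD(1)[OF X3(1)]
  have e2: "F (q \<union> s) \<noteq> tail_lim F r"
    if "q \<in> span0 X3" "r \<in> span0 X3" "s \<in> block_span X3" "prec q s" "prec r s" for q r s
    using D2[of q r s] new[of q r] that X2 X3 by auto
  have e3: "F (q \<union> s) \<noteq> tail_lim F (r \<union> s)" "F (q \<union> s) \<noteq> F (r \<union> s)"
    if "q \<in> span0 X3" "r \<in> span0 X3" "s \<in> block_span X3" "prec q s" "prec r s" "q \<noteq> r" for q r s
    using D3[of q r s] new2[of r q] that X2 X3 by auto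
  have e23: "(c = {} \<longrightarrow> F (q \<union> X3 i \<union> c) \<noteq> tail_lim F (b \<union> c)) \<and>
      (c \<noteq> {} \<longrightarrow> F (q \<union> X3 i \<union> c) \<noteq> tail_lim F (b \<union> c) \<and> F (b \<union> c) \<noteq> tail_lim F (q \<union> X3 i \<union> c) \<and>
        F (q \<union> X3 i \<union> c) \<noteq> F (b \<union> c))"
    if "q \<in> span0 X3" "b \<in> span0 X3" "c \<in> span0 X3" "prec q (X3 i)" "prec b (X3 i)" "prec (X3 i) c" for q b c i
  proof -
    have i: "X3 i \<in> block_span X3" using block_in_span[OF b3] .
    have n1: "c = {} \<Longrightarrow> F (q \<union> X3 i \<union> c) \<noteq> tail_lim F (b \<union> c)" using e2[of q b "X3 i"] that i by simp
    have qi: "q \<union> X3 i \<in> span0 X3" using span_Un[OF b3 that(1) i] span_subset_span0 by blast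
    have "q \<union> X3 i \<noteq> b"
    proof
      assume "q \<union> X3 i = b"
      then have "X3 i \<inter> b \<noteq> {}" using block_nonempty[OF b3] by blast
      then show False using prec_disjoint[OF that(5)] by blast
    qed
    moreover have "prec q c" "prec b c"
      using prec_trans that block_nonempty[OF b3] by blast+
    moreover have "c \<noteq> {} \<Longrightarrow> c \<in> block_span X3" using that span_iff[OF b3] by blast
    ultimately show ?thesis
      using n1 e3[of "q \<union> X3 i" b c] e3[of b "q \<union> X3 i" c] qi that by auto
  qed
  \<comment> \<open>The common tail \<open>c\<close> may be empty only if \<open>s\<close> has the larger maximum.\<close>
  have gam: "F s \<noteq> tail_lim F r" if s: "s \<in> block_span X3" and r: "r \<in> span0 X3" and sub: "r \<subseteq> down s" for s r
  proof (cases "r = s")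
    case True
    then show ?thesis using X1(3) s X2(2) X3(2) by blast
  next
    case False
    have sb: "s \<in> span0 X3" using s span_subset_span0 by blast
    obtain i q b c where d: "q \<in> span0 X3" "b \<in> span0 X3" "c \<in> span0 X3" "prec q (X3 i)" "prec b (X3 i)" "prec (X3 i) c"
      "(s = q \<union> X3 i \<union> c \<and> r = b \<union> c) \<or> (r = q \<union> X3 i \<union> c \<and> s = b \<union> c)"
      using span0_differ[OF b3 sb r not_sym[OF False]] by (elim exE bexE conjE) (rule that)
    have "c \<noteq> {}" if rs: "r = q \<union> X3 i \<union> c" "s = b \<union> c"
    proof
      assume "c = {}"
      then have "r = q \<union> X3 i" "s = b" using rs by simp_all
      then have "X3 i \<subseteq> down b" using sub by simp
      moreover obtain x where x: "x \<in> X3 i" using block_nonempty[OF b3] by blast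
      ultimately have "x \<in> down b" by (rule subsetD)
      then obtain y where "y \<in> b" "x \<le> y" unfolding down_def by blast
      then show False using d(5) x unfolding prec_def by (meson leD)
    qed
    then show ?thesis using e23[OF d(1-6)] d(7) by (elim disjE conjE; cases "c = {}"; simp)
  qed
  have "\<exists>A. \<forall>s\<in>block_span X3. most (F s) (A s) \<and> (\<forall>r\<in>span0 X3. r \<subseteq> down s \<longrightarrow> \<not> most (tail_lim F r) (A s))"
  proof (rule bchoice, intro ballI)
    fix s assume s: "s \<in> block_span X3"
    obtain B where "\<forall>r. F s \<noteq> tail_lim F r \<longrightarrow> most (F s) (B r) \<and> \<not> most (tail_lim F r) (B r)"
      using separate_family[of "\<lambda>_. F s" "tail_lim F"] ..
    note B = this[rule_format]
    let ?R = "{r \<in> span0 X3. r \<subseteq> down s}"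
    have fin: "finite ?R"
      using finite_down[of s] span_FIN[OF b3 s] unfolding FIN_def
      by (intro finite_subset[of ?R "Pow (down s)"]) auto
    have "most (F s) (\<lambda>v. \<forall>r\<in>?R. B r v)"
      unfolding most_ball_finite[OF fin] using B gam[OF s] by blast
    moreover have "\<not> most (tail_lim F r) (\<lambda>v. \<forall>r\<in>?R. B r v)" if "r \<in> ?R" for r
    proof
      assume "most (tail_lim F r) (\<lambda>v. \<forall>r\<in>?R. B r v)"
      then have "most (tail_lim F r) (B r)" by (rule most_mono) (use that in blast)
      then show False using B gam[OF s] that by blast
    qed
    ultimately show "\<exists>A. most (F s) A \<and> (\<forall>r\<in>span0 X3. r \<subseteq> down s \<longrightarrow> \<not> most (tail_lim F r) A)" by blast
  qed
  then obtain A where A: "\<And>s. s \<in> block_span X3 \<Longrightarrow> most (F s) (A s)"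
    "\<And>s r. s \<in> block_span X3 \<Longrightarrow> r \<in> span0 X3 \<Longrightarrow> r \<subseteq> down s \<Longrightarrow> \<not> most (tail_lim F r) (A s)" by blast
  obtain X where X: "big X" "block_span X \<subseteq> block_span X3" "span0 X \<subseteq> span0 X3"
    and diag_D: "diagonal (\<lambda>q r t. \<not> most (F (q \<union> t)) (A r)) X"
    by (rule diagonalizeE[OF X3(1)]; rule that)
  note D = diagonalD[OF diag_D]
  note b = bigD(1)[OF X(1)]
  have up: "\<not> most (F t) (A s)" if s: "s \<in> block_span X" and t: "t \<in> block_span X" and lt: "Max s < Max t" for s t
  proof -
    have tb: "t \<in> span0 X" "s \<in> span0 X" using s t span_subset_span0 by blast+
    note cut = span0_initial[OF b tb]
    have "Max t \<in> t" using span_FIN[OF b t] unfolding FIN_def by simp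
    then have "Max t \<in> t - down s" using down_FIN[OF span_FIN[OF b s]] lt by simp
    then have c: "t - down s \<in> block_span X" using cut span_iff[OF b] by blast
    have "\<not> most (tail_lim F (t \<inter> down s)) (A s)" using A(2)[of s "t \<inter> down s"] cut(1) s X by blast
    then have "most U (\<lambda>u. \<not> most (F ((t \<inter> down s) \<union> u)) (A s))" by (simp add: most_tail_lim)
    then have "\<not> most (F ((t \<inter> down s) \<union> (t - down s))) (A s)"
      using D[of "t \<inter> down s" s "t - down s"] cut c tb prec_subset[OF cut(3)] by blast
    moreover have "(t \<inter> down s) \<union> (t - down s) = t" by blast
    ultimately show ?thesis by simp
  qed
  have lev: "F s \<noteq> F t" if s: "s \<in> block_span X" and t: "t \<in> block_span X" and eq: "Max s = Max t" and ne: "s \<noteq> t" for s t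
  proof -
    have st: "s \<in> span0 X3" "t \<in> span0 X3" using s t X(3) span_subset_span0 by blast+
    obtain i q b' c where d: "q \<in> span0 X3" "b' \<in> span0 X3" "c \<in> span0 X3" "prec q (X3 i)" "prec b' (X3 i)" "prec (X3 i) c"
      "(s = q \<union> X3 i \<union> c \<and> t = b' \<union> c) \<or> (t = q \<union> X3 i \<union> c \<and> s = b' \<union> c)"
      using span0_differ[OF b3 st ne] by (elim exE bexE conjE) (rule that)
    have "c \<noteq> {}"
    proof
      assume "c = {}"
      then have disj: "(s = q \<union> X3 i \<and> t = b') \<or> (t = q \<union> X3 i \<and> s = b')" using d(7) by simp
      have "Max b' < Max (q \<union> X3 i)" if "b' \<in> FIN"
      proof -
        have "Max b' < Min (X3 i)" using d(5) that block_FIN[OF b3, of i] by (simp add: prec_iff_Max_less_Min)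
        also have "Min (X3 i) \<le> Max (X3 i)" by (rule Min_le_Max_FIN[OF block_FIN[OF b3]])
        also have "\<dots> \<le> Max (q \<union> X3 i)"
          using span0_finite[OF b3 d(1)] block_finite[OF b3] block_nonempty[OF b3] by (intro Max_mono) auto
        finally show ?thesis .
      qed
      then show False using disj eq span_FIN[OF b s] span_FIN[OF b t] by auto
    qed
    then have "F (q \<union> X3 i \<union> c) \<noteq> F (b' \<union> c)" using e23[OF d(1-6)] by simp
    then show ?thesis using d(7) by (elim disjE conjE) simp_all
  qed
  have "\<exists>B. (\<forall>x\<in>block_span X. most (F x) (B x)) \<and>
      (\<forall>x\<in>block_span X. \<forall>y\<in>block_span X. \<forall>v. B x v \<longrightarrow> B y v \<longrightarrow> x = y)"
    by (rule disjointify[where r = Max and A = A])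
       (use finite_span_Max[OF b] A(1) X(2) up lev in blast)+
  then obtain B where "\<And>x. x \<in> block_span X \<Longrightarrow> most (F x) (B x)"
    "\<And>x y v. x \<in> block_span X \<Longrightarrow> y \<in> block_span X \<Longrightarrow> B x v \<Longrightarrow> B y v \<Longrightarrow> x = y" by blast
  then obtain g where "decodes g U F"
    using decoder_of_disjoint[OF bigD(2)[OF X(1)], of F B] by blast
  then have "iterate (lim (push (\<lambda>s. s) U) F)"
    using it by (intro dlim) (auto simp: records_def)
  then show ?thesis by simp
qed

lemma tail_lim_push: "tail_lim (\<lambda>t. push g (Q t)) t = push g (tail_lim Q t)"
  unfolding tail_lim_def push_lim ..

text \<open>The images \<open>G t\<close> of \<open>Q t\<close> under the decoder converge to \<open>U_min\<close> or \<open>U_max\<close> without being equal to it. A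
  diagonal span shows that they are principal, say at \<open>h t\<close>, and \<open>h (t \<union> u) = h t\<close>. So a whole cone of
  ultrafilters \<open>Q (t \<union> u)\<close>, mostly different from \<open>Q t\<close>, lives on one fibre of the decoder. Choose on this fibre a set that
  separates its component \<open>P (h t)\<close> from the \<open>Q\<close> at the first block; since \<open>Q t\<close> is the limit of
  \<open>Q (t \<union> u)\<close>, it also separates from most \<open>Q\<close> in the cone. Over all fibres this gives a set in
  the limit that lies in no \<open>Q t\<close>.\<close>

lemma no_min_or_max_limit:
  assumes phi: "\<phi> \<in> {\<lambda>s. {Min s}, \<lambda>s. {Max s}}" and dec: "decodes g (push \<phi> U) P"
    and lim: "lim U Q = lim (push \<phi> U) P"
    and fixq: "most U (\<lambda>t. tail_lim Q t = Q t)" and ne: "most U (\<lambda>t. Q t \<noteq> lim U Q)"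
    and inj: "most U (\<lambda>t. most U (\<lambda>u. Q (t \<union> u) \<noteq> Q t))"
  shows False
proof -
  have rec: "\<phi> \<in> records" using phi unfolding records_def by auto
  define G where "G t = push g (Q t)" for t
  have limG: "lim U G = push \<phi> U"
    unfolding G_def push_lim[symmetric] lim by (rule decodes_push_lim[OF dec])
  have neG: "most U (\<lambda>t. push \<phi> U \<noteq> G t)"
    using images_differ[OF rec dec lim ne[unfolded lim]] unfolding G_def by (simp add: eq_commute)
  have fixG: "most U (\<lambda>t. tail_lim G t = G t)"
    by (rule most_mono[OF fixq]) (simp add: G_def[abs_def] tail_lim_push)
  \<comment> \<open>On the span \<open>Y\<close>, values of \<open>\<phi>\<close> beyond \<open>t\<close> are excluded by the separating set \<open>C t\<close>, so that only the
    finitely many values below \<open>Max t\<close> remain.\<close>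
  have pts: "most U (\<lambda>t. \<exists>y. G t = point y)"
  proof -
    obtain C where "\<forall>t. push \<phi> U \<noteq> G t \<longrightarrow> most (push \<phi> U) (C t) \<and> \<not> most (G t) (C t)"
      using separate_family[of "\<lambda>_. push \<phi> U" G] ..
    note C = this[rule_format]
    obtain X where X: "big X" "\<And>t. t \<in> block_span X \<Longrightarrow> push \<phi> U \<noteq> G t" using ex_big[OF neG] by blast
    obtain Y where Y: "big Y" "block_span Y \<subseteq> block_span X" "span0 Y \<subseteq> span0 X"
      and diag_D: "diagonal (\<lambda>q r s. C r (\<phi> s)) Y"
      by (rule diagonalizeE[OF X(1)]; rule that)
    note D = diagonalD[OF diag_D]
    note b = bigD(1)[OF Y(1)]
    have sep: "\<phi> s \<subseteq> down t \<or> C t (\<phi> s)" if s: "s \<in> block_span Y" and t: "t \<in> block_span Y" for s t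
    proof -
      have sb: "s \<in> span0 Y" "t \<in> span0 Y" using s t span_subset_span0 by blast+
      note cut = span0_initial[OF b sb]
      have sF: "finite s" "s \<noteq> {}" using span_FIN[OF b s] unfolding FIN_def by auto
      have Ct: "most U (\<lambda>s. C t (\<phi> s))" using C[of t] X(2)[of t] t Y(2) by auto
      have Dt: "C t (\<phi> c)" if "c \<in> block_span Y" "prec t c" for c
        using D[of t t c] Ct that sb(2) by blast
      have parts: "s = (s \<inter> down t) \<union> (s - down t)" by blast
      show ?thesis
      proof (cases "\<phi> = (\<lambda>s. {Min s})")
        case True
        show ?thesis
        proof (cases "s \<inter> down t = {}")
          case False
          then obtain x where x: "x \<in> s" "x \<in> down t" by blast
          then have "Min s \<le> x" using sF by simp
          then have "Min s \<in> down t" using x(2) unfolding down_def by (auto intro: order_trans)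
          then show ?thesis using True by simp
        next
          case empty: True
          then have "prec t s" using cut(3) parts by (metis Un_empty_left)
          then show ?thesis using Dt s by blast
        qed
      next
        case False
        then have phi: "\<phi> = (\<lambda>s. {Max s})" using phi by blast
        show ?thesis
        proof (cases "s - down t = {}")
          case True
          then have "Max s \<in> down t" using Max_in[OF sF] by blast
          then show ?thesis using phi by simp
        next
          case False
          then have c: "s - down t \<in> block_span Y" using cut(2) span_iff[OF b] by blast
          have "Max s = Max (s - down t)"
          proof (rule antisym)
            show "Max (s - down t) \<le> Max s" by (rule Max_mono) (use False sF in auto)
            have "Max s \<notin> down t"
            proof
              assume "Max s \<in> down t"
              then obtain y where y: "y \<in> t" "Max s \<le> y" unfolding down_def by blast
              obtain x where x: "x \<in> s - down t" using False by blast
              then have "y < x" using cut(3) y(1) unfolding prec_def by blast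
              then show False using Max_ge[OF sF(1), of x] x y by simp
            qed
            then show "Max s \<le> Max (s - down t)" using Max_in[OF sF] sF by simp
          qed
          then show ?thesis using Dt[OF c cut(3)] phi by simp
        qed
      qed
    qed
    have "most U (\<lambda>t. \<exists>s\<in>block_span Y. \<phi> t = \<phi> s)"
      by (rule most_mono[OF bigD(2)[OF Y(1)]]) blast
    then have "most (push \<phi> U) (\<lambda>x. \<exists>s\<in>block_span Y. x = \<phi> s)" by simp
    then have "most (lim U G) (\<lambda>x. \<exists>s\<in>block_span Y. x = \<phi> s)" unfolding limG .
    then have "most U (\<lambda>t. most (G t) (\<lambda>x. \<exists>s\<in>block_span Y. x = \<phi> s) \<and> t \<in> block_span Y)"
      using bigD(2)[OF Y(1)] by simp
    then show ?thesis
    proof (rule most_mono)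
      fix t assume t: "most (G t) (\<lambda>x. \<exists>s\<in>block_span Y. x = \<phi> s) \<and> t \<in> block_span Y"
      have "most (G t) (\<lambda>x. \<not> C t x)" using C[of t] X(2)[of t] t Y(2) by auto
      then have "most (G t) (\<lambda>x. (\<exists>s\<in>block_span Y. x = \<phi> s) \<and> \<not> C t x)" using t by simp
      then have "most (G t) (\<lambda>x. x \<in> Pow (down t))"
        by (rule most_mono) (use sep t in blast)
      moreover have "finite (Pow (down t))"
        using finite_down[of t] span_FIN[OF b, of t] t unfolding FIN_def by simp
      ultimately show "\<exists>y. G t = point y" using most_finite_point by blast
    qed
  qed
  define h where "h t = (SOME y. G t = point y)" for t
  have Gh: "most U (\<lambda>t. G t = point (h t))"
  proof (rule most_mono[OF pts])
    fix t assume "\<exists>y. G t = point y"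
    then show "G t = point (h t)" unfolding h_def by (rule someI_ex)
  qed
  have pushh: "push h U = push \<phi> U"
    using lim_cong[OF Gh] limG unfolding lim_point by simp
  have hnew: "most U (\<lambda>u. h u \<noteq> y)" for y
  proof -
    have "\<not> most (push h U) (\<lambda>x. x = y)" unfolding pushh using records_nonprincipal[OF rec] by simp
    then show ?thesis by simp
  qed
  have hconst: "most U (\<lambda>t. most U (\<lambda>u. h (t \<union> u) = h t))"
  proof -
    have "most U (\<lambda>t. G t = point (h t) \<and> tail_lim G t = G t \<and> most U (\<lambda>u. G (t \<union> u) = point (h (t \<union> u))))"
      using Gh fixG most_idem[of "\<lambda>t. G t = point (h t)"] by simp
    then show ?thesis
    proof (rule most_mono)
      fix t assume t: "G t = point (h t) \<and> tail_lim G t = G t \<and> most U (\<lambda>u. G (t \<union> u) = point (h (t \<union> u)))"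
      then have "most (tail_lim G t) (\<lambda>x. x = h t)" by simp
      then have "most U (\<lambda>u. most (G (t \<union> u)) (\<lambda>x. x = h t) \<and> G (t \<union> u) = point (h (t \<union> u)))"
        using t unfolding most_tail_lim by simp
      then show "most U (\<lambda>u. h (t \<union> u) = h t)" by (rule most_mono) (elim conjE, simp)
    qed
  qed
  have QP: "most U (\<lambda>t. Q t \<noteq> P (h t))"
  proof (rule ccontr)
    assume "\<not> ?thesis"
    then have eq: "most U (\<lambda>t. Q t = P (h t))" by simp
    then have "most U (\<lambda>t. Q t = P (h t) \<and> most U (\<lambda>u. Q (t \<union> u) = P (h (t \<union> u))) \<and>
        most U (\<lambda>u. h (t \<union> u) = h t) \<and> most U (\<lambda>u. Q (t \<union> u) \<noteq> Q t))"
      using hconst inj most_idem[of "\<lambda>t. Q t = P (h t)"] by simp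
    then obtain t where t: "Q t = P (h t)" "most U (\<lambda>u. Q (t \<union> u) = P (h (t \<union> u)))"
        "most U (\<lambda>u. h (t \<union> u) = h t)" "most U (\<lambda>u. Q (t \<union> u) \<noteq> Q t)" using most_ex by blast
    then have "most U (\<lambda>u. Q (t \<union> u) = P (h (t \<union> u)) \<and> h (t \<union> u) = h t \<and> Q (t \<union> u) \<noteq> Q t)" by simp
    then obtain u where "Q (t \<union> u) = P (h (t \<union> u))" "h (t \<union> u) = h t" "Q (t \<union> u) \<noteq> Q t"
      using most_ex by blast
    then show False using t(1) by simp
  qed
  obtain C where "\<forall>t. P (h t) \<noteq> Q t \<longrightarrow> most (P (h t)) (C t) \<and> \<not> most (Q t) (C t)"
    using separate_family[of "\<lambda>t. P (h t)" Q] ..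
  note C = this[rule_format]
  have "most U (\<lambda>t. P (h t) \<noteq> Q t)" by (rule most_mono[OF QP]) (rule not_sym)
  then have "most U (\<lambda>t. P (h t) \<noteq> Q t \<and> tail_lim Q t = Q t \<and> G t = point (h t) \<and> most U (\<lambda>u. h (t \<union> u) = h t))"
    using fixq Gh hconst by simp
  then obtain X where X: "big X" "\<And>t. t \<in> block_span X \<Longrightarrow>
      P (h t) \<noteq> Q t \<and> tail_lim Q t = Q t \<and> G t = point (h t) \<and> most U (\<lambda>u. h (t \<union> u) = h t)"
    using ex_big by blast
  obtain Y where Y: "big Y" "block_span Y \<subseteq> block_span X" "span0 Y \<subseteq> span0 X"
    and diag_D: "diagonal (\<lambda>q r u. \<not> most (Q (r \<union> u)) (C r) \<and> h (r \<union> u) = h r \<and> h u \<noteq> h r) Y"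
    by (rule diagonalizeE[OF X(1)]; rule that)
  note D = diagonalD[OF diag_D]
  note b = bigD(1)[OF Y(1)]
  have D': "\<not> most (Q (r \<union> s)) (C r) \<and> h (r \<union> s) = h r \<and> h s \<noteq> h r"
    if r: "r \<in> block_span Y" and s: "s \<in> block_span Y" and rs: "prec r s" for r s
  proof -
    have rX: "r \<in> block_span X" using r Y(2) by blast
    have "\<not> most (tail_lim Q r) (C r)" using X(2)[OF rX] C[of r] by simp
    then have "most U (\<lambda>u. \<not> most (Q (r \<union> u)) (C r) \<and> h (r \<union> u) = h r \<and> h u \<noteq> h r)"
      using X(2)[OF rX] hnew unfolding most_tail_lim by simp
    moreover have "r \<in> span0 Y" using r span_subset_span0 by blast
    ultimately show ?thesis using D[of r r s] s rs by blast
  qed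
  have hinj: "i = j" if "h (Y i) = h (Y j)" for i j
    using that D'[OF block_in_span[OF b] block_in_span[OF b] block_prec[OF b], of i j]
      D'[OF block_in_span[OF b] block_in_span[OF b] block_prec[OF b], of j i]
    by (metis linorder_neqE_nat)
  \<comment> \<open>By \<open>hinj\<close> at most one condition is imposed on each fibre.\<close>
  define K where "K v \<longleftrightarrow> (\<forall>i. h (Y i) = g v \<longrightarrow> C (Y i) v)" for v
  have KP: "most (P x) K" if x: "most (P x) (\<lambda>v. g v = x)" for x
  proof (cases "\<exists>i. h (Y i) = x")
    case True
    then obtain i where i: "h (Y i) = x" by blast
    have "Y i \<in> block_span X" using block_in_span[OF b] Y(2) by blast
    then have "most (P x) (C (Y i))" using C[of "Y i"] X(2) i by auto
    then have "most (P x) (\<lambda>v. C (Y i) v \<and> g v = x)" using x by simp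
    then show ?thesis
    proof (rule most_mono)
      fix v assume v: "C (Y i) v \<and> g v = x"
      show "K v" unfolding K_def
      proof (intro allI impI)
        fix j assume "h (Y j) = g v"
        then have "j = i" using v i by (intro hinj) simp
        then show "C (Y j) v" using v by simp
      qed
    qed
  next
    case False
    show ?thesis by (rule most_mono[OF x]) (use False in \<open>auto simp: K_def\<close>)
  qed
  have "most (push \<phi> U) (\<lambda>x. most (P x) K)"
    by (rule most_mono[OF dec[unfolded decodes_def]]) (rule KP)
  then have "most (lim U Q) K" unfolding lim most_lim .
  then have "most U (\<lambda>t. most (Q t) K)" by simp
  then obtain t where t: "most (Q t) K" "t \<in> block_span Y"
    by (rule most_span_obtain[OF _ Y(1) finite.emptyI]) (rule that)
  obtain i a where i: "a \<in> span0 Y" "t = Y i \<union> a" "prec (Y i) a" using span_first[OF b t(2)] by blast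
  have Yi: "Y i \<in> block_span X" using block_in_span[OF b] Y(2) by blast
  have ht: "\<not> most (Q t) (C (Y i)) \<and> h t = h (Y i)"
  proof (cases "a = {}")
    case True
    then show ?thesis using i(2) C[of "Y i"] X(2)[OF Yi] by auto
  next
    case False
    then have "a \<in> block_span Y" using i(1) span_iff[OF b] by blast
    then show ?thesis using D'[OF block_in_span[OF b], of a i] i by simp
  qed
  have "push g (Q t) = point (h t)" using X(2)[of t] t(2) Y(2) unfolding G_def by blast
  then have "most (push g (Q t)) (\<lambda>x. x = h t)" by simp
  then have "most (Q t) (\<lambda>v. g v = h t \<and> K v)" using t(1) by simp
  then have "most (Q t) (C (Y i))"
    by (rule most_mono) (use ht in \<open>auto simp: K_def\<close>)
  then show False using ht by blast
qed

text \<open>The decoder sees \<open>Q t\<close> as the continuations of \<open>t\<close>, by \<open>converging_continuations\<close>, and it sees \<open>tail_lim P t\<close>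
  the same way. So \<open>separate_limit\<close> excludes that they differ.\<close>

lemma continuations_of_limit:
  assumes dec: "decodes g U P" and lim: "lim U Q = lim U P"
    and fixq: "most U (\<lambda>t. tail_lim Q t = Q t)" and ne: "most U (\<lambda>t. Q t \<noteq> lim U Q)"
  shows "most U (\<lambda>t. Q t = tail_lim P t)"
proof (rule ccontr)
  assume "\<not> ?thesis"
  then have neq: "most U (\<lambda>t. Q t \<noteq> tail_lim P t)" by simp
  have "most U (\<lambda>t. push g (Q t) \<noteq> U)"
    using images_differ[of "\<lambda>s. s" g P Q] dec lim ne by (simp add: records_def)
  moreover have "lim U (\<lambda>t. push g (Q t)) = U"
    unfolding push_lim[symmetric] lim by (rule decodes_push_lim[OF dec])
  moreover have "most U (\<lambda>t. tail_lim (\<lambda>t. push g (Q t)) t = push g (Q t))"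
    by (rule most_mono[OF fixq]) (simp add: tail_lim_push)
  ultimately have G: "most U (\<lambda>t. push g (Q t) = push (\<lambda>u. t \<union> u) U)"
    by (intro converging_continuations)
  define D where "D t = push (\<lambda>u. t \<union> u) U" for t
  obtain C where C: "\<And>x. most (P x) (\<lambda>v. g v = x) \<Longrightarrow> most (P x) C"
    "\<And>t. most (D t) (\<lambda>x. finite x \<and> t \<subseteq> down x) \<Longrightarrow> push g (Q t) = D t \<Longrightarrow>
      Q t \<noteq> lim (D t) P \<Longrightarrow> \<not> most (Q t) C"
    using separate_limit[of P g D Q] by blast
  have "most U (\<lambda>x. most (P x) C)"
    by (rule most_mono[OF dec[unfolded decodes_def]]) (rule C(1))
  then have "most (lim U Q) C" unfolding lim by simp
  then have "most U (\<lambda>t. most (Q t) C \<and> push g (Q t) = D t \<and> Q t \<noteq> tail_lim P t \<and> t \<in> FIN)"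
    using G neq most_FIN unfolding D_def by simp
  then obtain t where t: "most (Q t) C" "push g (Q t) = D t" "Q t \<noteq> tail_lim P t" "t \<in> FIN"
    using most_ex by blast
  have ft: "finite t" using t(4) unfolding FIN_def by simp
  have "most U (\<lambda>u. finite (t \<union> u) \<and> t \<subseteq> down (t \<union> u))"
  proof (rule most_mono[OF most_FIN])
    fix u assume "u \<in> FIN"
    then show "finite (t \<union> u) \<and> t \<subseteq> down (t \<union> u)"
      using ft subset_down[of "t \<union> u"] unfolding FIN_def by auto
  qed
  then have "most (D t) (\<lambda>x. finite x \<and> t \<subseteq> down x)" unfolding D_def by simp
  moreover have "lim (D t) P = tail_lim P t" unfolding D_def lim_push tail_lim_def ..
  ultimately show False using C(2)[of t] t(1-3) by simp
qed

text \<open>Completing a block carries no information here, so each \<open>F s\<close> has to be opened once more. The two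
  discrete representations of \<open>F (s \<union> t)\<close>, as \<open>lim U (Pf (s \<union> t))\<close> and as the limit of \<open>Pf s (t \<union> u)\<close> over \<open>u\<close>,
  coincide. Hence \<open>Z x\<close>, defined by splitting \<open>x\<close> after its first block, is the value of \<open>Pf\<close> for every other way of
  splitting \<open>x\<close>, and \<open>Z\<close> has the same tail limits as \<open>F\<close>. It is not equal to them, because \<open>Pf s\<close> is discrete.\<close>

lemma continuing_case:
  assumes it: "\<And>s. iterate (F s)" and X0: "big X0"
    and inj: "\<And>a b. a \<in> span0 X0 \<Longrightarrow> b \<in> span0 X0 \<Longrightarrow> tail_lim F a = tail_lim F b \<Longrightarrow> a = b"
    and eq: "most U (\<lambda>s. F s = tail_lim F s)"
  shows "iterate (lim U F)"
proof -
  obtain X1 where X1: "big X1" "block_span X1 \<subseteq> block_span X0" "\<And>s. s \<in> block_span X1 \<Longrightarrow> F s = tail_lim F s"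
    using big_subset[OF X0 eq] by blast
  note b1 = bigD(1)[OF X1(1)]
  have sub0: "span0 X1 \<subseteq> span0 X0" by (rule span0_mono[OF X1(2)])
  have un1: "s \<union> t \<in> block_span X1" if "s \<in> block_span X1" "t \<in> block_span X1" for s t
    using span_Un[OF b1, of s t] that span_subset_span0 by blast
  have fin1: "finite s" if "s \<in> block_span X1" for s using span_FIN[OF b1 that] unfolding FIN_def by simp
  have Fne: "F (s \<union> t) \<noteq> F s" if s: "s \<in> block_span X1" and t: "t \<in> block_span X1" and st: "prec s t" for s t
  proof
    assume "F (s \<union> t) = F s"
    then have "tail_lim F (s \<union> t) = tail_lim F s" using X1(3)[OF un1[OF s t]] X1(3)[OF s] by simp
    then have "s \<union> t = s" using inj[of "s \<union> t" s] un1[OF s t] s sub0 span_subset_span0 by blast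
    then show False using prec_disjoint[OF st] t span_iff[OF b1] by blast
  qed
  have ex: "\<exists>P g. (\<forall>x. iterate (P x)) \<and> decodes g U P \<and> F s = lim U P \<and>
      most U (\<lambda>t. F (s \<union> t) = tail_lim P t)" if s: "s \<in> block_span X1" for s
  proof -
    define Q where "Q t = F (s \<union> t)" for t
    note tl = most_tail[OF X1(1) fin1[OF s]]
    have tlQ: "tail_lim Q t = tail_lim F (s \<union> t)" for t
      unfolding Q_def[abs_def] by (rule tail_lim_shift)
    have limQ: "lim U Q = F s" unfolding Q_def[abs_def] tail_lim_def[symmetric] using X1(3)[OF s] by simp
    have fixq: "most U (\<lambda>t. tail_lim Q t = Q t)"
      by (rule most_mono[OF tl]) (use X1(3) un1 s in \<open>simp add: tlQ Q_def\<close>)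
    have ne: "most U (\<lambda>t. Q t \<noteq> F s)"
      by (rule most_mono[OF tl]) (use Fne s in \<open>simp add: Q_def\<close>)
    have injq: "most U (\<lambda>t. most U (\<lambda>u. Q (t \<union> u) \<noteq> Q t))"
    proof (rule most_mono[OF tl])
      fix t assume t: "t \<in> block_span X1 \<and> prec s t"
      then have st: "s \<union> t \<in> block_span X1" using un1 s by blast
      show "most U (\<lambda>u. Q (t \<union> u) \<noteq> Q t)"
      proof (rule most_mono[OF most_tail[OF X1(1) fin1[OF st]]])
        fix u assume u: "u \<in> block_span X1 \<and> prec (s \<union> t) u"
        then show "Q (t \<union> u) \<noteq> Q t" using Fne[OF st, of u] unfolding Q_def by (simp add: Un_assoc)
      qed
    qed
    from it[of s] show ?thesis
    proof (cases rule: iterate.cases)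
      case (point a)
      have "most (lim U Q) (\<lambda>x. x = a)" unfolding limQ point by simp
      then have "most U (\<lambda>t. most (Q t) (\<lambda>x. x = a) \<and> Q t \<noteq> F s)" using ne by simp
      then obtain t where t: "most (Q t) (\<lambda>x. x = a)" "Q t \<noteq> F s" using most_ex by blast
      have "Q t = point a" by (rule most_eq_point[OF t(1)])
      then show ?thesis using t(2) point by simp
    next
      case (dlim \<phi> P g)
      have limQ': "lim U Q = lim (push \<phi> U) P" using limQ dlim by simp
      have ne': "most U (\<lambda>t. Q t \<noteq> lim U Q)" using ne limQ by simp
      show ?thesis
      proof (cases "\<phi> = (\<lambda>s. s)")
        case False
        then have "\<phi> \<in> {\<lambda>s. {Min s}, \<lambda>s. {Max s}}" using dlim(2) unfolding records_def by blast
        then have False using no_min_or_max_limit[OF _ dlim(4) limQ' fixq ne' injq] by blast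
        then show ?thesis ..
      next
        case True
        then have dec: "decodes g U P" and lq: "lim U Q = lim U P" using dlim(4) limQ' by simp_all
        have "most U (\<lambda>t. Q t = tail_lim P t)" by (rule continuations_of_limit[OF dec lq fixq ne'])
        then show ?thesis using dlim(3) dec lq limQ unfolding Q_def by metis
      qed
    qed
  qed
  define good where "good s P g \<longleftrightarrow> (\<forall>x. iterate (P x)) \<and> decodes g U P \<and> F s = lim U P \<and>
      most U (\<lambda>t. F (s \<union> t) = tail_lim P t)" for s P g
  define Pf where "Pf s = (SOME P. \<exists>g. good s P g)" for s
  have "\<exists>P g. good s P g" if "s \<in> block_span X1" for s
    unfolding good_def by (rule ex[OF that])
  then have "\<exists>g. good s (Pf s) g" if "s \<in> block_span X1" for s
    unfolding Pf_def by (rule someI_ex) (rule that)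
  then have Pf: "\<exists>g. decodes g U (Pf s)" "\<And>x. iterate (Pf s x)" "F s = lim U (Pf s)"
      "most U (\<lambda>t. F (s \<union> t) = tail_lim (Pf s) t)" if "s \<in> block_span X1" for s
    using that unfolding good_def by blast+
  have coh: "most U (\<lambda>t. most U (\<lambda>u. Pf (s \<union> t) u = Pf s (t \<union> u)))" if s: "s \<in> block_span X1" for s
  proof -
    obtain g where g: "decodes g U (Pf s)" using Pf(1)[OF s] by blast
    have "most U (\<lambda>t. most U (\<lambda>u. most (Pf s (t \<union> u)) (\<lambda>v. g v = t \<union> u)))"
      using g most_idem[of "\<lambda>x. most (Pf s x) (\<lambda>v. g v = x)"] unfolding decodes_def by simp
    then have "most U (\<lambda>t. most U (\<lambda>u. most (Pf s (t \<union> u)) (\<lambda>v. g v = t \<union> u)) \<and>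
        t \<in> block_span X1 \<and> F (s \<union> t) = tail_lim (Pf s) t)"
      using bigD(2)[OF X1(1)] Pf(4)[OF s] by simp
    then show ?thesis
    proof (rule most_mono)
      fix t assume t: "most U (\<lambda>u. most (Pf s (t \<union> u)) (\<lambda>v. g v = t \<union> u)) \<and>
        t \<in> block_span X1 \<and> F (s \<union> t) = tail_lim (Pf s) t"
      then have st: "s \<union> t \<in> block_span X1" using un1 s by blast
      obtain g' where g': "decodes g' U (Pf (s \<union> t))" using Pf(1)[OF st] by blast
      have "most U (\<lambda>u. most (Pf s (t \<union> u)) (\<lambda>v. g v = t \<union> u) \<and> prec t u)"
        using t most_prec[OF fin1, of t] by simp
      then have "most U (\<lambda>u. most (Pf s (t \<union> u)) (\<lambda>v. g v - t = u))"
      proof (rule most_mono)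
        fix u assume u: "most (Pf s (t \<union> u)) (\<lambda>v. g v = t \<union> u) \<and> prec t u"
        then have "t \<inter> u = {}" using prec_disjoint by blast
        then have tu: "(t \<union> u) - t = u" by blast
        have "most (Pf s (t \<union> u)) (\<lambda>v. g v = t \<union> u)" using u by blast
        then show "most (Pf s (t \<union> u)) (\<lambda>v. g v - t = u)" by (rule most_mono) (simp only: tu)
      qed
      then have "decodes (\<lambda>v. g v - t) U (\<lambda>u. Pf s (t \<union> u))" unfolding decodes_def .
      moreover have "lim U (Pf (s \<union> t)) = lim U (\<lambda>u. Pf s (t \<union> u))"
        using Pf(3)[OF st] t unfolding tail_lim_def by simp
      ultimately show "most U (\<lambda>u. Pf (s \<union> t) u = Pf s (t \<union> u))"
        by (intro discrete_limit_unique[OF g'])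
    qed
  qed
  obtain X2 where X2: "big X2" "block_span X2 \<subseteq> block_span X1" "span0 X2 \<subseteq> span0 X1"
    and diag_D2: "diagonal (\<lambda>q r t. most U (\<lambda>u. Pf (r \<union> t) u = Pf r (t \<union> u))) X2"
    by (rule diagonalizeE[OF X1(1)]; rule that)
  note D2 = diagonalD[OF diag_D2]
  obtain Y where Y: "big Y" "block_span Y \<subseteq> block_span X2" "span0 Y \<subseteq> span0 X2"
    and diag_D: "diagonal (\<lambda>q r u. Pf (q \<union> r) u = Pf q (r \<union> u)) Y"
    by (rule diagonalizeE[OF X2(1)]; rule that)
  note D = diagonalD[OF diag_D]
  note b = bigD(1)[OF Y(1)]
  have Y1: "block_span Y \<subseteq> block_span X1" using Y(2) X2(2) by blast
  have assoc: "Pf (s \<union> t) u = Pf s (t \<union> u)"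
    if s: "s \<in> block_span Y" and t: "t \<in> block_span Y" and u: "u \<in> block_span Y"
      and p: "prec s t" "prec s u" "prec t u" for s t u
  proof -
    have bs2: "s \<in> span0 X2" "t \<in> block_span X2" "s \<in> span0 Y" "t \<in> span0 Y"
      using s t Y(2) span_subset_span0 by blast+
    have "most U (\<lambda>u. Pf (s \<union> t) u = Pf s (t \<union> u))"
      using D2[OF bs2(1) bs2(1) bs2(2) p(1) p(1)] coh[of s] s Y1 by blast
    then show ?thesis by (rule D[OF bs2(3,4) u p(2,3)])
  qed
  \<comment> \<open>The first block of \<open>x\<close>. Sets with another minimum get an arbitrary block, so that \<open>Z\<close> has its values in
    \<open>iterate\<close> everywhere.\<close>
  define hd where "hd x = Y (SOME i. Min (Y i) = Min x)" for x
  have hd: "hd x = Y i" if "Min x = Min (Y i)" for x i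
  proof -
    have "(SOME i. Min (Y i) = Min x) = i"
      by (rule some_equality) (use that Min_block_inj[OF b] in auto)
    then show ?thesis unfolding hd_def by simp
  qed
  define Z where "Z x = Pf (hd x) (x - hd x)" for x
  have itZ: "iterate (Z x)" for x
  proof -
    have "hd x \<in> block_span X1" unfolding hd_def using block_in_span[OF b] Y1 by blast
    then show ?thesis unfolding Z_def by (rule Pf(2))
  qed
  have Z: "Z (s \<union> t) = Pf s t" if s: "s \<in> block_span Y" and t: "t \<in> block_span Y" and st: "prec s t" for s t
  proof -
    obtain i a where i: "a \<in> span0 Y" "s = Y i \<union> a" "prec (Y i) a" "Min s = Min (Y i)"
      using span_first[OF b s] by blast
    have p: "prec (Y i) t" "prec a t" using st i(2) by simp_all
    have "Min (s \<union> t) = Min s" using Min_Un_prec span_FIN[OF b] s t st by blast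
    then have h: "hd (s \<union> t) = Y i" using hd i(4) by simp
    have "(s \<union> t) - Y i = a \<union> t"
      using prec_disjoint[OF i(3)] prec_disjoint[OF p(1)] i(2) by blast
    then have "Z (s \<union> t) = Pf (Y i) (a \<union> t)" unfolding Z_def h by simp
    also have "\<dots> = Pf (Y i \<union> a) t"
    proof (cases "a = {}")
      case False
      then have "a \<in> block_span Y" using i(1) span_iff[OF b] by blast
      then show ?thesis using assoc[OF block_in_span[OF b] _ t i(3) p] by simp
    qed simp
    finally show ?thesis using i(2) by simp
  qed
  have ZF: "tail_lim Z s = F s" if s: "s \<in> block_span Y" for s
  proof -
    have sX: "s \<in> block_span X1" using s Y1 by blast
    have "tail_lim Z s = lim U (Pf s)"
      unfolding tail_lim_def
      by (rule lim_cong, rule most_mono[OF most_tail[OF Y(1) fin1[OF sX]]]) (use Z[OF s] in blast)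
    then show ?thesis using Pf(3)[OF sX] by simp
  qed
  have limZ: "lim U Z = lim U F"
  proof -
    have "lim U (tail_lim Z) = lim U F"
      by (rule lim_cong, rule most_mono[OF bigD(2)[OF Y(1)]]) (rule ZF)
    then show ?thesis unfolding lim_of_tail_lim .
  qed
  have tlZ: "tail_lim Z a = tail_lim F a" if "a \<in> span0 Y" for a
  proof (cases "a = {}")
    case False
    then have a: "a \<in> block_span Y" using that span_iff[OF b] by blast
    then show ?thesis using ZF X1(3) Y1 by auto
  qed (simp add: limZ)
  have "iterate (lim U Z)"
  proof (rule splitting_case[OF itZ Y(1)])
    show "a = c" if "a \<in> span0 Y" "c \<in> span0 Y" "tail_lim Z a = tail_lim Z c" for a c
      using that tlZ inj[of a c] span0_mono[OF Y1] sub0 by auto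
    show "most U (\<lambda>s. Z s \<noteq> tail_lim Z s)"
    proof (rule ccontr)
      assume "\<not> ?thesis"
      then have "most U (\<lambda>s. Z s = tail_lim Z s)" by simp
      then have "most U (\<lambda>s. most U (\<lambda>t. Z (s \<union> t) = tail_lim Z (s \<union> t)))"
        using most_idem[of "\<lambda>s. Z s = tail_lim Z s"] by simp
      then obtain s where s: "most U (\<lambda>t. Z (s \<union> t) = tail_lim Z (s \<union> t))" "s \<in> block_span Y"
        by (rule most_span_obtain[OF _ Y(1) finite.emptyI]) (rule that)
      have sX: "s \<in> block_span X1" using s(2) Y1 by blast
      obtain g where g: "decodes g U (Pf s)" using Pf(1)[OF sX] by blast
      have "most U (\<lambda>t. most U (\<lambda>u. most (Pf s (t \<union> u)) (\<lambda>v. g v = t \<union> u)))"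
        using g most_idem[of "\<lambda>x. most (Pf s x) (\<lambda>v. g v = x)"] unfolding decodes_def by simp
      then have "most U (\<lambda>t. Z (s \<union> t) = tail_lim Z (s \<union> t) \<and> most (Pf s t) (\<lambda>v. g v = t) \<and>
          most U (\<lambda>u. most (Pf s (t \<union> u)) (\<lambda>v. g v = t \<union> u)) \<and> F (s \<union> t) = tail_lim (Pf s) t)"
        using s(1) g Pf(4)[OF sX] unfolding decodes_def by simp
      then obtain t where t: "Z (s \<union> t) = tail_lim Z (s \<union> t) \<and> most (Pf s t) (\<lambda>v. g v = t) \<and>
          most U (\<lambda>u. most (Pf s (t \<union> u)) (\<lambda>v. g v = t \<union> u)) \<and> F (s \<union> t) = tail_lim (Pf s) t"
        "t \<in> block_span Y" "prec s t"
        by (rule most_span_obtain[OF _ Y(1) fin1[OF sX]]) (rule that)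
      have st: "s \<union> t \<in> block_span Y" using span_Un[OF b, of s t] s(2) t(2) span_subset_span0 by blast
      have ft: "finite t" using t(2) Y1 fin1 by blast
      have "Pf s t = tail_lim (Pf s) t" using t Z[OF s(2) t(2,3)] ZF[OF st] by simp
      then have "most (tail_lim (Pf s) t) (\<lambda>v. g v = t)" using t by simp
      then have "most U (\<lambda>u. most (Pf s (t \<union> u)) (\<lambda>v. g v = t) \<and> most (Pf s (t \<union> u)) (\<lambda>v. g v = t \<union> u))"
        using t unfolding most_tail_lim by simp
      then obtain u where u: "most (Pf s (t \<union> u)) (\<lambda>v. g v = t) \<and> most (Pf s (t \<union> u)) (\<lambda>v. g v = t \<union> u)"
        "u \<in> block_span Y" "prec t u"
        by (rule most_span_obtain[OF _ Y(1) ft]) (rule that)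
      then have "most (Pf s (t \<union> u)) (\<lambda>v. g v = t \<and> g v = t \<union> u)" by simp
      then have "t = t \<union> u" using most_ex by blast
      then show False using prec_disjoint[OF u(3)] u(2) span_iff[OF b] by blast
    qed
  qed
  then show ?thesis unfolding limZ .
qed

theorem iterate_lim:
  assumes it: "\<And>s. iterate (F s)"
  shows "iterate (lim U F)"
proof (rule trichotomy[of "\<lambda>a b. tail_lim F a = tail_lim F b"])
  show "tail_lim F a = tail_lim F b" if "most U (\<lambda>c. tail_lim F (a \<union> c) = tail_lim F (b \<union> c))" for a b
    using lim_cong[OF that] unfolding lim_tail_lim .
next
  fix X assume X: "big X" "\<And>a. a \<in> block_span X \<Longrightarrow> tail_lim F {} = tail_lim F a"
  show ?thesis
  proof (rule closing_case[OF it])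
    show "most U (\<lambda>s. tail_lim F s = lim U F)"
      by (rule most_mono[OF bigD(2)[OF X(1)]]) (use X(2) in simp)
  qed
next
  fix X assume X: "big X" "\<And>a. a \<in> block_span X \<Longrightarrow> tail_lim F {} \<noteq> tail_lim F a"
    "\<And>a b. a \<in> block_span X \<Longrightarrow> b \<in> block_span X \<Longrightarrow> (tail_lim F a = tail_lim F b) = (Min a = Min b)"
  show ?thesis
  proof (rule min_case[OF it X(1)])
    show "tail_lim F a \<noteq> lim U F" if "a \<in> block_span X" for a using X(2)[OF that] by simp
    show "tail_lim F a = tail_lim F b" if "a \<in> block_span X" "b \<in> block_span X" "Min a = Min b" for a b
      using X(3)[OF that(1,2)] that(3) by simp
  qed
next
  fix X assume X: "big X" "\<And>a b. a \<in> span0 X \<Longrightarrow> b \<in> span0 X \<Longrightarrow> tail_lim F a = tail_lim F b \<Longrightarrow> a = b"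
  show ?thesis
  proof (cases "most U (\<lambda>s. F s = tail_lim F s)")
    case True
    then show ?thesis using X by (intro continuing_case[OF it X(1)])
  next
    case False
    then have "most U (\<lambda>s. F s \<noteq> tail_lim F s)" by simp
    then show ?thesis using X by (intro splitting_case[OF it X(1)])
  qed
qed (simp_all)

end

section \<open>From Tukey reductions to iterated limits\<close>

text \<open>For the inductive definition of \<open>settled\<close>.\<close>

lemma most_monoI [mono]: "(\<And>x. P x \<longrightarrow> Q x) \<Longrightarrow> most V P \<longrightarrow> most V Q"
  using most_mono[of V P Q] by blast

lemma span_subsetI:
  assumes "block_seq X" "\<And>j. Z j \<in> block_span X"
  shows "block_span Z \<subseteq> block_span X"
proof
  fix s assume "s \<in> block_span Z"
  then obtain F where F: "finite F" "F \<noteq> {}" "s = (\<Union>j\<in>F. Z j)" unfolding block_span_def by auto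
  show "s \<in> block_span X" unfolding F(3) using F(1,2)
  proof (induction F rule: finite_ne_induct)
    case (insert j F)
    then show ?case using span_Un[OF assms(1), of "Z j" "\<Union>j\<in>F. Z j"] assms(2)[of j] span_subset_span0 by auto
  qed (use assms(2) in simp)
qed

context stable_ultra
begin

text \<open>The tree of questions of the introduction. At a leaf one point is known to belong to all values of
  \<open>T\<close> that are compatible with the answers \<open>S\<close>.\<close>

inductive settled :: "((nat \<Rightarrow> nat set) \<Rightarrow> 'i set) \<Rightarrow> nat set set \<Rightarrow> bool" for T where
  stop: "(\<And>X. big X \<Longrightarrow> S \<subseteq> block_span X \<Longrightarrow> i \<in> T X) \<Longrightarrow> settled T S"
| ask: "most U (\<lambda>t. settled T (insert t S)) \<Longrightarrow> settled T S"

lemma settled_iterate: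
  "settled T S \<Longrightarrow> \<exists>W. iterate W \<and> (\<forall>X. big X \<longrightarrow> S \<subseteq> block_span X \<longrightarrow> most W (\<lambda>i. i \<in> T X))"
proof (induction rule: settled.induct)
  case (stop S i)
  then show ?case by (intro exI[of _ "point i"]) (simp add: iterate.point)
next
  case (ask S)
  define good where "good t W \<longleftrightarrow> iterate W \<and>
    (\<forall>X. big X \<longrightarrow> insert t S \<subseteq> block_span X \<longrightarrow> most W (\<lambda>i. i \<in> T X))" for t W
  have ex: "most U (\<lambda>t. \<exists>W. good t W)"
    by (rule most_mono[OF ask]) (simp add: good_def)
  define F where "F t = (if \<exists>W. good t W then SOME W. good t W else point undefined)" for t
  have F: "good t (F t)" if "\<exists>W. good t W" for t
    using someI_ex[OF that] that unfolding F_def by simp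
  have "iterate (F t)" for t
    using F[of t] iterate.point unfolding good_def F_def by (cases "\<exists>W. good t W") (auto simp: good_def F_def)
  then have "iterate (lim U F)" by (rule iterate_lim)
  moreover have "most (lim U F) (\<lambda>i. i \<in> T X)" if X: "big X" "S \<subseteq> block_span X" for X
  proof -
    have "most U (\<lambda>t. (\<exists>W. good t W) \<and> t \<in> block_span X)" using ex bigD(2)[OF X(1)] by simp
    then have "most U (\<lambda>t. most (F t) (\<lambda>i. i \<in> T X))"
    proof (rule most_mono)
      fix t assume t: "(\<exists>W. good t W) \<and> t \<in> block_span X"
      then have "good t (F t)" using F by blast
      then show "most (F t) (\<lambda>i. i \<in> T X)" using t X unfolding good_def by blast
    qed
    then show ?thesis by simp
  qed
  ultimately show ?case by blast
qed

text \<open>Otherwise most one-point extensions of an unsettled set are unsettled, so by diagonalisation all finite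
  sets of blocks of one sequence are. For such a set \<open>S\<close> and every \<open>i\<close>, some \<open>X' S i\<close> compatible with \<open>S\<close> keeps
  \<open>i\<close> out of \<open>T (X' S i)\<close>. Diagonalising against these too, \<open>Z\<close> is below \<open>X' S i\<close> for a set \<open>S\<close> of initial blocks that
  depends on \<open>i\<close>, and monotonicity keeps \<open>i\<close> out of \<open>T Z\<close>.\<close>

lemma empty_settled:
  fixes T :: "(nat \<Rightarrow> nat set) \<Rightarrow> 'i set"
  assumes I: "countable I" and TI: "\<And>X. big X \<Longrightarrow> T X \<subseteq> I" and ne: "\<And>X. big X \<Longrightarrow> T X \<noteq> {}"
    and mono: "\<And>X Y. big X \<Longrightarrow> big Y \<Longrightarrow> block_span X \<subseteq> block_span Y \<Longrightarrow> T X \<subseteq> T Y"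
  shows "settled T {}"
proof (rule ccontr)
  assume not: "\<not> settled T {}"
  \<comment> \<open>The enumeration of \<open>I\<close> limits the points to be excluded at each stage to finitely many.\<close>
  define c where "c = to_nat_on I"
  have c: "inj_on c I" unfolding c_def by (rule inj_on_to_nat_on[OF I])
  have "most U (\<lambda>s. s \<in> FIN)" by (rule most_FIN)
  then obtain X0 where X0: "big X0" using ex_big by blast
  define X' where "X' S i = (SOME X. big X \<and> S \<subseteq> block_span X \<and> i \<notin> T X)" for S i
  have X': "big (X' S i) \<and> S \<subseteq> block_span (X' S i) \<and> i \<notin> T (X' S i)" if "\<not> settled T S" for S i
  proof -
    have "\<exists>X. big X \<and> S \<subseteq> block_span X \<and> i \<notin> T X" using that settled.stop[of S i T] by blast
    then show ?thesis unfolding X'_def by (rule someI_ex)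
  qed
  define Q where "Q q r t \<longleftrightarrow>
    (\<forall>S\<in>Pow (Pow (down r)). \<not> settled T S \<longrightarrow> \<not> settled T (insert t S)) \<and>
    (\<forall>S\<in>Pow (Pow (down r)). \<forall>i\<in>{i\<in>I. c i \<in> down r}. \<not> settled T S \<longrightarrow> t \<in> block_span (X' S i))"
    for q r t :: "nat set"
  have Q: "most U (Q q r)" if "finite r" for q r
  proof -
    have f1: "finite (Pow (Pow (down r)))" using finite_down[OF that] by simp
    have f2: "finite {i\<in>I. c i \<in> down r}"
    proof (rule finite_imageD)
      show "finite (c ` {i\<in>I. c i \<in> down r})"
        by (rule finite_subset[OF _ finite_down[OF that]]) auto
      show "inj_on c {i\<in>I. c i \<in> down r}" by (rule inj_on_subset[OF c]) auto
    qed
    have "most U (\<lambda>t. \<not> settled T (insert t S))" if "\<not> settled T S" for S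
      using that settled.ask[of T S] by auto
    moreover have "most U (\<lambda>t. t \<in> block_span (X' S i))" if "\<not> settled T S" for S i
      using X'[OF that] bigD(2) by blast
    ultimately show ?thesis
      unfolding Q_def most_conj most_ball_finite[OF f1] most_ball_finite[OF f2] most_imp most_const by blast
  qed
  obtain Z where Z: "big Z" "block_span Z \<subseteq> block_span X0" "span0 Z \<subseteq> span0 X0"
    and diag_D: "diagonal Q Z"
    by (rule diagonalizeE[OF X0]; rule that)
  note D = diagonalD[OF diag_D]
  note b = bigD(1)[OF Z(1)]
  define r where "r n = (\<Union>j\<in>{..<n}. Z j)" for n
  have r: "r n \<in> span0 Z" "finite (r n)" for n
    unfolding r_def using span0_UN[OF b, of "{..<n}"] span0_finite[OF b] by blast+
  have rp: "prec (r n) (Z m)" if "n \<le> m" for n m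
    unfolding prec_def
  proof (intro ballI)
    fix x y assume "x \<in> r n" "y \<in> Z m"
    then obtain j where "j < n" "x \<in> Z j" unfolding r_def by blast
    then show "x < y" using block_prec[OF b, of j m] that \<open>y \<in> Z m\<close> unfolding prec_def by auto
  qed
  have QZ: "Q (r n) (r n) (Z m)" if "n \<le> m" for n m
    using D[OF r(1) r(1) block_in_span[OF b] rp[OF that] rp[OF that]] Q[OF r(2)] by blast
  have sub: "Z ` {..<n} \<in> Pow (Pow (down (r n)))" for n
    using subset_down[of "r n"] unfolding r_def by blast
  have un: "\<not> settled T (Z ` {..<n})" for n
  proof (induction n)
    case 0
    then show ?case using not by simp
  next
    case (Suc n)
    have "\<not> settled T (insert (Z n) (Z ` {..<n}))" using QZ[of n n] sub[of n] Suc unfolding Q_def by blast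
    moreover have "Z ` {..<Suc n} = insert (Z n) (Z ` {..<n})" by (auto simp: lessThan_Suc)
    ultimately show ?case by simp
  qed
  have "i \<notin> T Z" if i: "i \<in> I" for i
  proof -
    define n where "n = Suc (c i)"
    note X = X'[OF un[of n], of i]
    have ci: "c i \<in> down (r n)"
    proof -
      have "Min (Z (c i)) \<in> Z (c i)" using block_finite[OF b] block_nonempty[OF b] by (rule Min_in)
      then have "Min (Z (c i)) \<in> r n" unfolding r_def n_def by blast
      then show ?thesis using block_index_le[OF b, of "c i"] unfolding down_def by blast
    qed
    have "Z j \<in> block_span (X' (Z ` {..<n}) i)" for j
    proof (cases "j < n")
      case True
      then show ?thesis using X by blast
    next
      case False
      then have "Q (r n) (r n) (Z j)" by (intro QZ) simp
      then show ?thesis using sub[of n] ci i un[of n] unfolding Q_def by blast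
    qed
    then have "block_span Z \<subseteq> block_span (X' (Z ` {..<n}) i)"
      using X bigD(1) by (intro span_subsetI) auto
    then have "T Z \<subseteq> T (X' (Z ` {..<n}) i)" using X Z(1) by (intro mono) auto
    then show ?thesis using X by blast
  qed
  then show False using TI[OF Z(1)] ne[OF Z(1)] by blast
qed

lemma iterate_of_monotone_cofinal:
  fixes T :: "(nat \<Rightarrow> nat set) \<Rightarrow> 'i set" and V :: "'i ultra"
  assumes I: "countable I" and TI: "\<And>X. big X \<Longrightarrow> T X \<subseteq> I" and TV: "\<And>X. big X \<Longrightarrow> most V (\<lambda>i. i \<in> T X)"
    and mono: "\<And>X Y. big X \<Longrightarrow> big Y \<Longrightarrow> block_span X \<subseteq> block_span Y \<Longrightarrow> T X \<subseteq> T Y"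
    and cofinal: "\<And>P. most V P \<Longrightarrow> \<exists>X. big X \<and> (\<forall>i\<in>T X. P i)"
  shows "iterate V"
proof -
  have "T X \<noteq> {}" if "big X" for X using most_ex[OF TV[OF that]] by blast
  then have "settled T {}" using I TI mono by (intro empty_settled)
  then obtain W where W: "iterate W" "\<And>X. big X \<Longrightarrow> most W (\<lambda>i. i \<in> T X)"
    using settled_iterate[of T "{}"] by auto
  have "V = W"
  proof (rule ultra_eqI')
    fix P assume "most V P"
    then obtain X where X: "big X" "\<forall>i\<in>T X. P i" using cofinal by blast
    show "most W P" by (rule most_mono[OF W(2)[OF X(1)]]) (use X(2) in blast)
  qed
  then show ?thesis using W(1) by simp
qed

end

subsection \<open>Ultrafilters on subsets of a type\<close>

definition ultra_on :: "'a set \<Rightarrow> 'a set set \<Rightarrow> 'a ultra" where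
  "ultra_on I V = ultra_of (\<lambda>P. {x\<in>I. P x} \<in> V)"

lemma most_ultra_on:
  assumes "ultrafilter_on I V"
  shows "most (ultra_on I V) P \<longleftrightarrow> {x\<in>I. P x} \<in> V"
proof -
  have I: "I \<in> V" and e: "{} \<notin> V" and int: "\<And>A B. A \<in> V \<Longrightarrow> B \<in> V \<Longrightarrow> A \<inter> B \<in> V"
    and up: "\<And>A B. A \<in> V \<Longrightarrow> A \<subseteq> B \<Longrightarrow> B \<subseteq> I \<Longrightarrow> B \<in> V"
    and ult: "\<And>A. A \<subseteq> I \<Longrightarrow> A \<in> V \<or> I - A \<in> V"
    using assms unfolding ultrafilter_on_def by blast+
  show ?thesis
    unfolding ultra_on_def
  proof (rule most_ultra_of)
    show "{x \<in> I. True} \<in> V" using I by simp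
    show "({x \<in> I. \<not> P x} \<in> V) \<longleftrightarrow> {x \<in> I. P x} \<notin> V" for P
    proof -
      have "{x \<in> I. \<not> P x} = I - {x \<in> I. P x}" "{x \<in> I. P x} \<inter> (I - {x \<in> I. P x}) = {}" by auto
      then show ?thesis using ult[of "{x \<in> I. P x}"] int[of "{x \<in> I. P x}" "I - {x \<in> I. P x}"] e by auto
    qed
    show "{x \<in> I. P x \<and> Q x} \<in> V" if "{x \<in> I. P x} \<in> V" "{x \<in> I. Q x} \<in> V" for P Q
    proof -
      have "{x \<in> I. P x \<and> Q x} = {x \<in> I. P x} \<inter> {x \<in> I. Q x}" by auto
      then show ?thesis using int[OF that] by simp
    qed
    show "{x \<in> I. Q x} \<in> V" if "{x \<in> I. P x} \<in> V" "\<And>x. P x \<Longrightarrow> Q x" for P Q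
      by (rule up[OF that(1)]) (use that(2) in auto)
  qed
qed

lemma ultrafilter_on_subset: "ultrafilter_on I V \<Longrightarrow> A \<in> V \<Longrightarrow> A \<subseteq> I"
  unfolding ultrafilter_on_def by (elim conjE) (drule subsetD, assumption, simp)

lemma span_subset_FIN: "block_seq X \<Longrightarrow> block_span X \<subseteq> FIN"
  using span_FIN by blast

lemma most_ultra_on_span:
  assumes "ultrafilter_on FIN U" "block_seq X"
  shows "most (ultra_on FIN U) (\<lambda>s. s \<in> block_span X) \<longleftrightarrow> block_span X \<in> U"
proof -
  have "{s \<in> FIN. s \<in> block_span X} = block_span X" using span_subset_FIN[OF assms(2)] by blast
  then show ?thesis using most_ultra_on[OF assms(1)] by simp
qed

lemma stable_ultra_ultra_on:
  assumes "stable_ordered_union U"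
  shows "stable_ultra (ultra_on FIN U)"
proof -
  have ou: "ordered_union U" using assms unfolding stable_ordered_union_def by (rule conjunct1)
  then have uf: "ultrafilter_on FIN U" unfolding ordered_union_def by (rule conjunct1)
  have "\<exists>B. filter_base U B \<and> (\<forall>b\<in>B. \<exists>X. block_seq X \<and> b = block_span X)"
    using ou unfolding ordered_union_def by (rule conjunct2)
  then obtain B where B: "filter_base U B" "\<forall>b\<in>B. \<exists>X. block_seq X \<and> b = block_span X"
    by (elim exE conjE) (rule that)
  show ?thesis
  proof
    show "most (ultra_on FIN U) (\<lambda>s. s \<in> FIN)"
      using uf unfolding most_ultra_on[OF uf] ultrafilter_on_def by simp
  next
    fix P assume "most (ultra_on FIN U) P"
    then have "{s \<in> FIN. P s} \<in> U" unfolding most_ultra_on[OF uf] .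
    then obtain b where b: "b \<in> B" "b \<subseteq> {s \<in> FIN. P s}" using B(1) unfolding filter_base_def by blast
    then obtain X where X: "block_seq X" "b = block_span X" using B(2) by blast
    have "block_span X \<in> U" using b(1) X(2) B(1) unfolding filter_base_def by blast
    then show "\<exists>X. block_seq X \<and> most (ultra_on FIN U) (\<lambda>s. s \<in> block_span X) \<and> (\<forall>s\<in>block_span X. P s)"
      using X b(2) most_ultra_on_span[OF uf X(1)] by blast
  next
    fix Xs assume Xs: "\<And>i. block_seq (Xs i) \<and> most (ultra_on FIN U) (\<lambda>s. s \<in> block_span (Xs i)) \<and>
        block_le_star (Xs (Suc i)) (Xs i)"
    then have "\<forall>i. block_seq (Xs i) \<and> block_span (Xs i) \<in> U \<and> block_le_star (Xs (Suc i)) (Xs i)"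
      using most_ultra_on_span[OF uf] by blast
    then have "\<exists>X. block_seq X \<and> block_span X \<in> U \<and> (\<forall>i. block_le_star X (Xs i))"
      by (rule mp[OF spec[OF conjunct2[OF assms[unfolded stable_ordered_union_def]]]])
    then obtain X where X: "block_seq X" "block_span X \<in> U" "\<forall>i. block_le_star X (Xs i)"
      by (elim exE conjE) (rule that)
    then show "\<exists>X. block_seq X \<and> most (ultra_on FIN U) (\<lambda>s. s \<in> block_span X) \<and> (\<forall>i. block_le_star X (Xs i))"
      using most_ultra_on_span[OF uf X(1)] by blast
  qed
qed

text \<open>The reduction \<open>f\<close> is replaced by the union \<open>T X\<close> of its values on members of \<open>U\<close> inside the span of \<open>X\<close>. This is
  monotone by construction. It is still cofinal: if no member of \<open>U\<close> had all smaller values of \<open>f\<close> inside a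
  given \<open>A \<in> V\<close>, the \<open>C\<close> with \<open>f C\<close> not inside \<open>A\<close> would form a base of \<open>U\<close> whose image is no base of \<open>V\<close>.\<close>

lemma tukey_iterate:
  assumes U: "stable_ordered_union U" and I: "countable I" and V: "ultrafilter_on I V" and le: "V \<le>\<^sub>T U"
  shows "stable_ultra.iterate (ultra_on FIN U) (ultra_on I V)"
proof -
  interpret stable_ultra "ultra_on FIN U" by (rule stable_ultra_ultra_on[OF U])
  have uf: "ultrafilter_on FIN U"
    using U unfolding stable_ordered_union_def ordered_union_def by (elim conjE)
  obtain f where f: "f \<in> U \<rightarrow> V" "\<And>B. filter_base U B \<Longrightarrow> filter_base V (f ` B)"
    using le unfolding tukey_le_def by blast
  have VI: "A \<subseteq> I" if "A \<in> V" for A by (rule ultrafilter_on_subset[OF V that])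
  have inU: "block_span X \<in> U" if "big X" for X
    using bigD[OF that] most_ultra_on_span[OF uf] by blast
  define T where "T X = (\<Union>B\<in>{B\<in>U. B \<subseteq> block_span X}. f B)" for X
  show ?thesis
  proof (rule iterate_of_monotone_cofinal[OF I, of T])
    show TI: "T X \<subseteq> I" if "big X" for X unfolding T_def using f(1) VI by blast
    show "most (ultra_on I V) (\<lambda>i. i \<in> T X)" if X: "big X" for X
    proof -
      have "f (block_span X) \<in> V" using f(1) inU[OF X] by blast
      moreover have "f (block_span X) \<subseteq> {i \<in> I. i \<in> T X}"
        using inU[OF X] VI[OF calculation] unfolding T_def by blast
      ultimately show ?thesis
        unfolding most_ultra_on[OF V] using V unfolding ultrafilter_on_def by blast
    qed
    show "T X \<subseteq> T Y" if "block_span X \<subseteq> block_span Y" for X Y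
      unfolding T_def using that by blast
    show "\<exists>X. big X \<and> (\<forall>i\<in>T X. P i)" if P: "most (ultra_on I V) P" for P
    proof -
      have PV: "{i \<in> I. P i} \<in> V" using P unfolding most_ultra_on[OF V] .
      have "\<exists>B\<in>U. \<forall>C\<in>U. C \<subseteq> B \<longrightarrow> f C \<subseteq> {i \<in> I. P i}"
      proof (rule ccontr)
        assume "\<not> ?thesis"
        then have "filter_base U {C\<in>U. \<not> f C \<subseteq> {i \<in> I. P i}}" unfolding filter_base_def by blast
        then have "filter_base V (f ` {C\<in>U. \<not> f C \<subseteq> {i \<in> I. P i}})" by (rule f(2))
        then show False using PV unfolding filter_base_def by blast
      qed
      then obtain B where B: "B \<in> U" "\<And>C. C \<in> U \<Longrightarrow> C \<subseteq> B \<Longrightarrow> f C \<subseteq> {i \<in> I. P i}" by blast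
      have "B \<subseteq> FIN" by (rule ultrafilter_on_subset[OF uf B(1)])
      then have "{s \<in> FIN. s \<in> B} = B" by blast
      then have "most (ultra_on FIN U) (\<lambda>s. s \<in> B)" using B(1) unfolding most_ultra_on[OF uf] by simp
      then obtain X where X: "big X" "\<forall>s\<in>block_span X. s \<in> B" using ex_big by blast
      have "\<forall>i\<in>T X. P i"
      proof
        fix i assume "i \<in> T X"
        then obtain C where C: "C \<in> U" "C \<subseteq> block_span X" "i \<in> f C" unfolding T_def by blast
        then have "C \<subseteq> B" using X(2) by blast
        then show "P i" using B(2)[OF C(1)] C(3) by blast
      qed
      then show ?thesis using X(1) by blast
    qed
  qed
qed

section \<open>The countable ordinals and the Fubini classes\<close>

lemma wo_omega1: "wo_rel omega1"
  using Well_order_omega1 by (simp add: wo_rel_def)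

lemma omega1_trans: "(a, b) \<in> omega1 \<Longrightarrow> (b, c) \<in> omega1 \<Longrightarrow> (a, c) \<in> omega1"
  using wo_rel.TRANS[OF wo_omega1] unfolding trans_def by blast

lemma omega1_antisym: "(a, b) \<in> omega1 \<Longrightarrow> (b, a) \<in> omega1 \<Longrightarrow> a = b"
  using wo_rel.ANTISYM[OF wo_omega1] unfolding antisym_def by blast

lemma omega1_total: "a \<in> Field omega1 \<Longrightarrow> b \<in> Field omega1 \<Longrightarrow> (a, b) \<in> omega1 \<or> (b, a) \<in> omega1"
  using wo_rel.TOTALS[OF wo_omega1] by blast

lemma omega1_least:
  assumes "B \<subseteq> Field omega1" "B \<noteq> {}"
  shows "\<exists>m\<in>B. \<forall>b\<in>B. (m, b) \<in> omega1"
  using wo_rel.minim_in[OF wo_omega1 assms] wo_rel.minim_least[OF wo_omega1 assms(1)] by blast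

lemma underS_trans: "a \<in> underS omega1 b \<Longrightarrow> (b, c) \<in> omega1 \<Longrightarrow> a \<in> underS omega1 c"
  unfolding underS_def using omega1_trans omega1_antisym by blast

lemma infinite_omega1: "\<not> finite (Field omega1)"
  unfolding omega1_def cardSuc_finite[OF natLeq_Card_order] by (simp add: Field_natLeq)

lemma omega1_above: "a \<in> Field omega1 \<Longrightarrow> \<exists>b\<in>Field omega1. a \<in> underS omega1 b"
  using infinite_Card_order_limit[OF Card_order_omega1 infinite_omega1] unfolding underS_def by blast

text \<open>This is the regularity of the first uncountable cardinal.\<close>

lemma omega1_countable_bound:
  fixes \<alpha> :: "nat \<Rightarrow> nat set"
  assumes "\<And>n. \<alpha> n \<in> Field omega1"
  shows "\<exists>\<gamma>\<in>Field omega1. \<forall>n. \<alpha> n \<in> underS omega1 \<gamma>"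
proof -
  have "\<exists>i\<in>Field (cardSuc natLeq). range \<alpha> \<subseteq> under omega1 i"
  proof (rule cardSuc_UNION_Cinfinite[OF natLeq_Cinfinite])
    show "relChain (cardSuc natLeq) (under omega1)"
      unfolding relChain_def under_def omega1_def[symmetric] using omega1_trans by blast
    show "range \<alpha> \<subseteq> (\<Union>i\<in>Field (cardSuc natLeq). under omega1 i)"
      unfolding omega1_def[symmetric] under_def
      using assms omega1_total by blast
    show "(card_of (range \<alpha>), natLeq) \<in> ordLeq"
      by (rule ordLeq_ordIso_trans[OF card_of_image card_of_nat])
  qed
  then obtain i where i: "i \<in> Field omega1" "\<And>n. (\<alpha> n, i) \<in> omega1"
    unfolding omega1_def[symmetric] under_def by blast
  obtain b where b: "b \<in> Field omega1" "i \<in> underS omega1 b" using omega1_above[OF i(1)] by blast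
  have "\<alpha> n \<in> underS omega1 b" for n
    using i(2)[of n] b(2) omega1_trans omega1_antisym unfolding underS_def by blast
  then show ?thesis using b(1) by blast
qed

text \<open>The least upper bound of a strictly increasing sequence of bounds is a limit.\<close>

lemma omega1_limit_bound:
  fixes \<alpha> :: "nat \<Rightarrow> nat set"
  assumes \<alpha>: "\<And>n. \<alpha> n \<in> Field omega1"
  shows "\<exists>\<gamma>\<in>Field omega1. (\<forall>n. \<alpha> n \<in> underS omega1 \<gamma>) \<and>
    \<not> is_zero1 \<gamma> \<and> (\<nexists>\<beta>. is_succ1 \<beta> \<gamma>)"
proof -
  have "\<exists>f. \<forall>k. (f k \<in> Field omega1 \<and> (\<forall>n. \<alpha> n \<in> underS omega1 (f k))) \<and>
      f k \<in> underS omega1 (f (Suc k))"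
  proof (rule dependent_nat_choice)
    show "\<exists>x. x \<in> Field omega1 \<and> (\<forall>n. \<alpha> n \<in> underS omega1 x)"
      using omega1_countable_bound[of \<alpha>] \<alpha> by blast
  next
    fix x and k :: nat assume x: "x \<in> Field omega1 \<and> (\<forall>n. \<alpha> n \<in> underS omega1 x)"
    then obtain b where b: "b \<in> Field omega1" "x \<in> underS omega1 b" using omega1_above by blast
    then have "(x, b) \<in> omega1" unfolding underS_def by blast
    then have "\<forall>n. \<alpha> n \<in> underS omega1 b" using x underS_trans by blast
    then show "\<exists>y. (y \<in> Field omega1 \<and> (\<forall>n. \<alpha> n \<in> underS omega1 y)) \<and>
        x \<in> underS omega1 y" using b by blast
  qed
  then obtain f where f: "\<And>k. f k \<in> Field omega1" "\<And>k n. \<alpha> n \<in> underS omega1 (f k)"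
    "\<And>k. f k \<in> underS omega1 (f (Suc k))" by blast
  define B where "B = {b \<in> Field omega1. \<forall>k. f k \<in> underS omega1 b}"
  have "B \<noteq> {}" unfolding B_def using omega1_countable_bound[of f] f(1) by blast
  then obtain \<gamma> where \<gamma>: "\<gamma> \<in> B" "\<And>b. b \<in> B \<Longrightarrow> (\<gamma>, b) \<in> omega1"
    using omega1_least[of B] unfolding B_def by blast
  have fg: "f k \<in> underS omega1 \<gamma>" for k using \<gamma>(1) unfolding B_def by blast
  have "\<alpha> n \<in> underS omega1 \<gamma>" for n
    using underS_trans[OF f(2)[of n 0]] fg[of 0] unfolding underS_def by blast
  moreover have "\<not> is_zero1 \<gamma>" unfolding is_zero1_def using fg by blast
  moreover have False if \<beta>: "is_succ1 \<beta> \<gamma>" for \<beta>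
  proof -
    have bg: "\<beta> \<in> underS omega1 \<gamma>" and top: "\<And>\<delta>. \<delta> \<in> underS omega1 \<gamma> \<Longrightarrow> (\<delta>, \<beta>) \<in> omega1"
      using \<beta> unfolding is_succ1_def by blast+
    have "f k \<in> underS omega1 \<beta>" for k
      by (rule underS_trans[OF f(3)[of k] top[OF fg]])
    moreover have "\<beta> \<in> Field omega1" using bg unfolding underS_def by (auto simp: Field_def)
    ultimately have "\<beta> \<in> B" unfolding B_def by blast
    then have "(\<gamma>, \<beta>) \<in> omega1" by (rule \<gamma>(2))
    then show False using bg omega1_antisym unfolding underS_def by blast
  qed
  ultimately show ?thesis using \<gamma>(1) unfolding B_def by blast
qed

lemma omega1_succ:
  assumes \<gamma>: "\<gamma> \<in> Field omega1"
  shows "\<exists>\<delta>\<in>Field omega1. is_succ1 \<gamma> \<delta>"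
proof -
  define B where "B = {b \<in> Field omega1. \<gamma> \<in> underS omega1 b}"
  have "B \<noteq> {}" unfolding B_def using omega1_above[OF \<gamma>] by blast
  then obtain \<delta> where \<delta>: "\<delta> \<in> B" "\<And>b. b \<in> B \<Longrightarrow> (\<delta>, b) \<in> omega1"
    using omega1_least[of B] unfolding B_def by blast
  have "(\<eta>, \<gamma>) \<in> omega1" if \<eta>: "\<eta> \<in> underS omega1 \<delta>" for \<eta>
  proof (rule ccontr)
    assume n: "(\<eta>, \<gamma>) \<notin> omega1"
    have F: "\<eta> \<in> Field omega1" using \<eta> unfolding underS_def by (auto simp: Field_def)
    then have "(\<gamma>, \<eta>) \<in> omega1" using omega1_total[OF F \<gamma>] n by blast
    then have "\<eta> \<in> B" unfolding B_def underS_def using F n by blast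
    then have "(\<delta>, \<eta>) \<in> omega1" by (rule \<delta>(2))
    then show False using \<eta> omega1_antisym unfolding underS_def by blast
  qed
  then have "is_succ1 \<gamma> \<delta>" using \<delta>(1) unfolding is_succ1_def B_def by blast
  then show ?thesis using \<delta>(1) unfolding B_def by blast
qed

lemma fubini_class0_subset: "fubini_class0 e p U \<subseteq> fubini_class_omega1 e p U"
proof -
  have "Field omega1 \<noteq> {}" using infinite_omega1 by auto
  then obtain z where z: "z \<in> Field omega1" "\<And>b. b \<in> Field omega1 \<Longrightarrow> (z, b) \<in> omega1"
    using omega1_least[of "Field omega1"] by blast
  have "is_zero1 z" unfolding is_zero1_def underS_def
    using z(2) omega1_antisym by (auto simp: Field_def)
  then show ?thesis using fubini_class_zero[of z e p U] z(1) unfolding fubini_class_omega1_def by blast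
qed

text \<open>The successor step of the classes wants all \<open>W x\<close> in the same class. They all lie in the class of a
  limit ordinal above their indices, which is the union of the earlier ones.\<close>

lemma fubini_class_step:
  assumes V: "V \<in> fubini_class0 e p U" and W: "\<And>x :: nat. W x \<in> fubini_class_omega1 e p U"
  shows "rk_image UNIV UNIV p (fubini_lim UNIV UNIV V W) \<in> fubini_class_omega1 e p U"
proof -
  have "\<forall>x. \<exists>\<alpha>. \<alpha> \<in> Field omega1 \<and> W x \<in> fubini_class e p U \<alpha>"
    using W unfolding fubini_class_omega1_def by blast
  then obtain \<alpha> where \<alpha>: "\<And>x. \<alpha> x \<in> Field omega1" "\<And>x. W x \<in> fubini_class e p U (\<alpha> x)" by metis
  obtain \<gamma> where \<gamma>: "\<gamma> \<in> Field omega1" "\<And>n. \<alpha> n \<in> underS omega1 \<gamma>"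
    "\<not> is_zero1 \<gamma>" "\<nexists>\<beta>. is_succ1 \<beta> \<gamma>" using omega1_limit_bound[of \<alpha>] \<alpha>(1) by blast
  have "W x \<in> fubini_class e p U \<gamma>" for x
    unfolding fubini_class_lim[OF \<gamma>(3,4)] using \<alpha>(2) \<gamma>(2) by blast
  moreover obtain \<delta> where \<delta>: "\<delta> \<in> Field omega1" "is_succ1 \<gamma> \<delta>" using omega1_succ[OF \<gamma>(1)] by blast
  ultimately have "rk_image UNIV UNIV p (fubini_lim UNIV UNIV V W) \<in> fubini_class e p U \<delta>"
    unfolding fubini_class_succ[OF \<delta>(2)] fubini_step_def using V by blast
  then show ?thesis using \<delta>(1) unfolding fubini_class_omega1_def by blast
qed

section \<open>Iterated discrete limits are Fubini iterates\<close>

lemma mem_Rep_ultra: "A \<in> Rep_ultra V \<longleftrightarrow> most V (\<lambda>x. x \<in> A)"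
  unfolding most_def by simp

lemma rk_image_Rep: "rk_image UNIV UNIV f (Rep_ultra V) = Rep_ultra (push f V)"
  unfolding rk_image_def by (simp add: set_eq_iff mem_Rep_ultra vimage_def)

lemma rk_image_ultra_on:
  assumes "ultrafilter_on I V"
  shows "rk_image I UNIV f V = Rep_ultra (push f (ultra_on I V))"
proof -
  have eq: "f -` Y \<inter> I = {x \<in> I. f x \<in> Y}" for Y by auto
  show ?thesis
    unfolding rk_image_def eq by (intro set_eqI) (simp add: mem_Rep_ultra most_ultra_on[OF assms])
qed

lemma fubini_lim_Rep:
  "fubini_lim UNIV UNIV (Rep_ultra V) (\<lambda>x. Rep_ultra (W x)) = Rep_ultra (lim V (\<lambda>x. push (Pair x) (W x)))"
  unfolding fubini_lim_def by (simp add: set_eq_iff mem_Rep_ultra)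

definition ultra_iso :: "'a ultra \<Rightarrow> 'b ultra \<Rightarrow> bool" where
  "ultra_iso V W \<longleftrightarrow> (\<exists>f g. push f V = W \<and> push g W = V)"

context
  fixes e :: "nat set \<Rightarrow> nat" and p :: "nat \<times> nat \<Rightarrow> nat" and U\<^sub>0 :: "nat set set set"
  assumes e: "bij_betw e FIN UNIV" and p: "bij p" and U0: "stable_ordered_union U\<^sub>0"
begin

interpretation stable_ultra "ultra_on FIN U\<^sub>0" by (rule stable_ultra_ultra_on[OF U0])

abbreviation "fubini_iterates \<equiv> {C :: nat ultra. Rep_ultra C \<in> fubini_class_omega1 e p U\<^sub>0}"

lemma record_in_class0:
  assumes "\<phi> \<in> records"
  shows "\<exists>a b. Rep_ultra (push a (push \<phi> (ultra_on FIN U\<^sub>0))) \<in> fubini_class0 e p U\<^sub>0 \<and> most (push \<phi> (ultra_on FIN U\<^sub>0)) (\<lambda>x. b (a x :: nat) = x)"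
proof -
  have uf: "ultrafilter_on FIN U\<^sub>0"
    using U0 unfolding stable_ordered_union_def ordered_union_def by (elim conjE)
  consider (1) "\<phi> = (\<lambda>s. {Min s})" | (2) "\<phi> = (\<lambda>s. {Max s})" | (3) "\<phi> = (\<lambda>s. s)"
    using assms unfolding records_def by blast
  then show ?thesis
  proof cases
    case 1
    have "Rep_ultra (push Min (push \<phi> (ultra_on FIN U\<^sub>0))) = rk_image FIN UNIV Min U\<^sub>0"
      unfolding push_push rk_image_ultra_on[OF uf] 1 by simp
    then have "Rep_ultra (push Min (push \<phi> (ultra_on FIN U\<^sub>0))) \<in> fubini_class0 e p U\<^sub>0" unfolding fubini_class0_def by simp
    moreover have "most (push \<phi> (ultra_on FIN U\<^sub>0)) (\<lambda>x. {Min x} = x)" unfolding 1 by simp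
    ultimately show ?thesis by (intro exI conjI)
  next
    case 2
    have "Rep_ultra (push Max (push \<phi> (ultra_on FIN U\<^sub>0))) = rk_image FIN UNIV Max U\<^sub>0"
      unfolding push_push rk_image_ultra_on[OF uf] 2 by simp
    then have "Rep_ultra (push Max (push \<phi> (ultra_on FIN U\<^sub>0))) \<in> fubini_class0 e p U\<^sub>0" unfolding fubini_class0_def by simp
    moreover have "most (push \<phi> (ultra_on FIN U\<^sub>0)) (\<lambda>x. {Max x} = x)" unfolding 2 by simp
    ultimately show ?thesis by (intro exI conjI)
  next
    case 3
    have "Rep_ultra (push e (push \<phi> (ultra_on FIN U\<^sub>0))) = rk_image FIN UNIV e U\<^sub>0"
      unfolding push_push rk_image_ultra_on[OF uf] 3 by simp
    then have "Rep_ultra (push e (push \<phi> (ultra_on FIN U\<^sub>0))) \<in> fubini_class0 e p U\<^sub>0" unfolding fubini_class0_def by simp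
    moreover have "most (push \<phi> (ultra_on FIN U\<^sub>0)) (\<lambda>x. inv_into FIN e (e x) = x)"
    proof -
      have "most (ultra_on FIN U\<^sub>0) (\<lambda>s. inv_into FIN e (e s) = s)"
        by (rule most_mono[OF most_FIN]) (use e in \<open>simp add: bij_betw_def\<close>)
      then show ?thesis unfolding 3 by simp
    qed
    ultimately show ?thesis by (intro exI conjI)
  qed
qed

text \<open>In a discrete limit the components are mostly principal or mostly not. If they are, the limit is
  isomorphic to the index ultrafilter. If not, the decoder together with the isomorphisms of the
  components maps the limit to the Fubini limit of their representatives.\<close>

lemma iterate_point_or_class:
  "iterate W \<Longrightarrow> (\<exists>a. W = point a) \<or> (\<exists>C\<in>fubini_iterates. ultra_iso W C)"
proof (induction rule: iterate.induct)
  case (point a)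
  then show ?case by blast
next
  case (dlim \<phi> P g)
  define D where "D = push \<phi> (ultra_on FIN U\<^sub>0)"
  obtain a b where ab: "Rep_ultra (push a D) \<in> fubini_class0 e p U\<^sub>0" "most D (\<lambda>x. b (a x :: nat) = x)"
    using record_in_class0[OF dlim(1)] unfolding D_def by blast
  have dec: "most D (\<lambda>x. most (P x) (\<lambda>v. g v = x))" using dlim(3) unfolding decodes_def D_def .
  have aI: "push a D \<in> fubini_iterates" using ab(1) fubini_class0_subset by blast
  show ?case
  proof (cases "most D (\<lambda>x. \<exists>q. P x = point q)")
    case True
    define q where "q x = (SOME q. P x = point q)" for x
    have "most D (\<lambda>x. P x = point (q x))"
    proof (rule most_mono[OF True])
      fix x assume "\<exists>q. P x = point q"
      then show "P x = point (q x)" unfolding q_def by (rule someI_ex)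
    qed
    then have L: "lim D P = push q D" using lim_cong lim_point by metis
    have "push g (lim D P) = D" using decodes_push_lim dlim(3) unfolding D_def by blast
    then have "push (\<lambda>v. a (g v)) (lim D P) = push a D" by (simp add: push_push[symmetric])
    moreover have "push (\<lambda>n. q (b n)) (push a D) = lim D P"
      unfolding L push_push by (rule push_cong, rule most_mono[OF ab(2)]) simp
    ultimately have "ultra_iso (lim D P) (push a D)" unfolding ultra_iso_def by blast
    then show ?thesis using aI unfolding D_def by blast
  next
    case False
    define good where "good x C f h \<longleftrightarrow> C \<in> fubini_iterates \<and> push f (P x) = C \<and> push h C = P x" for x C f h
    have good: "most D (\<lambda>x. \<exists>C f h. good x C f h)"
    proof -
      have "most D (\<lambda>x. \<not> (\<exists>q. P x = point q))" using False unfolding most_not .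
      then show ?thesis
      proof (rule most_mono)
        fix x assume "\<not> (\<exists>q. P x = point q)"
        then show "\<exists>C f h. good x C f h" using dlim(4)[of x] unfolding ultra_iso_def good_def by blast
      qed
    qed
    \<comment> \<open>Outside the large set of good indices any member of the class serves as a component.\<close>
    define C where "C x = (if \<exists>C f h. good x C f h then SOME C. \<exists>f h. good x C f h else push a D)" for x
    define f where "f x = (SOME f. \<exists>h. good x (C x) f h)" for x
    define h where "h x = (SOME h. good x (C x) (f x) h)" for x
    have gd: "good x (C x) (f x) (h x)" if "\<exists>C f h. good x C f h" for x
    proof -
      have "\<exists>f h. good x (C x) f h" using someI_ex[OF that] that unfolding C_def by simp
      then have "\<exists>h. good x (C x) (f x) h" unfolding f_def by (rule someI_ex)
      then show ?thesis unfolding h_def by (rule someI_ex)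
    qed
    have Cin: "C x \<in> fubini_iterates" for x
    proof (cases "\<exists>C f h. good x C f h")
      case True
      then show ?thesis using gd[OF True] unfolding good_def by blast
    next
      case False
      then have "C x = push a D" unfolding C_def by (rule if_not_P)
      then show ?thesis using aI by simp
    qed
    define L where "L = push p (lim (push a D) (\<lambda>n. push (Pair n) (C (b n))))"
    have "Rep_ultra L \<in> fubini_class_omega1 e p U\<^sub>0"
      unfolding L_def rk_image_Rep[of p, symmetric] fubini_lim_Rep[symmetric]
      by (rule fubini_class_step[OF ab(1)]) (use Cin in blast)
    moreover have L: "L = lim D (\<lambda>x. push (\<lambda>v. p (a x, v)) (C (b (a x))))"
      unfolding L_def push_lim lim_push push_push ..
    have "push (\<lambda>v. p (a (g v), f (g v) v)) (lim D P) = L"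
      unfolding L push_lim
    proof (rule lim_cong)
      have "most D (\<lambda>x. (\<exists>C f h. good x C f h) \<and> b (a x) = x \<and> most (P x) (\<lambda>v. g v = x))"
        using good ab(2) dec by simp
      then show "most D (\<lambda>x. push (\<lambda>v. p (a (g v), f (g v) v)) (P x) = push (\<lambda>v. p (a x, v)) (C (b (a x))))"
      proof (rule most_mono)
        fix x assume x: "(\<exists>C f h. good x C f h) \<and> b (a x) = x \<and> most (P x) (\<lambda>v. g v = x)"
        have "push (\<lambda>v. p (a (g v), f (g v) v)) (P x) = push (\<lambda>v. p (a x, f x v)) (P x)"
          by (rule push_cong, rule most_mono[of _ "\<lambda>v. g v = x"]) (use x in auto)
        also have "\<dots> = push (\<lambda>v. p (a x, v)) (push (f x) (P x))" unfolding push_push ..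
        also have "push (f x) (P x) = C x" using gd x unfolding good_def by blast
        finally show "push (\<lambda>v. p (a (g v), f (g v) v)) (P x) = push (\<lambda>v. p (a x, v)) (C (b (a x)))"
          using x by simp
      qed
    qed
    moreover have "push (\<lambda>m. h (b (fst (inv p m))) (snd (inv p m))) L = lim D P"
      unfolding L push_lim push_push
    proof (rule lim_cong)
      have "most D (\<lambda>x. (\<exists>C f h. good x C f h) \<and> b (a x) = x)" using good ab(2) by simp
      then show "most D (\<lambda>x. push (\<lambda>v. h (b (fst (inv p (p (a x, v))))) (snd (inv p (p (a x, v))))) (C (b (a x))) = P x)"
      proof (rule most_mono)
        fix x assume x: "(\<exists>C f h. good x C f h) \<and> b (a x) = x"
        have ip: "inv p (p y) = y" for y using p by (simp add: bij_is_inj)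
        have "push (h x) (C x) = P x" using gd x unfolding good_def by blast
        then show "push (\<lambda>v. h (b (fst (inv p (p (a x, v))))) (snd (inv p (p (a x, v))))) (C (b (a x))) = P x"
          using x by (simp add: ip)
      qed
    qed
    ultimately have "L \<in> fubini_iterates" "ultra_iso (lim D P) L" unfolding ultra_iso_def by blast+
    then show ?thesis unfolding D_def by blast
  qed
qed

lemma tukey_below_is_iterate:
  assumes I: "countable I" and V: "ultrafilter_on I V" and np: "nonprincipal_on I V" and le: "V \<le>\<^sub>T U\<^sub>0"
  shows "\<exists>W\<in>fubini_class_omega1 e p U\<^sub>0. rk_isomorphic I V (UNIV :: nat set) W"
proof -
  define V' where "V' = ultra_on I V"
  have IV: "I \<in> V" and eV: "{} \<notin> V" using V unfolding ultrafilter_on_def by simp_all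
  have most: "most V' P \<longleftrightarrow> {x\<in>I. P x} \<in> V" for P unfolding V'_def by (rule most_ultra_on[OF V])
  have mem: "Y \<in> V \<longleftrightarrow> most V' (\<lambda>x. x \<in> Y)" if "Y \<subseteq> I" for Y
  proof -
    have "{x\<in>I. x \<in> Y} = Y" using that by blast
    then show ?thesis unfolding most by simp
  qed
  have notpt: "V' \<noteq> point a" for a
  proof
    assume a: "V' = point a"
    have mema: "Y \<in> V \<longleftrightarrow> a \<in> Y" if "Y \<subseteq> I" for Y using mem[OF that] unfolding a by simp
    have "V = {A. A \<subseteq> I \<and> a \<in> A}" using mema ultrafilter_on_subset[OF V] by blast
    moreover have "a \<in> I" using mema[of I] IV by simp
    ultimately show False using np unfolding nonprincipal_on_def by blast
  qed
  have "iterate V'" unfolding V'_def by (rule tukey_iterate[OF U0 I V le])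
  then obtain C where C: "C \<in> fubini_iterates" "ultra_iso V' C" using iterate_point_or_class notpt by blast
  then obtain F B where FB: "push F V' = C" "push B C = V'" unfolding ultra_iso_def by blast
  obtain i0 where i0: "i0 \<in> I" using IV eV by (cases "I = {}") auto
  \<comment> \<open>The inverse map has to take its values in \<open>I\<close>.\<close>
  define B' where "B' n = (if B n \<in> I then B n else i0)" for n
  have "most V' (\<lambda>x. x \<in> I)" using mem[of I] IV by simp
  then have "most C (\<lambda>n. B n \<in> I)" unfolding FB(2)[symmetric] by simp
  then have "most C (\<lambda>n. B' n = B n)" by (rule most_mono) (simp add: B'_def)
  then have B': "push B' C = V'" using push_cong[of C B' B] FB(2) by simp
  have "rk_isomorphic I V UNIV (Rep_ultra C)"
    unfolding rk_isomorphic_def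
  proof (intro exI conjI)
    show "F \<in> I \<rightarrow> UNIV" by simp
    show "B' \<in> UNIV \<rightarrow> I" using i0 by (simp add: B'_def)
    show "rk_image I UNIV F V = Rep_ultra C" unfolding rk_image_ultra_on[OF V] V'_def[symmetric] FB(1) ..
    show "rk_image UNIV I B' (Rep_ultra C) = V"
    proof (intro set_eqI iffI)
      fix Y assume "Y \<in> rk_image UNIV I B' (Rep_ultra C)"
      then have Y: "Y \<subseteq> I" "most C (\<lambda>n. B' n \<in> Y)"
        unfolding rk_image_def by (simp_all add: mem_Rep_ultra)
      then have "most V' (\<lambda>x. x \<in> Y)" unfolding B'[symmetric] by simp
      then show "Y \<in> V" using mem[OF Y(1)] by simp
    next
      fix Y assume Y: "Y \<in> V"
      have YI: "Y \<subseteq> I" by (rule ultrafilter_on_subset[OF V Y])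
      then have "most V' (\<lambda>x. x \<in> Y)" using mem Y by blast
      then have "most C (\<lambda>n. B' n \<in> Y)" unfolding B'[symmetric] by simp
      then show "Y \<in> rk_image UNIV I B' (Rep_ultra C)"
        unfolding rk_image_def using YI by (simp add: mem_Rep_ultra)
    qed
  qed
  then show ?thesis using C(1) by blast
qed

end

theorem theorem5p4:
  fixes U :: "nat set set set"
    and I :: "'i set" and V :: "'i set set"
    and e :: "nat set \<Rightarrow> nat" and p :: "nat \<times> nat \<Rightarrow> nat"
  assumes "bij_betw e FIN UNIV" and "bij p"
    and "stable_ordered_union U"
    and "countable I" and "ultrafilter_on I V" and "nonprincipal_on I V"
    and "V \<le>\<^sub>T U"
  shows "\<exists>W \<in> fubini_class_omega1 e p U. rk_isomorphic I V (UNIV :: nat set) W"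
  using tukey_below_is_iterate[OF assms] .

end
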